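(* Let $F$ be a field of characteristic zero and let $n\in\mathbb N$. Then $\mathrm{rad}^{(k)}\mathcal B_n=\mathcal B_n\cap\mathrm{rad}^{(k)}F\Pi_n$ for all integers $k\ge0$.
   Context: A set composition of $[n]=\{1,\ldots,n\}$ is a tuple $P=(P_1,\ldots,P_l)$ of mutually disjoint non-empty subsets of $[n]$ with union $[n]$; $\Pi_n$ is the set of all of these. $F\Pi_n$ is the $F$-vector space with basis $\Pi_n$, an associative algebra with identity $([n])$ under the bilinear product $(P_1,\ldots,P_l)\wedge(Q_1,\ldots,Q_k)=(P_1\cap Q_1,\ldots,P_1\cap Q_k,\ldots,P_l\cap Q_1,\ldots,P_l\cap Q_k)$ with empty sets deleted (the Solomon-Tits algebra). The symmetric group $S_n$ acts (on the right) on $\Pi_n$ by $(P_1,\ldots,P_l)^\pi=(P_1\pi,\ldots,P_l\pi)$ and, linearly, by algebra automorphisms on $F\Pi_n$; $\mathcal B_n$ is the subalgebra of $S_n$-invariants in $F\Pi_n$ (isomorphic to the Solomon descent algebra of $S_n$ over $F$). For a finite-dimensional associative algebra $\mathcal A$ with identity: $\mathrm{rad}^{(0)}\mathcal A=\mathcal A$ and $\mathrm{rad}^{(k+1)}\mathcal A=(\mathrm{rad}\,\mathcal A)(\mathrm{rad}^{(k)}\mathcal A)$, where $\mathrm{rad}\,\mathcal A$ is the Jacobson radical; so $\mathrm{rad}^{(k)}\mathcal A$ is the $k$th power of the Jacobson radical. *)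

theory Defs
  imports
    "HOL-Algebra.Ideal_Product"
    "HOL-Algebra.Subrings"
    "HOL-Combinatorics.Permutations"
    "HOL-Library.Disjoint_Sets"
begin

section \<open>Jacobson radical and its powers\<close>

locale left_ideal = additive_subgroup I R + ring R for I and R (structure) +
  assumes I_l_closed: "\<lbrakk>a \<in> I; x \<in> carrier R\<rbrakk> \<Longrightarrow> x \<otimes> a \<in> I"

locale max_left_ideal = left_ideal I R for I and R (structure) +
  assumes I_notcarr: "carrier R \<noteq> I"
    and I_maximal: "\<lbrakk>left_ideal J R; I \<subseteq> J; J \<subseteq> carrier R\<rbrakk> \<Longrightarrow> J = I \<or> J = carrier R"

text \<open>
  The Jacobson radical is a purely ring-theoretic notion: in a unital algebra every left ideal
  is automatically a linear subspace, so no scalar action has to be recorded.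
\<close>

definition jacobson_rad :: "('a, 'b) ring_scheme \<Rightarrow> 'a set" where
  "jacobson_rad R = {x \<in> carrier R. \<forall>M. max_left_ideal M R \<longrightarrow> x \<in> M}"

primrec rad_pow :: "('a, 'b) ring_scheme \<Rightarrow> nat \<Rightarrow> 'a set" where
  "rad_pow R 0 = carrier R"
| "rad_pow R (Suc k) = ideal_prod R (jacobson_rad R) (rad_pow R k)"


section \<open>Set compositions\<close>

definition set_comps :: "nat \<Rightarrow> nat set list set" where
  "set_comps n = {P. (\<forall>i<length P. P ! i \<noteq> {}) \<and>
                     disjoint_family_on (\<lambda>i. P ! i) {..<length P} \<and>
                     (\<Union>i<length P. P ! i) = {1..n}}"

definition wedge :: "'a set list \<Rightarrow> 'a set list \<Rightarrow> 'a set list" where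
  "wedge P Q = filter (\<lambda>C. C \<noteq> {}) (concat (map (\<lambda>A. map (\<lambda>B. A \<inter> B) Q) P))"

definition perm_comp :: "(nat \<Rightarrow> nat) \<Rightarrow> nat set list \<Rightarrow> nat set list" where
  "perm_comp \<pi> P = map (image \<pi>) P"


section \<open>The Solomon-Tits algebra and its invariants\<close>

text \<open>
  An element of the algebra is represented by its coefficient function, extended by 0 outside
  the set compositions of \<open>{1..n}\<close>.  The filter in the identity only matters for \<open>n = 0\<close>, where
  the sole set composition is the empty list.
\<close>

definition solomon_tits :: "nat \<Rightarrow> (nat set list \<Rightarrow> 'f::field) ring" where
  "solomon_tits n =
     \<lparr> carrier = {f. \<forall>P. P \<notin> set_comps n \<longrightarrow> f P = 0},
       monoid.mult = (\<lambda>f g R. \<Sum>(P, Q) \<in> {(P, Q) \<in> set_comps n \<times> set_comps n. wedge P Q = R}. f P * g Q),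
       one = (\<lambda>P. if P = filter (\<lambda>C. C \<noteq> {}) [{1..n}] then 1 else 0),
       zero = (\<lambda>P. 0),
       add = (\<lambda>f g P. f P + g P) \<rparr>"

text \<open>Linear extension of the action: \<open>\<Sum> f(P) P\<close> is sent to \<open>\<Sum> f(P) P\<^sup>\<pi>\<close>.\<close>

definition perm_act :: "nat \<Rightarrow> (nat \<Rightarrow> nat) \<Rightarrow> (nat set list \<Rightarrow> 'f::field) \<Rightarrow> nat set list \<Rightarrow> 'f" where
  "perm_act n \<pi> f = (\<lambda>Q. \<Sum>P \<in> {P \<in> set_comps n. perm_comp \<pi> P = Q}. f P)"

definition invariant_algebra :: "nat \<Rightarrow> (nat set list \<Rightarrow> 'f::field) ring" where
  "invariant_algebra n =
     (solomon_tits n)\<lparr> carrier := {f \<in> carrier (solomon_tits n).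
                                     \<forall>\<pi>. \<pi> permutes {1..n} \<longrightarrow> perm_act n \<pi> f = f} \<rparr>"


section \<open>Well-definedness\<close>

lemma set_comps_alt:
  "P \<in> set_comps n \<longleftrightarrow> {} \<notin> set P \<and> sorted_wrt disjnt P \<and> \<Union>(set P) = {1..n}"
proof -
  have "sorted_wrt disjnt P \<longleftrightarrow> disjoint_family_on (\<lambda>i. P ! i) {..<length P}"
  proof
    assume *: "sorted_wrt disjnt P"
    show "disjoint_family_on (\<lambda>i. P ! i) {..<length P}"
      unfolding disjoint_family_on_def
    proof (intro ballI impI)
      fix i j assume "i \<in> {..<length P}" "j \<in> {..<length P}" "i \<noteq> j"
      then show "P ! i \<inter> P ! j = {}"
        using sorted_wrt_nth_less[OF *, of i j] sorted_wrt_nth_less[OF *, of j i]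
        by (cases i j rule: linorder_cases) (auto simp: disjnt_def)
    qed
  next
    assume "disjoint_family_on (\<lambda>i. P ! i) {..<length P}"
    then show "sorted_wrt disjnt P"
      by (auto simp: sorted_wrt_iff_nth_less disjoint_family_on_def disjnt_def)
  qed
  moreover have "(\<forall>i<length P. P ! i \<noteq> {}) \<longleftrightarrow> {} \<notin> set P"
    by (metis in_set_conv_nth)
  moreover have "(\<Union>i<length P. P ! i) = \<Union>(set P)"
    by (auto simp: set_conv_nth)
  ultimately show ?thesis by (simp add: set_comps_def)
qed

lemma finite_set_comps: "finite (set_comps n)"
proof (rule finite_subset)
  show "finite {xs. set xs \<subseteq> Pow {1..n} \<and> distinct xs}"
    by (rule finite_subset_distinct) simp
  show "set_comps n \<subseteq> {xs. set xs \<subseteq> Pow {1..n} \<and> distinct xs}"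
  proof
    fix P assume P: "P \<in> set_comps n"
    have "{} \<notin> set P \<Longrightarrow> sorted_wrt disjnt P \<Longrightarrow> distinct P"
      by (induction P) (auto simp: disjnt_def)
    then show "P \<in> {xs. set xs \<subseteq> Pow {1..n} \<and> distinct xs}"
      using P by (auto simp: set_comps_alt)
  qed
qed

lemma wedge_closed:
  assumes "P \<in> set_comps n" "Q \<in> set_comps n"
  shows "wedge P Q \<in> set_comps n"
proof -
  have row: "sorted_wrt disjnt Q \<Longrightarrow> sorted_wrt disjnt (map ((\<inter>) A) Q)" for A :: "nat set" and Q
    by (induction Q) (auto simp: disjnt_def)
  have "sorted_wrt disjnt P \<Longrightarrow> sorted_wrt disjnt Q \<Longrightarrow>
          sorted_wrt disjnt (concat (map (\<lambda>A. map ((\<inter>) A) Q) P))" for P Q :: "nat set list"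
    by (induction P) (auto simp: sorted_wrt_append row, auto simp: disjnt_def)
  then have "sorted_wrt disjnt (wedge P Q)"
    using assms by (auto simp: set_comps_alt wedge_def intro!: sorted_wrt_filter)
  moreover have "\<Union>(set (wedge P Q)) = \<Union>(set P) \<inter> \<Union>(set Q)"
    by (auto simp: wedge_def)
  ultimately show ?thesis
    using assms by (auto simp: set_comps_alt) (auto simp: wedge_def)
qed

lemma wedge_Nil: "wedge [] Q = []"
  by (simp add: wedge_def)

lemma wedge_Cons: "wedge (A # P) Q = filter (\<lambda>C. C \<noteq> {}) (map ((\<inter>) A) Q) @ wedge P Q"
  by (simp add: wedge_def)

lemma wedge_append: "wedge (P @ P') Q = wedge P Q @ wedge P' Q"
  by (simp add: wedge_def)

lemma wedge_assoc: "wedge (wedge P Q) U = wedge P (wedge Q U)"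
proof (induction P)
  case (Cons A P)
  have *: "wedge (filter (\<lambda>C. C \<noteq> {}) (map ((\<inter>) A) Q)) U
             = filter (\<lambda>C. C \<noteq> {}) (map ((\<inter>) A) (wedge Q U))" for Q
  proof (induction Q)
    case (Cons B Q)
    have "filter (\<lambda>C. C \<noteq> {}) (map ((\<inter>) (A \<inter> B)) U)
        = filter (\<lambda>C. C \<noteq> {}) (map ((\<inter>) A) (filter (\<lambda>C. C \<noteq> {}) (map ((\<inter>) B) U)))"
      by (induction U) (auto simp: Int_assoc)
    moreover have "A \<inter> B = {} \<Longrightarrow> filter (\<lambda>C. C \<noteq> {}) (map ((\<inter>) (A \<inter> B)) U) = []"
      by (induction U) auto
    ultimately show ?case
      using Cons by (auto simp: wedge_Cons)
  qed (simp add: wedge_Nil)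
  show ?case
    using Cons by (simp add: wedge_Cons wedge_append *)
qed (simp add: wedge_Nil)

lemma one_comp: "filter (\<lambda>C. C \<noteq> {}) [{1..n}] \<in> set_comps n"
  by (auto simp: set_comps_alt)

lemma wedge_one:
  assumes "P \<in> set_comps n"
  shows "wedge (filter (\<lambda>C. C \<noteq> {}) [{1..n}]) P = P"
    and "wedge P (filter (\<lambda>C. C \<noteq> {}) [{1..n}]) = P"
proof -
  have P: "{} \<notin> set P" "\<And>A. A \<in> set P \<Longrightarrow> A \<subseteq> {1..n}"
    using assms by (auto simp: set_comps_alt)
  have "filter (\<lambda>C. C \<noteq> {}) (map ((\<inter>) {1..n}) P) = P"
    using P by (induction P) (auto simp: Int_absorb1)
  moreover have "n = 0 \<Longrightarrow> P = []"
    using P by (cases P) force+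
  ultimately show "wedge (filter (\<lambda>C. C \<noteq> {}) [{1..n}]) P = P"
    by (auto simp: wedge_Cons wedge_Nil)
  have "{1..n} \<noteq> {} \<Longrightarrow> wedge P [{1..n}] = P"
    using P by (induction P) (auto simp: wedge_Cons wedge_Nil Int_absorb2)
  then show "wedge P (filter (\<lambda>C. C \<noteq> {}) [{1..n}]) = P"
    using \<open>n = 0 \<Longrightarrow> P = []\<close> by (auto simp: wedge_Nil)
qed

lemma mult_alt:
  "(f \<otimes>\<^bsub>solomon_tits n\<^esub> g) R =
     (\<Sum>P\<in>set_comps n. \<Sum>Q\<in>set_comps n. if wedge P Q = R then f P * g Q else 0)"
proof -
  let ?S = "set_comps n"
  have "(f \<otimes>\<^bsub>solomon_tits n\<^esub> g) R = (\<Sum>(P, Q) \<in> {z \<in> ?S \<times> ?S. wedge (fst z) (snd z) = R}. f P * g Q)"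
    by (auto simp: solomon_tits_def intro!: sum.cong)
  also have "\<dots> = (\<Sum>z \<in> ?S \<times> ?S. if wedge (fst z) (snd z) = R then f (fst z) * g (snd z) else 0)"
    by (subst sum.inter_filter) (auto simp: finite_set_comps intro!: sum.cong)
  finally show ?thesis
    by (simp add: sum.cartesian_product case_prod_unfold)
qed

lemma mult_closed: 
  "f \<otimes>\<^bsub>solomon_tits n\<^esub> g \<in> carrier (solomon_tits n)"
proof -
  have "(f \<otimes>\<^bsub>solomon_tits n\<^esub> g) R = 0" if "R \<notin> set_comps n" for R
    unfolding mult_alt using that wedge_closed by (intro sum.neutral ballI) auto
  then show ?thesis by (simp add: solomon_tits_def)
qed

lemma sum_mult_weighted:
  fixes h :: "nat set list \<Rightarrow> 'f::field"
  shows "(\<Sum>T\<in>set_comps n. (f \<otimes>\<^bsub>solomon_tits n\<^esub> g) T * h T)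
       = (\<Sum>P\<in>set_comps n. \<Sum>Q\<in>set_comps n. f P * g Q * h (wedge P Q))"
proof -
  let ?S = "set_comps n"
  have "(\<Sum>T\<in>?S. (f \<otimes>\<^bsub>solomon_tits n\<^esub> g) T * h T)
      = (\<Sum>T\<in>?S. \<Sum>P\<in>?S. \<Sum>Q\<in>?S. if wedge P Q = T then f P * g Q * h T else 0)"
    unfolding mult_alt sum_distrib_right by (intro sum.cong refl) auto
  also have "\<dots> = (\<Sum>P\<in>?S. \<Sum>T\<in>?S. \<Sum>Q\<in>?S. if wedge P Q = T then f P * g Q * h T else 0)"
    by (rule sum.swap)
  also have "\<dots> = (\<Sum>P\<in>?S. \<Sum>Q\<in>?S. \<Sum>T\<in>?S. if wedge P Q = T then f P * g Q * h T else 0)"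
    by (rule sum.cong[OF refl], rule sum.swap)
  also have "\<dots> = (\<Sum>P\<in>?S. \<Sum>Q\<in>?S. f P * g Q * h (wedge P Q))"
    by (intro sum.cong refl) (simp add: finite_set_comps wedge_closed)
  finally show ?thesis .
qed

lemma mult_assoc:
  fixes f g h :: "nat set list \<Rightarrow> 'f::field"
  shows "f \<otimes>\<^bsub>solomon_tits n\<^esub> g \<otimes>\<^bsub>solomon_tits n\<^esub> h
       = f \<otimes>\<^bsub>solomon_tits n\<^esub> (g \<otimes>\<^bsub>solomon_tits n\<^esub> h)"
proof
  fix R
  let ?S = "set_comps n"
  have pull: "(p \<otimes>\<^bsub>solomon_tits n\<^esub> q) R
      = (\<Sum>T\<in>?S. p T * (\<Sum>U\<in>?S. if wedge T U = R then q U else 0))" for p q :: "nat set list \<Rightarrow> 'f"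
    unfolding mult_alt sum_distrib_left by (intro sum.cong refl) auto
  have "(f \<otimes>\<^bsub>solomon_tits n\<^esub> g \<otimes>\<^bsub>solomon_tits n\<^esub> h) R
      = (\<Sum>P\<in>?S. \<Sum>Q\<in>?S. f P * g Q * (\<Sum>U\<in>?S. if wedge (wedge P Q) U = R then h U else 0))"
    unfolding pull by (rule sum_mult_weighted)
  also have "\<dots> = (\<Sum>P\<in>?S. \<Sum>Q\<in>?S. \<Sum>U\<in>?S. g Q * h U * (if wedge P (wedge Q U) = R then f P else 0))"
    unfolding sum_distrib_left wedge_assoc by (intro sum.cong refl) auto
  also have "\<dots> = (\<Sum>P\<in>?S. \<Sum>T\<in>?S. (g \<otimes>\<^bsub>solomon_tits n\<^esub> h) T * (if wedge P T = R then f P else 0))"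
    unfolding sum_mult_weighted ..
  also have "\<dots> = (f \<otimes>\<^bsub>solomon_tits n\<^esub> (g \<otimes>\<^bsub>solomon_tits n\<^esub> h)) R"
    unfolding mult_alt[where f = f] by (intro sum.cong refl) auto
  finally show "(f \<otimes>\<^bsub>solomon_tits n\<^esub> g \<otimes>\<^bsub>solomon_tits n\<^esub> h) R
       = (f \<otimes>\<^bsub>solomon_tits n\<^esub> (g \<otimes>\<^bsub>solomon_tits n\<^esub> h)) R" .
qed

lemma mult_one:
  fixes f :: "nat set list \<Rightarrow> 'f::field"
  assumes "f \<in> carrier (solomon_tits n)"
  shows "\<one>\<^bsub>solomon_tits n\<^esub> \<otimes>\<^bsub>solomon_tits n\<^esub> f = f"
    and "f \<otimes>\<^bsub>solomon_tits n\<^esub> \<one>\<^bsub>solomon_tits n\<^esub> = f"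
proof -
  let ?S = "set_comps n" and ?e = "filter (\<lambda>C. C \<noteq> {}) [{1..n}]"
  have one: "\<one>\<^bsub>solomon_tits n\<^esub> P = (if P = ?e then 1 else (0::'f))" for P
    by (simp add: solomon_tits_def)
  have f: "f R = 0" if "R \<notin> ?S" for R
    using assms that by (simp add: solomon_tits_def)
  show "\<one>\<^bsub>solomon_tits n\<^esub> \<otimes>\<^bsub>solomon_tits n\<^esub> f = f"
  proof
    fix R
    have "(\<one>\<^bsub>solomon_tits n\<^esub> \<otimes>\<^bsub>solomon_tits n\<^esub> f) R
        = (\<Sum>P\<in>?S. if P = ?e then \<Sum>Q\<in>?S. if wedge P Q = R then f Q else 0 else 0)"
      unfolding mult_alt one by (intro sum.cong refl) (auto simp: intro!: sum.neutral sum.cong)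
    also have "\<dots> = (\<Sum>Q\<in>?S. if wedge ?e Q = R then f Q else 0)"
      using one_comp[of n] by (simp only: sum.delta[OF finite_set_comps] if_True)
    also have "\<dots> = (\<Sum>Q\<in>?S. if Q = R then f Q else 0)"
      by (intro sum.cong refl) (simp only: wedge_one)
    also have "\<dots> = f R"
      using f by (auto simp: finite_set_comps)
    finally show "(\<one>\<^bsub>solomon_tits n\<^esub> \<otimes>\<^bsub>solomon_tits n\<^esub> f) R = f R" .
  qed
  show "f \<otimes>\<^bsub>solomon_tits n\<^esub> \<one>\<^bsub>solomon_tits n\<^esub> = f"
  proof
    fix R
    have "(f \<otimes>\<^bsub>solomon_tits n\<^esub> \<one>\<^bsub>solomon_tits n\<^esub>) R
        = (\<Sum>P\<in>?S. \<Sum>Q\<in>?S. if Q = ?e then (if wedge P Q = R then f P else 0) else 0)"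
      unfolding mult_alt one by (intro sum.cong refl) auto
    also have "\<dots> = (\<Sum>P\<in>?S. if wedge P ?e = R then f P else 0)"
      using one_comp[of n] by (simp only: sum.delta[OF finite_set_comps] if_True)
    also have "\<dots> = (\<Sum>P\<in>?S. if P = R then f P else 0)"
      by (intro sum.cong refl) (simp only: wedge_one)
    also have "\<dots> = f R"
      using f by (auto simp: finite_set_comps)
    finally show "(f \<otimes>\<^bsub>solomon_tits n\<^esub> \<one>\<^bsub>solomon_tits n\<^esub>) R = f R" .
  qed
qed

lemma ring_solomon_tits: "ring (solomon_tits n :: (nat set list \<Rightarrow> 'f::field) ring)"
proof (rule ringI)
  show "abelian_group (solomon_tits n :: (nat set list \<Rightarrow> 'f::field) ring)"
  proof (rule abelian_groupI)
    fix f :: "nat set list \<Rightarrow> 'f" assume "f \<in> carrier (solomon_tits n)"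
    then show "\<exists>g\<in>carrier (solomon_tits n). g \<oplus>\<^bsub>solomon_tits n\<^esub> f = \<zero>\<^bsub>solomon_tits n\<^esub>"
      by (intro bexI[of _ "\<lambda>P. - f P"]) (auto simp: solomon_tits_def)
  qed (auto simp: solomon_tits_def algebra_simps)
  show "Group.monoid (solomon_tits n :: (nat set list \<Rightarrow> 'f::field) ring)"
  proof (rule monoidI)
    show "\<one>\<^bsub>solomon_tits n\<^esub> \<in> carrier (solomon_tits n :: (nat set list \<Rightarrow> 'f::field) ring)"
      using one_comp[of n] by (auto simp: solomon_tits_def)
  qed (auto simp: mult_closed mult_assoc mult_one)
next
  fix f g h :: "nat set list \<Rightarrow> 'f"
  have add: "(f \<oplus>\<^bsub>solomon_tits n\<^esub> g) P = f P + g P" for f g :: "nat set list \<Rightarrow> 'f" and P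
    by (simp add: solomon_tits_def)
  show "(f \<oplus>\<^bsub>solomon_tits n\<^esub> g) \<otimes>\<^bsub>solomon_tits n\<^esub> h
      = f \<otimes>\<^bsub>solomon_tits n\<^esub> h \<oplus>\<^bsub>solomon_tits n\<^esub> g \<otimes>\<^bsub>solomon_tits n\<^esub> h"
    by (rule ext) (auto simp: mult_alt add distrib_right simp flip: sum.distrib intro!: sum.cong)
  show "h \<otimes>\<^bsub>solomon_tits n\<^esub> (f \<oplus>\<^bsub>solomon_tits n\<^esub> g)
      = h \<otimes>\<^bsub>solomon_tits n\<^esub> f \<oplus>\<^bsub>solomon_tits n\<^esub> h \<otimes>\<^bsub>solomon_tits n\<^esub> g"
    by (rule ext) (auto simp: mult_alt add distrib_left simp flip: sum.distrib intro!: sum.cong)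
qed

lemma wedge_perm_comp:
  assumes "inj \<pi>"
  shows "wedge (perm_comp \<pi> P) (perm_comp \<pi> Q) = perm_comp \<pi> (wedge P Q)"
proof (induction P)
  case (Cons A P)
  have "filter (\<lambda>C. C \<noteq> {}) (map ((\<inter>) (\<pi> ` A)) (map (image \<pi>) Q))
      = map (image \<pi>) (filter (\<lambda>C. C \<noteq> {}) (map ((\<inter>) A) Q))"
    by (induction Q) (auto simp flip: image_Int[OF assms])
  then show ?case
    using Cons by (simp add: perm_comp_def wedge_Cons)
qed (simp add: perm_comp_def wedge_Nil)

lemma perm_comp_inj: "inj \<pi> \<Longrightarrow> perm_comp \<pi> P = perm_comp \<pi> Q \<longleftrightarrow> P = Q"
  unfolding perm_comp_def by (simp add: inj_map_eq_map inj_image_eq_iff inj_def)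

lemma perm_comp_closed:
  assumes "\<pi> permutes {1..n}" "P \<in> set_comps n"
  shows "perm_comp \<pi> P \<in> set_comps n"
proof -
  have inj: "inj \<pi>" using assms(1) by (rule permutes_inj)
  have "sorted_wrt disjnt P \<Longrightarrow> sorted_wrt disjnt (map (image \<pi>) P)" for P
    unfolding sorted_wrt_map by (rule sorted_wrt_mono_rel) (auto simp: disjnt_def inj_eq[OF inj])
  moreover have "\<Union>(set (map (image \<pi>) P)) = \<pi> ` \<Union>(set P)"
    by auto
  ultimately show ?thesis
    using assms(2) permutes_image[OF assms(1)] unfolding set_comps_alt perm_comp_def by auto
qed

lemma perm_comp_bij:
  assumes "\<pi> permutes {1..n}"
  shows "bij_betw (perm_comp \<pi>) (set_comps n) (set_comps n)"
  unfolding bij_betw_def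
proof
  show inj: "inj_on (perm_comp \<pi>) (set_comps n)"
    by (rule inj_onI) (simp add: perm_comp_inj[OF permutes_inj[OF assms]])
  show "perm_comp \<pi> ` set_comps n = set_comps n"
    by (rule endo_inj_surj[OF finite_set_comps _ inj]) (use perm_comp_closed[OF assms] in blast)
qed

lemma perm_act_perm_comp:
  assumes "\<pi> permutes {1..n}" "P \<in> set_comps n"
  shows "perm_act n \<pi> f (perm_comp \<pi> P) = f P"
proof -
  have "{P' \<in> set_comps n. perm_comp \<pi> P' = perm_comp \<pi> P} = {P}"
    using assms by (auto simp: perm_comp_inj[OF permutes_inj[OF assms(1)]])
  then show ?thesis by (simp add: perm_act_def)
qed

lemma invariant_alt:
  "f \<in> carrier (invariant_algebra n) \<longleftrightarrow> f \<in> carrier (solomon_tits n) \<and>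
     (\<forall>\<pi>. \<pi> permutes {1..n} \<longrightarrow> (\<forall>P\<in>set_comps n. f (perm_comp \<pi> P) = f P))"
proof -
  have "perm_act n \<pi> f = f \<longleftrightarrow> (\<forall>P\<in>set_comps n. f (perm_comp \<pi> P) = f P)"
    if f: "f \<in> carrier (solomon_tits n)" and \<pi>: "\<pi> permutes {1..n}" for \<pi>
  proof
    assume "perm_act n \<pi> f = f"
    then show "\<forall>P\<in>set_comps n. f (perm_comp \<pi> P) = f P"
      using perm_act_perm_comp[OF \<pi>, of _ f] by simp
  next
    assume *: "\<forall>P\<in>set_comps n. f (perm_comp \<pi> P) = f P"
    show "perm_act n \<pi> f = f"
    proof
      fix Q
      show "perm_act n \<pi> f Q = f Q"
      proof (cases "Q \<in> set_comps n")
        case True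
        then obtain P where "P \<in> set_comps n" "Q = perm_comp \<pi> P"
          using perm_comp_bij[OF \<pi>] unfolding bij_betw_def by blast
        then show ?thesis using * perm_act_perm_comp[OF \<pi>, of P f] by simp
      next
        case False
        then have "{P \<in> set_comps n. perm_comp \<pi> P = Q} = {}"
          using perm_comp_closed[OF \<pi>] by blast
        then have "perm_act n \<pi> f Q = 0" unfolding perm_act_def by (simp only: sum.empty)
        then show ?thesis using f False by (simp add: solomon_tits_def)
      qed
    qed
  qed
  then show ?thesis by (auto simp: invariant_algebra_def)
qed

lemma subring_invariant_algebra:
  "subring (carrier (invariant_algebra n)) (solomon_tits n :: (nat set list \<Rightarrow> 'f::field) ring)"
proof -
  interpret ring "solomon_tits n :: (nat set list \<Rightarrow> 'f) ring" by (rule ring_solomon_tits)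
  show ?thesis
  proof (rule subringI)
    show "carrier (invariant_algebra n) \<subseteq> carrier (solomon_tits n)"
      by (auto simp: invariant_alt)
  next
    show "\<one>\<^bsub>solomon_tits n\<^esub> \<in> carrier (invariant_algebra n :: (nat set list \<Rightarrow> 'f) ring)"
      unfolding invariant_alt
    proof (intro conjI allI impI ballI)
      fix \<pi> P assume \<pi>: "\<pi> permutes {1..n}"
      let ?e = "filter (\<lambda>C. C \<noteq> {}) [{1..n}]"
      have "perm_comp \<pi> ?e = ?e"
        using permutes_image[OF \<pi>] by (auto simp: perm_comp_def)
      then have "perm_comp \<pi> P = ?e \<longleftrightarrow> P = ?e"
        using perm_comp_inj[OF permutes_inj[OF \<pi>], of P ?e] by argo
      then show "\<one>\<^bsub>solomon_tits n\<^esub> (perm_comp \<pi> P) = (\<one>\<^bsub>solomon_tits n\<^esub> P :: 'f)"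
        by (simp only: solomon_tits_def monoid.select_convs)
    qed simp
  next
    fix f :: "nat set list \<Rightarrow> 'f" assume f: "f \<in> carrier (invariant_algebra n)"
    then have fc: "f \<in> carrier (solomon_tits n)" by (simp add: invariant_alt)
    have "(\<ominus>\<^bsub>solomon_tits n\<^esub> f) = (\<lambda>P. - f P)"
      using fc by (intro minus_equality) (auto simp: solomon_tits_def)
    then show "\<ominus>\<^bsub>solomon_tits n\<^esub> f \<in> carrier (invariant_algebra n)"
      using f by (auto simp: invariant_alt solomon_tits_def)
  next
    fix f g :: "nat set list \<Rightarrow> 'f"
    assume f: "f \<in> carrier (invariant_algebra n)" and g: "g \<in> carrier (invariant_algebra n)"
    show "f \<oplus>\<^bsub>solomon_tits n\<^esub> g \<in> carrier (invariant_algebra n)"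
      using f g by (auto simp: invariant_alt solomon_tits_def)
    show "f \<otimes>\<^bsub>solomon_tits n\<^esub> g \<in> carrier (invariant_algebra n)"
      unfolding invariant_alt
    proof (intro conjI allI impI ballI mult_closed)
      fix \<pi> R assume \<pi>: "\<pi> permutes {1..n}"
      let ?S = "set_comps n" and ?p = "perm_comp \<pi>"
      note inj = permutes_inj[OF \<pi>]
      have reindex: "(\<Sum>P\<in>?S. h P) = (\<Sum>P\<in>?S. h (?p P))" for h :: "nat set list \<Rightarrow> 'f"
        by (rule sum.reindex_bij_betw[OF perm_comp_bij[OF \<pi>], symmetric])
      have "(f \<otimes>\<^bsub>solomon_tits n\<^esub> g) (?p R)
          = (\<Sum>P\<in>?S. \<Sum>Q\<in>?S. if wedge (?p P) (?p Q) = ?p R then f (?p P) * g (?p Q) else 0)"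
        unfolding mult_alt by (rule trans[OF reindex], rule sum.cong[OF refl], rule reindex)
      also have "\<dots> = (f \<otimes>\<^bsub>solomon_tits n\<^esub> g) R"
        unfolding mult_alt wedge_perm_comp[OF inj] perm_comp_inj[OF inj]
        using f g \<pi> by (intro sum.cong refl) (simp add: invariant_alt)
      finally show "(f \<otimes>\<^bsub>solomon_tits n\<^esub> g) (?p R) = (f \<otimes>\<^bsub>solomon_tits n\<^esub> g) R" .
    qed
  qed
qed

lemma ring_invariant_algebra: "ring (invariant_algebra n :: (nat set list \<Rightarrow> 'f::field) ring)"
  using ring.subring_is_ring[OF ring_solomon_tits subring_invariant_algebra]
  by (simp add: invariant_algebra_def)

end

theory Submission
  imports Defs "HOL-Library.Poly_Mapping" "HOL-Library.Product_Plus"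
begin

text \<open>
  Both algebras are studied inside free associative algebras. A set composition is a word whose
  letters are sets, so the Solomon-Tits algebra is a subspace of the free algebra \<open>T\<close>
  on sets. An invariant depends on block sizes only, so it is the expansion of an element of the
  free algebra \<open>N\<close> on letters \<open>h\<^sub>1, h\<^sub>2, \<dots>\<close>, the
  noncommutative symmetric functions: a word \<open>h\<^sub>c h\<^sub>d \<dots>\<close> expands to
  the sum of all set compositions with block sizes \<open>c, d, \<dots>\<close>. Every ring has a
  smallest multiplicative filtration \<open>C\<^sub>0, C\<^sub>1, \<dots>\<close> for which the
  commutator of \<open>C\<^sub>s\<close> and \<open>C\<^sub>t\<close> lies in
  \<open>C\<^sub>s\<^sub>+\<^sub>t\<^sub>+\<^sub>1\<close>. The theorem holds because the
  \<open>k\<close>th radical power of the Solomon-Tits algebra lies in \<open>C\<^sub>k\<close>,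
  and invariants in \<open>C\<^sub>k\<close> lie in the \<open>k\<close>th radical power of the
  algebra of invariants. The other inclusion is a comparison of the two radicals.

  The radical of the Solomon-Tits algebra is the kernel of the support map, which forgets the
  order of the blocks: characters kill the radical, and the kernel is nil. Hence a radical element
  is a combination of differences \<open>P - P'\<close> where \<open>P'\<close> rearranges
  \<open>P\<close>. If \<open>x\<close> lies in \<open>C\<^sub>k\<close>, then the difference of
  \<open>P \<and> x\<close> and \<open>P' \<and> x\<close> lies in
  \<open>C\<^sub>k\<^sub>+\<^sub>1\<close> (\<open>cfilt_wedge_lin_perm\<close>), because
  exchanging two neighbouring parts of a product is a commutator. So the \<open>k\<close>th
  radical power lies in \<open>C\<^sub>k\<close>.

  Invariants are carried from \<open>T\<close> to \<open>N\<close> by the homomorphism that sends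
  the letter \<open>A\<close> to \<open>|A|! h\<close> of degree \<open>|A|\<close>. Homomorphisms
  respect the filtration, and up to the factor \<open>n!\<close> this one inverts the expansion
  (\<open>expand_forget\<close>). So an invariant in the \<open>k\<close>th radical power of the
  big algebra is the expansion of an element of \<open>C\<^sub>k\<close> in \<open>N\<close>.

  It remains to write such expansions as products of \<open>k\<close> radical invariants, by
  induction on \<open>k\<close>. Let \<open>p\<^sub>1, p\<^sub>2, \<dots>\<close> be the primitive
  generators given by Newton's identities, and let \<open>D\<close> be the derivation of
  \<open>N\<close> with
  \<open>D h\<^sub>n = [p\<^sub>a, p\<^sub>b] h\<^sub>n\<^sub>-\<^sub>a\<^sub>-\<^sub>b\<close>,
  read as 0 if \<open>n < a + b\<close>. Since \<open>[p\<^sub>a, p\<^sub>b]\<close> is primitive,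
  \<open>D\<close> is also a coderivation, and this makes it the right multiplication by the
  expansion of \<open>D h\<^sub>n\<close>, a radical invariant
  (\<open>collapse_pair_insertion\<close>). So \<open>D\<close> turns
  \<open>C\<^sub>k\<^sub>-\<^sub>1\<close> into elements of the \<open>k\<close>th radical power.
  Modulo terms of higher filtration, \<open>D\<close> replaces the generator of degree
  \<open>a + b\<close> by \<open>(a + b) [p\<^sub>a, p\<^sub>b]\<close> and kills the others. Now
  \<open>C\<^sub>k\<close> is spanned by products of left-normed brackets with at least
  \<open>k\<close> commutators, and \<open>brk_prod_in_subspace\<close> shows that the images of
  these derivations exhaust \<open>C\<^sub>k\<close> modulo
  \<open>C\<^sub>k\<^sub>+\<^sub>1\<close>. As \<open>C\<^sub>k\<close> contributes nothing for
  \<open>k > n\<close>, this suffices.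
\<close>

section \<open>Words and linear maps between monoid algebras\<close>

text \<open>
  A copy of lists with concatenation as addition, so that finitely supported functions on words
  form the free associative algebra.
\<close>

datatype 'a word = Word (letters: "'a list")

instantiation word :: (type) monoid_add
begin

definition zero_word_def: "0 = Word []"
definition plus_word_def: "v + w = Word (letters v @ letters w)"

instance
  by standard (simp_all add: zero_word_def plus_word_def)

end

lemma letters_simps [simp]: "letters 0 = []" "letters (v + w) = letters v @ letters w"
  by (simp_all add: zero_word_def plus_word_def)

lemma Word_Nil: "Word [] = 0"
  by (simp add: zero_word_def)

lemma Word_append: "Word (u @ v) = Word u + Word v"
  by (simp add: plus_word_def)

instance prod :: (monoid_add, monoid_add) monoid_add
  by standard (simp_all add: prod_eq_iff add.assoc)

abbreviation (input) "lookup \<equiv> Poly_Mapping.lookup"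
abbreviation (input) "keys \<equiv> Poly_Mapping.keys"

abbreviation basis :: "'a \<Rightarrow> 'a \<Rightarrow>\<^sub>0 'f::field" where
  "basis w \<equiv> Poly_Mapping.single w 1"

lemma basis_add: "basis (v + w) = (basis v * basis w :: 'a::monoid_add \<Rightarrow>\<^sub>0 'f::field)"
  by (simp add: mult_single)

definition scl :: "'f \<Rightarrow> ('a::monoid_add \<Rightarrow>\<^sub>0 'f) \<Rightarrow> 'a \<Rightarrow>\<^sub>0 'f::field" where
  "scl c x = Poly_Mapping.single 0 c * x"

lemma lookup_scl [simp]: "lookup (scl c x) w = c * lookup x w"
  unfolding scl_def mult_map_scale_conv_mult[symmetric]
  by (simp add: Poly_Mapping.map.rep_eq when_def)

lemma scl_one [simp]: "scl 1 x = x"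
  and scl_zero [simp]: "scl 0 x = 0" "scl c 0 = 0"
  and scl_add: "scl c (x + y) = scl c x + scl c y"
  and scl_add_left: "scl (c + d) x = scl c x + scl d x"
  and scl_diff: "scl c (x - y) = scl c x - scl c y"
  and scl_scl [simp]: "scl c (scl d x) = scl (c * d) x"
  and scl_minus_one: "scl (- 1) x = - x"
  by (rule poly_mapping_eqI, simp add: lookup_add lookup_minus algebra_simps)+

lemma scl_mult_left: "scl c x * y = scl c (x * y)"
  by (simp add: scl_def mult.assoc)

lemma scl_sum: "scl c (sum f A) = (\<Sum>a\<in>A. scl c (f a))"
  by (simp add: scl_def sum_distrib_left)

lemma scl_of_nat: "scl (of_nat n) x = of_nat n * x"
  by (simp add: scl_def)

interpretation ncp: vector_space "scl :: 'f::field \<Rightarrow> ('a::monoid_add \<Rightarrow>\<^sub>0 'f) \<Rightarrow> _"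
  by standard (simp_all add: scl_add scl_add_left)

lemma poly_mapping_expand:
  fixes x :: "'a::monoid_add \<Rightarrow>\<^sub>0 'f::field"
  shows "x = (\<Sum>w\<in>keys x. scl (lookup x w) (basis w))"
proof (rule poly_mapping_eqI)
  fix v
  have "lookup (\<Sum>w\<in>keys x. scl (lookup x w) (basis w)) v = (\<Sum>w\<in>keys x. if w = v then lookup x w else 0)"
    unfolding lookup_sum by (intro sum.cong refl) (simp add: lookup_single when_def)
  also have "\<dots> = lookup x v"
    by (simp add: in_keys_iff)
  finally show "lookup x v = lookup (\<Sum>w\<in>keys x. scl (lookup x w) (basis w)) v" ..
qed

lemma poly_mapping_linear_induct [case_names zero basis add scl]:
  fixes x :: "'a::monoid_add \<Rightarrow>\<^sub>0 'f::field"
  assumes "Q 0" "\<And>w. Q (basis w)" "\<And>x y. Q x \<Longrightarrow> Q y \<Longrightarrow> Q (x + y)" "\<And>c x. Q x \<Longrightarrow> Q (scl c x)"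
  shows "Q x"
proof -
  have "Q (\<Sum>w\<in>A. scl (lookup x w) (basis w))" if "finite A" for A
    using that by induction (auto intro: assms)
  then show ?thesis by (subst poly_mapping_expand) simp
qed

lemma single_zero_central: "Poly_Mapping.single 0 c * x = x * Poly_Mapping.single 0 (c::'f::field)"
proof (induction x rule: poly_mapping_linear_induct)
  case (scl d x)
  have "Poly_Mapping.single 0 c * scl d x = Poly_Mapping.single 0 d * (Poly_Mapping.single 0 c * x)"
    unfolding scl_def by (simp add: mult_single mult.commute flip: mult.assoc)
  then show ?case
    unfolding scl scl_def by (simp add: mult.assoc)
qed (simp_all add: mult_single algebra_simps)

lemma scl_mult_right: "x * scl c y = scl c (x * y)"
  by (metis scl_def mult.assoc single_zero_central)

definition linop :: "(('a::monoid_add \<Rightarrow>\<^sub>0 'f::field) \<Rightarrow> ('b::monoid_add \<Rightarrow>\<^sub>0 'f)) \<Rightarrow> bool" where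
  "linop F \<longleftrightarrow> (\<forall>x y. F (x + y) = F x + F y) \<and> (\<forall>c x. F (scl c x) = scl c (F x))"

lemma linop_add: "linop F \<Longrightarrow> F (x + y) = F x + F y"
  and linop_scl: "linop F \<Longrightarrow> F (scl c x) = scl c (F x)"
  by (simp_all add: linop_def)

lemma linop_zero: "linop F \<Longrightarrow> F 0 = 0"
  using linop_scl[of F 0 0] by simp

lemma linop_diff: "linop F \<Longrightarrow> F (x - y) = F x - F y"
  using linop_add[of F x "scl (- 1) y"] linop_scl[of F "- 1" y] by (simp add: scl_minus_one)

lemma linop_sum:
  assumes "linop F"
  shows "F (sum f A) = (\<Sum>a\<in>A. F (f a))"
  by (induction A rule: infinite_finite_induct)
     (simp_all add: linop_zero[OF assms] linop_add[OF assms])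

lemma linop_ext:
  assumes "linop F" "linop G" "\<And>w. F (basis w) = G (basis w)"
  shows "F x = G x"
  by (induction x rule: poly_mapping_linear_induct)
     (simp_all add: assms(3) linop_zero[OF assms(1)] linop_add[OF assms(1)] linop_scl[OF assms(1)]
       linop_zero[OF assms(2)] linop_add[OF assms(2)] linop_scl[OF assms(2)])

lemma linop_ident: "linop (\<lambda>x. x)"
  by (simp add: linop_def)

lemma linop_comp: "linop F \<Longrightarrow> linop G \<Longrightarrow> linop (\<lambda>x. F (G x))"
  by (simp add: linop_def)

lemma linop_minus: "linop F \<Longrightarrow> linop G \<Longrightarrow> linop (\<lambda>x. F x - G x)"
  and linop_scl_fun: "linop F \<Longrightarrow> linop (\<lambda>x. scl c (F x))"
  by (simp_all add: linop_def algebra_simps scl_diff)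

definition lin :: "('a \<Rightarrow> ('b::monoid_add \<Rightarrow>\<^sub>0 'f::field)) \<Rightarrow> ('a \<Rightarrow>\<^sub>0 'f) \<Rightarrow> 'b \<Rightarrow>\<^sub>0 'f" where
  "lin \<phi> x = (\<Sum>w\<in>keys x. scl (lookup x w) (\<phi> w))"

lemma lin_superset:
  assumes "finite A" "keys x \<subseteq> A"
  shows "lin \<phi> x = (\<Sum>w\<in>A. scl (lookup x w) (\<phi> w))"
  unfolding lin_def using assms by (intro sum.mono_neutral_left) (auto simp: in_keys_iff)

lemma linop_lin [simp]: "linop (lin \<phi>)"
  unfolding linop_def
proof (intro conjI allI)
  fix x y :: "'a \<Rightarrow>\<^sub>0 'b" and c :: 'b
  let ?A = "keys x \<union> keys y"
  have "lin \<phi> (x + y) = (\<Sum>w\<in>?A. scl (lookup (x + y) w) (\<phi> w))"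
    by (rule lin_superset) (use Poly_Mapping.keys_add[of x y] in auto)
  also have "\<dots> = (\<Sum>w\<in>?A. scl (lookup x w) (\<phi> w)) + (\<Sum>w\<in>?A. scl (lookup y w) (\<phi> w))"
    by (simp add: lookup_add scl_add_left sum.distrib)
  finally show "lin \<phi> (x + y) = lin \<phi> x + lin \<phi> y"
    by (simp add: lin_superset[of ?A])
  have "keys (scl c x) \<subseteq> keys x"
    by (auto simp: in_keys_iff)
  then show "lin \<phi> (scl c x) = scl c (lin \<phi> x)"
    by (simp add: lin_superset[of "keys x"] scl_sum)
qed

lemma lin_basis [simp]: "lin \<phi> (basis w) = \<phi> w"
  by (simp add: lin_def)

lemmas lin_add = linop_add[OF linop_lin]
  and lin_scl = linop_scl[OF linop_lin]
  and lin_diff = linop_diff[OF linop_lin]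
  and lin_sum = linop_sum[OF linop_lin]
  and lin_zero = linop_zero[OF linop_lin]

lemmas linop_simps = linop_def lin_add lin_scl distrib_left distrib_right
  scl_add scl_diff scl_mult_left scl_mult_right

lemma lin_mult:
  assumes "\<And>v w. \<phi> (v + w) = \<phi> v * \<phi> w"
  shows "lin \<phi> (x * y) = lin \<phi> x * lin \<phi> y"
proof -
  have left: "lin \<phi> (basis v * y) = \<phi> v * lin \<phi> y" for v
    by (rule linop_ext[of "\<lambda>y. lin \<phi> (basis v * y)" "\<lambda>y. \<phi> v * lin \<phi> y"])
       (simp_all add: linop_simps assms flip: basis_add)
  show ?thesis
    by (rule linop_ext[of "\<lambda>x. lin \<phi> (x * y)" "\<lambda>x. lin \<phi> x * lin \<phi> y"])
       (simp_all add: linop_simps left)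
qed

definition letter :: "'a \<Rightarrow> 'a word \<Rightarrow>\<^sub>0 'f::field" where
  "letter a = basis (Word [a])"

lemma basis_Cons: "basis (Word (a # w)) = letter a * basis (Word w)"
  by (simp add: letter_def mult_single flip: Word_append)

text \<open>
  The algebra homomorphism out of the free algebra that is determined by the images of the letters.
\<close>

definition lift :: "('a \<Rightarrow> ('b::monoid_add \<Rightarrow>\<^sub>0 'f::field)) \<Rightarrow> ('a word \<Rightarrow>\<^sub>0 'f) \<Rightarrow> 'b \<Rightarrow>\<^sub>0 'f" where
  "lift \<psi> = lin (\<lambda>w. prod_list (map \<psi> (letters w)))"

lemma lift_mult: "lift \<psi> (x * y) = lift \<psi> x * lift \<psi> y"
  unfolding lift_def by (rule lin_mult) simp

lemma linop_lift [simp]: "linop (lift \<psi>)"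
  by (simp add: lift_def)

lemma lift_letter [simp]: "lift \<psi> (letter a) = \<psi> a"
  by (simp add: lift_def letter_def)

lemma lift_one [simp]: "lift \<psi> 1 = 1"
  unfolding single_one[symmetric] lift_def lin_basis by simp


section \<open>Tensor squares\<close>

text \<open>
  The tensor product of two monoid algebras is the monoid algebra of the product monoid; this is
  the embedding of pure tensors.
\<close>

definition tens :: "('a::monoid_add \<Rightarrow>\<^sub>0 'f::field) \<Rightarrow> ('b::monoid_add \<Rightarrow>\<^sub>0 'f) \<Rightarrow> 'a \<times> 'b \<Rightarrow>\<^sub>0 'f" where
  "tens x y = lin (\<lambda>v. basis (v, 0)) x * lin (\<lambda>w. basis (0, w)) y"

lemma linop_tens: "linop F \<Longrightarrow> linop (\<lambda>x. tens (F x) y)" "linop F \<Longrightarrow> linop (\<lambda>y. tens x (F y))"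
  unfolding tens_def by (simp_all add: linop_simps)

lemma tens_linear:
  "tens (x + x') y = tens x y + tens x' y" "tens x (y + y') = tens x y + tens x y'"
  "tens (scl c x) y = scl c (tens x y)" "tens x (scl c y) = scl c (tens x y)"
  unfolding tens_def by (simp_all add: linop_simps)

lemma tens_basis: "tens (basis v) (basis w) = basis (v, w)"
  by (simp add: tens_def mult_single plus_prod_def)

lemma tens_one: "tens 1 1 = 1"
  unfolding single_one[symmetric] tens_basis by (simp add: zero_prod_def)

lemma tens_zero [simp]: "tens 0 y = 0" "tens x 0 = 0"
  by (simp_all add: tens_def lin_zero)

lemma tens_mult: "tens a b * tens c d = tens (a * c) (b * d)"
proof -
  let ?l = "lin (\<lambda>v. basis (v, 0))" and ?r = "lin (\<lambda>w. basis (0, w))"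
  have l: "?l (a * c) = ?l a * ?l c"
    by (rule lin_mult) (simp add: mult_single plus_prod_def)
  have r: "?r (b * d) = ?r b * ?r d"
    by (rule lin_mult) (simp add: mult_single plus_prod_def)
  have "?r b * ?l c = ?l c * ?r b"
  proof (rule linop_ext[of "\<lambda>b. ?r b * ?l c" "\<lambda>b. ?l c * ?r b"])
    fix w
    show "?r (basis w) * ?l c = ?l c * ?r (basis w)"
      by (rule linop_ext[of "\<lambda>c. ?r (basis w) * ?l c" "\<lambda>c. ?l c * ?r (basis w)"])
         (simp_all add: linop_simps mult_single plus_prod_def)
  qed (simp_all add: linop_simps)
  then have "?l a * (?r b * ?l c) * ?r d = ?l a * (?l c * ?r b) * ?r d"
    by simp
  then show ?thesis
    unfolding tens_def l r by (simp add: mult.assoc)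
qed

lemma lin_tens:
  "lin (\<lambda>vw. \<phi> (fst vw) * \<psi> (snd vw)) (tens x y) = lin \<phi> x * lin \<psi> y" (is "?L (tens x y) = _")
proof (rule linop_ext[of "\<lambda>x. ?L (tens x y)" "\<lambda>x. lin \<phi> x * lin \<psi> y"])
  fix v
  show "?L (tens (basis v) y) = lin \<phi> (basis v) * lin \<psi> y"
    by (rule linop_ext[of "\<lambda>y. ?L (tens (basis v) y)" "\<lambda>y. lin \<phi> (basis v) * lin \<psi> y"])
       (simp_all add: linop_simps tens_linear tens_basis)
qed (simp_all add: linop_simps tens_linear)

section \<open>The commutator filtration\<close>

text \<open>
  Defining the filtration by closure in an arbitrary ring makes it compatible with all
  homomorphisms, also with those that do not send letters to letters. Its explicit form in a free
  algebra is \<open>cfilt_span\<close>.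
\<close>

inductive cfilt :: "nat \<Rightarrow> 'a::ring_1 \<Rightarrow> bool" where
  any: "cfilt 0 x"
| zero: "cfilt k 0"
| add: "cfilt k x \<Longrightarrow> cfilt k y \<Longrightarrow> cfilt k (x + y)"
| mult: "cfilt s x \<Longrightarrow> cfilt t y \<Longrightarrow> cfilt (s + t) (x * y)"
| comm: "cfilt s x \<Longrightarrow> cfilt t y \<Longrightarrow> cfilt (Suc (s + t)) (x * y - y * x)"
| weaken: "cfilt (Suc k) x \<Longrightarrow> cfilt k x"

lemma cfilt_mono: "cfilt k x \<Longrightarrow> j \<le> k \<Longrightarrow> cfilt j x"
  by (induction k) (auto simp: le_Suc_eq dest: cfilt.weaken)

lemma cfilt_multL: "cfilt k x \<Longrightarrow> cfilt k (a * x)"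
  using cfilt.mult[OF cfilt.any, of k x a] by simp

lemma cfilt_multR: "cfilt k x \<Longrightarrow> cfilt k (x * a)"
  using cfilt.mult[OF _ cfilt.any, of k x a] by simp

lemma cfilt_sum: "(\<And>a. a \<in> A \<Longrightarrow> cfilt k (f a)) \<Longrightarrow> cfilt k (sum f A)"
  by (induction A rule: infinite_finite_induct) (auto intro: cfilt.zero cfilt.add)

lemma cfilt_scl: "cfilt k x \<Longrightarrow> cfilt k (scl c x)"
  unfolding scl_def by (rule cfilt_multL)

lemma cfilt_hom:
  assumes "cfilt k x"
    and "F 0 = 0" "\<And>x y. F (x + y) = F x + F y" "\<And>x y. F (x - y) = F x - F y" "\<And>x y. F (x * y) = F x * F y"
  shows "cfilt k (F x)"
  using assms(1)
proof induction
  case (any x)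
  show ?case by (rule cfilt.any)
next
  case (zero k)
  show ?case unfolding assms(2) by (rule cfilt.zero)
next
  case (add k x y)
  show ?case unfolding assms(3) by (rule cfilt.add[OF add.IH])
next
  case (mult s x t y)
  show ?case unfolding assms(5) by (rule cfilt.mult[OF mult.IH])
next
  case (comm s x t y)
  show ?case unfolding assms(4,5) by (rule cfilt.comm[OF comm.IH])
next
  case (weaken k x)
  show ?case by (rule cfilt.weaken[OF weaken.IH])
qed

lemma cfilt_lift: "cfilt k x \<Longrightarrow> cfilt k (lift \<psi> x)"
  by (rule cfilt_hom[where F = "lift \<psi>"])
     (simp_all add: lift_mult linop_zero[OF linop_lift] linop_add[OF linop_lift] linop_diff[OF linop_lift])

section \<open>Products of left-normed brackets\<close>

abbreviation cmt :: "'a::ring \<Rightarrow> 'a \<Rightarrow> 'a" where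
  "cmt x y \<equiv> x * y - y * x"

lemma linop_span:
  assumes "linop F" "x \<in> ncp.span S" "ncp.subspace V" "\<And>s. s \<in> S \<Longrightarrow> F s \<in> V"
  shows "F x \<in> V"
  using assms(2)
proof (induction rule: ncp.span_induct_alt)
  case base
  then show ?case by (simp add: linop_zero[OF assms(1)] ncp.subspace_0[OF assms(3)])
next
  case (step c x y)
  then show ?case
    by (simp add: linop_add[OF assms(1)] linop_scl[OF assms(1)] assms(4)
        ncp.subspace_add[OF assms(3)] ncp.subspace_scale[OF assms(3)])
qed

lemma bilinear_span:
  assumes "\<And>y. linop (\<lambda>x. F x y)" "\<And>x. linop (F x)" "x \<in> ncp.span S" "y \<in> ncp.span T"
    and "\<And>s t. s \<in> S \<Longrightarrow> t \<in> T \<Longrightarrow> F s t \<in> ncp.span U"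
  shows "F x y \<in> ncp.span U"
proof (rule linop_span[OF assms(1) assms(3) ncp.subspace_span])
  fix s assume "s \<in> S"
  then show "F s y \<in> ncp.span U"
    by (intro linop_span[OF assms(2) assms(4) ncp.subspace_span] assms(5))
qed

lemma linop_cmt: "linop (\<lambda>x. cmt x y)" "linop (\<lambda>x. cmt y x)"
  and linop_times: "linop (\<lambda>x. x * y)" "linop (\<lambda>x. y * x)"
  by (simp_all add: linop_simps algebra_simps)

definition brk :: "('i \<Rightarrow> 'r::ring_1) \<Rightarrow> 'i list \<Rightarrow> 'r" where
  "brk p w = foldl (\<lambda>x i. cmt x (p i)) (p (hd w)) (tl w)"

definition brk_prod :: "('i \<Rightarrow> 'r::ring_1) \<Rightarrow> 'i list list \<Rightarrow> 'r" where
  "brk_prod p ws = prod_list (map (brk p) ws)"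

text \<open>The number of commutators in a product of brackets.\<close>

definition depth :: "'i list list \<Rightarrow> nat" where
  "depth ws = sum_list (map (\<lambda>w. length w - 1) ws)"

lemma brk_single [simp]: "brk p [i] = p i"
  by (simp add: brk_def)

lemma brk_snoc: "w \<noteq> [] \<Longrightarrow> brk p (w @ [i]) = cmt (brk p w) (p i)"
  by (simp add: brk_def)

lemma brk_repeat: "brk p (i # i # w) = 0"
proof (induction w rule: rev_induct)
  case Nil
  then show ?case by (simp add: brk_def)
next
  case (snoc j w)
  then show ?case using brk_snoc[of "i # i # w" p j] by simp
qed

lemma brk_prod_simps [simp]:
  "brk_prod p [] = 1" "brk_prod p (w # ws) = brk p w * brk_prod p ws"
  "brk_prod p (ws @ vs) = brk_prod p ws * brk_prod p vs"
  by (simp_all add: brk_prod_def)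

lemma depth_simps [simp]:
  "depth [] = 0" "depth (w # ws) = length w - 1 + depth ws" "depth (ws @ vs) = depth ws + depth vs"
  by (simp_all add: depth_def)

lemma cfilt_brk: "w \<noteq> [] \<Longrightarrow> cfilt (length w - 1) (brk p w)"
proof (induction w rule: rev_induct)
  case (snoc i w)
  show ?case
  proof (cases "w = []")
    case False
    then have "cfilt (Suc (length w - 1 + 0)) (brk p (w @ [i]))"
      unfolding brk_snoc[OF False] by (intro cfilt.comm snoc.IH cfilt.any)
    then show ?thesis using False by simp
  qed (simp add: cfilt.any)
qed simp

lemma cfilt_brk_prod: "[] \<notin> set ws \<Longrightarrow> cfilt (depth ws) (brk_prod p ws)"
proof (induction ws)
  case (Cons w ws)
  then have "cfilt (length w - 1) (brk p w)" "cfilt (depth ws) (brk_prod p ws)"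
    using cfilt_brk[of w p] by auto
  then show ?case by (simp add: cfilt.mult)
qed (simp add: cfilt.any)

text \<open>
  By the Jacobi identity \<open>[x, [y, p]] = [[x, y], p] - [[x, p], y]\<close>, used along the second bracket.
\<close>

lemma cmt_brk:
  fixes p :: "'i \<Rightarrow> ('b::monoid_add \<Rightarrow>\<^sub>0 'f::field)"
  shows "w \<noteq> [] \<Longrightarrow> v \<noteq> [] \<Longrightarrow>
    cmt (brk p w) (brk p v) \<in> ncp.span {brk p (w @ v') | v'. mset v' = mset v}"
proof (induction v arbitrary: w rule: rev_induct)
  case (snoc i v)
  let ?S = "\<lambda>w v. {brk p (w @ v') | v'. mset v' = mset v}"
  show ?case
  proof (cases "v = []")
    case True
    have "brk p (w @ [i]) \<in> ?S w [i]" by blast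
    then have "brk p (w @ [i]) \<in> ncp.span (?S w [i])" by (rule ncp.span_base)
    then show ?thesis
      using True snoc.prems brk_snoc[of w p i] by simp
  next
    case False
    let ?x = "brk p w" and ?y = "brk p v"
    have "cmt (cmt ?x ?y) (p i) \<in> ncp.span (?S w (v @ [i]))"
    proof (rule linop_span[OF linop_cmt(1) snoc.IH[OF snoc.prems(1) False] ncp.subspace_span])
      fix s assume "s \<in> ?S w v"
      then obtain v' where v': "s = brk p (w @ v')" "mset v' = mset v" by blast
      then have "cmt s (p i) = brk p (w @ (v' @ [i]))" "mset (v' @ [i]) = mset (v @ [i])"
        using brk_snoc[of "w @ v'" p i] snoc.prems(1) by simp_all
      then show "cmt s (p i) \<in> ncp.span (?S w (v @ [i]))"
        by (intro ncp.span_base) blast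
    qed
    moreover have "cmt (cmt ?x (p i)) ?y \<in> ncp.span (?S w (v @ [i]))"
    proof -
      have "cmt (brk p (w @ [i])) ?y \<in> ncp.span (?S (w @ [i]) v)"
        by (rule snoc.IH) (use False in simp_all)
      moreover have "?S (w @ [i]) v \<subseteq> ?S w (v @ [i])"
      proof
        fix s assume "s \<in> ?S (w @ [i]) v"
        then obtain v' where v': "s = brk p (w @ (i # v'))" "mset v' = mset v" by auto
        moreover have "mset (i # v') = mset (v @ [i])" using v'(2) by simp
        ultimately show "s \<in> ?S w (v @ [i])" by blast
      qed
      ultimately show ?thesis
        using ncp.span_mono snoc.prems(1) by (simp add: brk_snoc) blast
    qed
    moreover have "cmt ?x (brk p (v @ [i])) = cmt (cmt ?x ?y) (p i) - cmt (cmt ?x (p i)) ?y"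
      by (simp add: brk_snoc[OF False] algebra_simps)
    ultimately show ?thesis by (simp add: ncp.span_diff)
  qed
qed simp

text \<open>
  A bracket that ends in \<open>m\<close> is, up to sign, the commutator of the one-letter bracket \<open>m\<close> with a
  shorter bracket, so \<open>cmt_brk\<close> applies; letters behind \<open>m\<close> are appended afterwards.
\<close>

lemma brk_move_to_front:
  fixes p :: "'i \<Rightarrow> ('b::monoid_add \<Rightarrow>\<^sub>0 'f::field)"
  shows "m \<in> set w \<Longrightarrow> brk p w \<in> ncp.span {brk p (m # v) | v. mset (m # v) = mset w}"
proof (induction w rule: rev_induct)
  case (snoc i w)
  let ?S = "\<lambda>w. {brk p (m # v) | v. mset (m # v) = mset w}"
  show ?case
  proof (cases "m \<in> set w")
    case True
    then have "w \<noteq> []" by auto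
    have "cmt (brk p w) (p i) \<in> ncp.span (?S (w @ [i]))"
    proof (rule linop_span[OF linop_cmt(1) snoc.IH[OF True] ncp.subspace_span])
      fix s assume "s \<in> ?S w"
      then obtain v where v: "s = brk p (m # v)" "mset (m # v) = mset w" by blast
      then have "cmt s (p i) = brk p (m # (v @ [i]))" "mset (m # (v @ [i])) = mset (w @ [i])"
        using brk_snoc[of "m # v" p i] by simp_all
      then show "cmt s (p i) \<in> ncp.span (?S (w @ [i]))"
        by (intro ncp.span_base) blast
    qed
    then show ?thesis by (simp add: brk_snoc[OF \<open>w \<noteq> []\<close>])
  next
    case False
    then have i: "i = m" using snoc.prems by simp
    show ?thesis
    proof (cases "w = []")
      case True
      then have "brk p (w @ [i]) \<in> ?S (w @ [i])" using i by auto
      then show ?thesis by (rule ncp.span_base)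
    next
      case False
      have "cmt (brk p [m]) (brk p w) \<in> ncp.span {brk p ([m] @ v') | v'. mset v' = mset w}"
        by (rule cmt_brk) (use False in simp_all)
      moreover have "{brk p ([m] @ v') | v'. mset v' = mset w} = ?S (w @ [i])"
        using i by auto
      ultimately have "- cmt (brk p [m]) (brk p w) \<in> ncp.span (?S (w @ [i]))"
        by (simp only: ncp.span_neg)
      then show ?thesis using i by (simp add: brk_snoc[OF False])
    qed
  qed
qed simp

definition bracket_products :: "('i \<Rightarrow> 'r::ring_1) \<Rightarrow> 'i set \<Rightarrow> nat \<Rightarrow> 'r set" where
  "bracket_products p I k =
     {brk_prod p ws | ws. [] \<notin> set ws \<and> \<Union>(set ` set ws) \<subseteq> I \<and> k \<le> depth ws}"

lemma bracket_productsI: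
  "[] \<notin> set ws \<Longrightarrow> \<Union>(set ` set ws) \<subseteq> I \<Longrightarrow> k \<le> depth ws \<Longrightarrow> brk_prod p ws \<in> bracket_products p I k"
  by (auto simp: bracket_products_def)

lemma bracket_products_antimono: "j \<le> k \<Longrightarrow> bracket_products p I k \<subseteq> bracket_products p I j"
  unfolding bracket_products_def using le_trans by blast

lemma bracket_products_mult:
  "x \<in> bracket_products p I s \<Longrightarrow> y \<in> bracket_products p I t \<Longrightarrow> x * y \<in> bracket_products p I (s + t)"
proof -
  assume "x \<in> bracket_products p I s" "y \<in> bracket_products p I t"
  then obtain ws vs where "x = brk_prod p ws" "y = brk_prod p vs"
    and *: "[] \<notin> set ws" "\<Union>(set ` set ws) \<subseteq> I" "s \<le> depth ws"
      "[] \<notin> set vs" "\<Union>(set ` set vs) \<subseteq> I" "t \<le> depth vs"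
    unfolding bracket_products_def by blast
  then have "x * y = brk_prod p (ws @ vs)" by simp
  also have "\<dots> \<in> bracket_products p I (s + t)"
    by (rule bracket_productsI) (use * in auto)
  finally show ?thesis .
qed

lemma span_bracket_products_mult:
  fixes p :: "'i \<Rightarrow> ('b::monoid_add \<Rightarrow>\<^sub>0 'f::field)"
  assumes "x \<in> ncp.span (bracket_products p I s)" "y \<in> ncp.span (bracket_products p I t)"
  shows "x * y \<in> ncp.span (bracket_products p I (s + t))"
  by (rule bilinear_span[OF _ _ assms])
     (auto simp: linop_times intro: ncp.span_base bracket_products_mult)

lemma cmt_brk_brk_prod:
  fixes p :: "'i \<Rightarrow> ('b::monoid_add \<Rightarrow>\<^sub>0 'f::field)"
  assumes "w \<noteq> []" "set w \<subseteq> I"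
  shows "[] \<notin> set vs \<Longrightarrow> \<Union>(set ` set vs) \<subseteq> I \<Longrightarrow>
    cmt (brk p w) (brk_prod p vs) \<in> ncp.span (bracket_products p I (length w + depth vs))"
proof (induction vs)
  case (Cons v vs)
  let ?B = "\<lambda>k. ncp.span (bracket_products p I k)" and ?b = "brk p w" and ?y = "brk_prod p vs"
  have v: "v \<noteq> []" "set v \<subseteq> I" using Cons.prems by auto
  have "cmt ?b (brk p v) * ?y \<in> ?B (length w + depth (v # vs))"
  proof (rule linop_span[OF linop_times(1) cmt_brk[OF assms(1) v(1)] ncp.subspace_span])
    fix s assume "s \<in> {brk p (w @ v') |v'. mset v' = mset v}"
    then obtain v' where v': "s = brk p (w @ v')" "mset v' = mset v" by blast
    have "length v' = length v" "set v' = set v"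
      using mset_eq_length[OF v'(2)] mset_eq_setD[OF v'(2)] by simp_all
    then have "brk_prod p ((w @ v') # vs) \<in> bracket_products p I (length w + depth (v # vs))"
      using assms v Cons.prems by (intro bracket_productsI) (auto simp: Suc_le_eq)
    then show "s * ?y \<in> ?B (length w + depth (v # vs))"
      using v' by (simp add: ncp.span_base)
  qed
  moreover have "brk p v * cmt ?b ?y \<in> ?B (length v - 1 + (length w + depth vs))"
  proof (rule span_bracket_products_mult)
    have "brk_prod p [v] \<in> bracket_products p I (length v - 1)"
      using v by (intro bracket_productsI) auto
    then show "brk p v \<in> ?B (length v - 1)" by (simp add: ncp.span_base)
    show "cmt ?b ?y \<in> ?B (length w + depth vs)"
      using Cons by simp
  qed
  moreover have "cmt ?b (brk_prod p (v # vs)) = cmt ?b (brk p v) * ?y + brk p v * cmt ?b ?y"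
    by (simp add: algebra_simps)
  moreover have "length v - 1 + (length w + depth vs) = length w + depth (v # vs)"
    by simp
  ultimately show ?case
    by (simp only: ncp.span_add)
qed (simp add: ncp.span_zero)

lemma cmt_brk_prod:
  fixes p :: "'i \<Rightarrow> ('b::monoid_add \<Rightarrow>\<^sub>0 'f::field)"
  assumes vs: "[] \<notin> set vs" "\<Union>(set ` set vs) \<subseteq> I"
  shows "[] \<notin> set ws \<Longrightarrow> \<Union>(set ` set ws) \<subseteq> I \<Longrightarrow>
    cmt (brk_prod p ws) (brk_prod p vs) \<in> ncp.span (bracket_products p I (Suc (depth ws + depth vs)))"
proof (induction ws)
  case (Cons w ws)
  let ?B = "\<lambda>k. ncp.span (bracket_products p I k)" and ?b = "brk p w" and ?x = "brk_prod p ws"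
    and ?y = "brk_prod p vs"
  have w: "w \<noteq> []" "set w \<subseteq> I" using Cons.prems by auto
  have "brk_prod p [w] \<in> bracket_products p I (length w - 1)"
    using w by (intro bracket_productsI) auto
  then have "?b \<in> ?B (length w - 1)" by (simp add: ncp.span_base)
  then have "?b * cmt ?x ?y \<in> ?B (length w - 1 + Suc (depth ws + depth vs))"
    using Cons by (intro span_bracket_products_mult) auto
  moreover have "?x \<in> ?B (depth ws)"
    using Cons.prems by (intro ncp.span_base bracket_productsI) auto
  then have "cmt ?b ?y * ?x \<in> ?B ((length w + depth vs) + depth ws)"
    by (intro span_bracket_products_mult cmt_brk_brk_prod w vs)
  moreover have "cmt (brk_prod p (w # ws)) ?y = ?b * cmt ?x ?y + cmt ?b ?y * ?x"
    by (simp add: algebra_simps)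
  moreover have "length w - 1 + Suc (depth ws + depth vs) = Suc (depth (w # ws) + depth vs)"
    "(length w + depth vs) + depth ws = Suc (depth (w # ws) + depth vs)"
    using w by (auto simp: Suc_le_eq)
  ultimately show ?case
    by (simp only: ncp.span_add)
qed (simp add: ncp.span_zero)

text \<open>
  The spans on the right satisfy all closure conditions of the filtration. The essential one is
  that a commutator of two products is, by the Leibniz rule, a sum of products in which one
  commutator of two brackets occurs, and this is again a combination of brackets.
\<close>

lemma cfilt_span:
  fixes p :: "'i \<Rightarrow> ('b::monoid_add \<Rightarrow>\<^sub>0 'f::field)"
  assumes gen: "\<And>x. x \<in> ncp.span (bracket_products p I 0)"
  shows "cfilt k x \<Longrightarrow> x \<in> ncp.span (bracket_products p I k)"
proof (induction rule: cfilt.induct)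
  case (any x)
  show ?case by (rule gen)
next
  case (mult s x t y)
  then show ?case by (simp add: span_bracket_products_mult)
next
  case (comm s x t y)
  show ?case
  proof (rule bilinear_span[OF linop_cmt comm.IH])
    fix a b assume "a \<in> bracket_products p I s" "b \<in> bracket_products p I t"
    then obtain ws vs where *: "a = brk_prod p ws" "b = brk_prod p vs"
      "[] \<notin> set ws" "\<Union>(set ` set ws) \<subseteq> I" "s \<le> depth ws"
      "[] \<notin> set vs" "\<Union>(set ` set vs) \<subseteq> I" "t \<le> depth vs"
      unfolding bracket_products_def by blast
    then have "cmt a b \<in> ncp.span (bracket_products p I (Suc (depth ws + depth vs)))"
      by (simp add: cmt_brk_prod)
    moreover have "bracket_products p I (Suc (depth ws + depth vs)) \<subseteq> bracket_products p I (Suc (s + t))"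
      using *(5,8) by (intro bracket_products_antimono) simp
    ultimately show "cmt a b \<in> ncp.span (bracket_products p I (Suc (s + t)))"
      using ncp.span_mono by blast
  qed
next
  case (weaken k x)
  show ?case
    by (rule subsetD[OF ncp.span_mono[OF bracket_products_antimono] weaken.IH]) simp
qed (simp_all add: ncp.span_zero ncp.span_add)


section \<open>Derivations that insert a bracket\<close>

definition derivation :: "(('b::monoid_add \<Rightarrow>\<^sub>0 'f::field) \<Rightarrow> 'b \<Rightarrow>\<^sub>0 'f) \<Rightarrow> bool" where
  "derivation D \<longleftrightarrow> linop D \<and> (\<forall>x y. D (x * y) = D x * y + x * D y)"

lemma derivation_cmt: "derivation D \<Longrightarrow> D (cmt x y) = cmt (D x) y + cmt x (D y)"
  by (simp add: derivation_def linop_diff algebra_simps)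

text \<open>Since \<open>x y z - z y x = [x, y z] + [y, z] x\<close>.\<close>

lemma cfilt_reverse3:
  assumes "cfilt a x" "cfilt b y" "cfilt c z"
  shows "cfilt (Suc (a + b + c)) (x * y * z - z * y * x)"
proof -
  have "cfilt (Suc (a + (b + c))) (cmt x (y * z))" "cfilt (Suc (b + c) + a) (cmt y z * x)"
    by (intro cfilt.comm cfilt.mult assms)+
  then have "cfilt (Suc (a + b + c)) (cmt x (y * z) + cmt y z * x)"
    by (intro cfilt.add) (simp_all add: ac_simps)
  then show ?thesis by (simp add: algebra_simps)
qed

text \<open>
  To first order, such a derivation replaces the letter \<open>a + b\<close> by a bracket of \<open>a\<close> and \<open>b\<close> and
  kills all other letters.
\<close>

locale bracket_insertion =
  fixes p :: "nat \<Rightarrow> ('b::monoid_add \<Rightarrow>\<^sub>0 'f::field_char_0)"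
    and D :: "('b \<Rightarrow>\<^sub>0 'f) \<Rightarrow> ('b \<Rightarrow>\<^sub>0 'f)" and a b :: nat
  assumes derivation: "derivation D"
    and D_hit: "D (p (a + b)) = scl (of_nat (a + b)) (cmt (p a) (p b))"
    and D_miss: "\<And>i. 0 < i \<Longrightarrow> i \<noteq> a + b \<Longrightarrow> cfilt 2 (D (p i))"
begin

lemma D_mult: "D (x * y) = D x * y + x * D y"
  and linop_D: "linop D"
  using derivation by (simp_all add: derivation_def)

lemma D_brk_miss:
  "w \<noteq> [] \<Longrightarrow> 0 \<notin> set w \<Longrightarrow> a + b \<notin> set w \<Longrightarrow> cfilt (Suc (length w)) (D (brk p w))"
proof (induction w rule: rev_induct)
  case (snoc i w)
  have i: "cfilt 2 (D (p i))"
    using snoc.prems by (intro D_miss) auto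
  show ?case
  proof (cases "w = []")
    case True
    then show ?thesis using i by (simp add: numeral_2_eq_2)
  next
    case False
    then have "cfilt (Suc (Suc (length w) + 0)) (cmt (D (brk p w)) (p i))"
      using snoc by (intro cfilt.comm cfilt.any) auto
    moreover have "cfilt (Suc (length w - 1 + 2)) (cmt (brk p w) (D (p i)))"
      by (intro cfilt.comm cfilt_brk i False)
    then have "cfilt (Suc (Suc (length w))) (cmt (brk p w) (D (p i)))"
      by (rule cfilt_mono) simp
    ultimately show ?thesis
      using False by (simp add: brk_snoc derivation_cmt[OF derivation] cfilt.add)
  qed
qed simp

lemma D_brk_hit:
  "0 \<notin> set w \<Longrightarrow> a + b \<notin> set w \<Longrightarrow>
   cfilt (length w + 2) (D (brk p ((a + b) # w)) - scl (of_nat (a + b)) (brk p (a # b # w)))"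
proof (induction w rule: rev_induct)
  case Nil
  then show ?case by (simp add: D_hit brk_def cfilt.zero)
next
  case (snoc i w)
  let ?n = "of_nat (a + b) :: 'f" and ?x = "brk p ((a + b) # w)" and ?y = "brk p (a # b # w)"
  have "cfilt (Suc (length w + 2 + 0)) (cmt (D ?x - scl ?n ?y) (p i))"
    using snoc by (intro cfilt.comm cfilt.any) auto
  moreover have "cfilt (Suc (length ((a + b) # w) - 1 + 2)) (cmt ?x (D (p i)))"
    using snoc.prems by (intro cfilt.comm cfilt_brk D_miss) auto
  ultimately have "cfilt (length w + 3) (cmt (D ?x - scl ?n ?y) (p i) + cmt ?x (D (p i)))"
    by (intro cfilt.add) (simp_all add: numeral_3_eq_3)
  moreover have "D (brk p ((a + b) # w @ [i])) = cmt (D ?x) (p i) + cmt ?x (D (p i))"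
    using brk_snoc[of "(a + b) # w" p i] by (simp add: derivation_cmt[OF derivation])
  moreover have "scl ?n (brk p (a # b # w @ [i])) = cmt (scl ?n ?y) (p i)"
    using brk_snoc[of "a # b # w" p i] by (simp add: scl_diff scl_mult_left scl_mult_right)
  ultimately have "D (brk p ((a + b) # w @ [i])) - scl ?n (brk p (a # b # w @ [i]))
      = cmt (D ?x - scl ?n ?y) (p i) + cmt ?x (D (p i))"
    by (simp only:) (simp only: algebra_simps)
  then show ?case
    using \<open>cfilt (length w + 3) _\<close> by (simp add: numeral_3_eq_3)
qed

text \<open>
  The first-order effect on a product in which \<open>a + b\<close> occurs only as a factor of its own.
\<close>

fun insertions :: "nat list list \<Rightarrow> nat list list list" where
  "insertions [] = []"
| "insertions (w # ws) = (if w = [a + b] then [[a, b] # ws] else []) @ map ((#) w) (insertions ws)"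

lemma insertionsD:
  "vs \<in> set (insertions ws) \<Longrightarrow> \<exists>us us'. ws = us @ [a + b] # us' \<and> vs = us @ [a, b] # us'"
proof (induction ws arbitrary: vs)
  case (Cons w ws)
  then consider "w = [a + b]" "vs = [a, b] # ws" | vs' where "vs' \<in> set (insertions ws)" "vs = w # vs'"
    by (auto split: if_splits)
  then show ?case
  proof cases
    case 1
    then show ?thesis by (intro exI[of _ "[]"] exI[of _ ws]) simp
  next
    case 2
    then obtain us us' where "ws = us @ [a + b] # us'" "vs' = us @ [a, b] # us'"
      using Cons.IH by blast
    then show ?thesis using 2 by (intro exI[of _ "w # us"] exI[of _ us']) simp
  qed
qed simp

lemma D_brk_prod:
  assumes "\<And>w. w \<in> set ws \<Longrightarrow> w \<noteq> [] \<and> 0 \<notin> set w \<and> (w = [a + b] \<or> a + b \<notin> set w)"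
  shows "cfilt (depth ws + 2)
    (D (brk_prod p ws) - scl (of_nat (a + b)) (\<Sum>vs\<leftarrow>insertions ws. brk_prod p vs))"
  using assms
proof (induction ws)
  case Nil
  have "D 1 = 0" using D_mult[of 1 1] by simp
  then show ?case by (simp add: cfilt.zero)
next
  case (Cons w ws)
  let ?n = "of_nat (a + b) :: 'f"
  let ?c = "if w = [a + b] then scl ?n (brk p [a, b]) else 0"
  let ?s = "scl ?n (\<Sum>vs\<leftarrow>insertions ws. brk_prod p vs)"
  have ws: "[] \<notin> set ws" using Cons.prems by force
  have w: "w \<noteq> []" "0 \<notin> set w" "w = [a + b] \<or> a + b \<notin> set w" using Cons.prems by auto
  have "cfilt (Suc (length w)) (D (brk p w) - ?c)"
  proof (cases "w = [a + b]")
    case True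
    then show ?thesis using D_hit by (simp add: brk_def cfilt.zero)
  qed (use w in \<open>simp add: D_brk_miss\<close>)
  then have "cfilt (Suc (length w) + depth ws) ((D (brk p w) - ?c) * brk_prod p ws)"
    by (intro cfilt.mult cfilt_brk_prod ws)
  moreover have "cfilt (length w - 1 + (depth ws + 2)) (brk p w * (D (brk_prod p ws) - ?s))"
    using Cons w by (intro cfilt.mult cfilt_brk) auto
  moreover have "Suc (length w) + depth ws = depth (w # ws) + 2"
    "length w - 1 + (depth ws + 2) = depth (w # ws) + 2"
    using w(1) by (auto simp: Suc_le_eq)
  ultimately have "cfilt (depth (w # ws) + 2)
      ((D (brk p w) - ?c) * brk_prod p ws + brk p w * (D (brk_prod p ws) - ?s))"
    by (simp only: cfilt.add)
  moreover have "scl ?n (\<Sum>vs\<leftarrow>insertions (w # ws). brk_prod p vs) = ?c * brk_prod p ws + brk p w * ?s"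
  proof -
    have "(\<Sum>vs\<leftarrow>insertions ws. brk p w * brk_prod p vs) = brk p w * (\<Sum>vs\<leftarrow>insertions ws. brk_prod p vs)"
      by (rule sum_list_const_mult)
    then show ?thesis
      by (simp add: comp_def scl_add scl_mult_left scl_mult_right)
  qed
  moreover have "D (brk_prod p (w # ws)) = D (brk p w) * brk_prod p ws + brk p w * D (brk_prod p ws)"
    by (simp add: D_mult)
  ultimately show ?case by (simp only: algebra_simps)
qed

end

lemma subspace_sum_list:
  "ncp.subspace K \<Longrightarrow> (\<And>x. x \<in> set xs \<Longrightarrow> f x \<in> K) \<Longrightarrow> (\<Sum>x\<leftarrow>xs. f x) \<in> K"
  by (induction xs) (auto simp: ncp.subspace_0 ncp.subspace_add)

lemma subspace_scale_cancel:
  assumes "ncp.subspace K" "c \<noteq> 0" "scl c x \<in> K"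
  shows "x \<in> K"
  using ncp.subspace_scale[OF assms(1,3), of "inverse c"] assms(2) by simp

lemma subspace_add_cancel:
  assumes "ncp.subspace K" "x + y \<in> K" "y \<in> K"
  shows "x \<in> K"
  using ncp.subspace_diff[OF assms] by simp

text \<open>
  The induction goes down on the largest letter \<open>m\<close> that occurs in a bracket of length at least two;
  letters are bounded by their total \<open>N\<close>, which no step changes, and \<open>t\<close> measures the distance.
  Bring such a bracket into the form \<open>[m, i, \<dots>]\<close>. It vanishes if \<open>i = m\<close>. Otherwise \<open>i < m\<close>, so
  \<open>m + i\<close> exceeds every letter in a nontrivial bracket, and the product arises, up to a nonzero
  factor, when the derivation for \<open>m\<close> and \<open>i\<close> is applied to the product with \<open>[m + i, \<dots>]\<close>
  instead. All other first-order terms come from one-letter factors \<open>m + i\<close>. If \<open>[m + i, \<dots>]\<close> is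
  still a nontrivial bracket, these terms have a larger letter in a nontrivial bracket and the
  induction covers them. If it has become a single letter, they differ from the given product only
  by the order of the factors, that is, by terms of higher filtration; then the coefficients add up to a positive multiple of the product,
  which is where characteristic zero enters.
\<close>

lemma brk_prod_in_subspace:
  fixes p :: "nat \<Rightarrow> ('b::monoid_add \<Rightarrow>\<^sub>0 'f::field_char_0)"
  assumes D: "\<And>a b. 0 < a \<Longrightarrow> 0 < b \<Longrightarrow> bracket_insertion p (D a b) a b"
    and K: "ncp.subspace K"
    and high: "\<And>x. cfilt (Suc k) x \<Longrightarrow> x \<in> K"
    and DK: "\<And>a b x. 0 < a \<Longrightarrow> 0 < b \<Longrightarrow> cfilt (k - 1) x \<Longrightarrow> D a b x \<in> K"
  shows "[] \<notin> set ws \<Longrightarrow> 0 \<notin> \<Union>(set ` set ws) \<Longrightarrow> depth ws = k \<Longrightarrow> sum_list (concat ws) = N \<Longrightarrow>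
    w \<in> set ws \<Longrightarrow> 2 \<le> length w \<Longrightarrow> m \<in> set w \<Longrightarrow> N < m + t \<Longrightarrow> brk_prod p ws \<in> K"
proof (induction t arbitrary: ws w m)
  case 0
  then have "m \<le> N"
    using member_le_sum_list[of m "concat ws"] by auto
  with 0 show ?case by simp
next
  case (Suc t)
  have exchange: "x \<in> K" if "y \<in> K" "cfilt (Suc k) (x - y)" for x y
    using ncp.subspace_add[OF K high[OF that(2)] that(1)] by simp
  show ?case
  proof (cases "\<exists>w'\<in>set ws. 2 \<le> length w' \<and> (\<exists>m'\<in>set w'. N < m' + t)")
    case True
    then show ?thesis using Suc.IH Suc.prems(1-4) by blast
  next
    case False
    then have max: "m' \<le> m" if "w' \<in> set ws" "2 \<le> length w'" "m' \<in> set w'" for w' m'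
      using that Suc.prems(8) by force
    obtain us vs where ws: "ws = us @ w # vs"
      using split_list[OF Suc.prems(5)] by blast
    define rest where "rest = us @ vs"
    have rest: "[] \<notin> set rest" "0 \<notin> \<Union>(set ` set rest)" "set rest \<subseteq> set ws"
      using Suc.prems(1,2) by (auto simp: rest_def ws)
    have k: "k = length w - 1 + depth rest"
      using Suc.prems(3) by (simp add: ws rest_def)
    have "brk_prod p (w # rest) \<in> K"
    proof -
      have "linop (\<lambda>x. x * brk_prod p rest)" by (rule linop_times)
      moreover note brk_move_to_front[OF Suc.prems(7)] K
      moreover have "s * brk_prod p rest \<in> K"
        if "s \<in> {brk p (m # v) | v. mset (m # v) = mset w}" for s
      proof -
        from that obtain v where v: "s = brk p (m # v)" "mset (m # v) = mset w" by blast
        have len: "Suc (length v) = length w"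
          using mset_eq_length[OF v(2)] by simp
        then obtain i u where iu: "v = i # u"
          using Suc.prems(6) by (cases v) auto
        have set_w: "set w = insert m (insert i (set u))"
          using mset_eq_setD[OF v(2)] iu by simp
        have pos: "0 < m" "0 < i" "0 \<notin> set u"
          using Suc.prems(2,5) set_w by auto
        have le: "i \<le> m" "\<And>j. j \<in> set u \<Longrightarrow> j \<le> m"
          using max[OF Suc.prems(5,6)] set_w by auto
        show ?thesis
        proof (cases "i = m")
          case True
          then show ?thesis using v iu by (simp add: brk_repeat ncp.subspace_0[OF K])
        next
          case False
          let ?c = "of_nat (m + i) :: 'f"
          interpret bracket_insertion p "D m i" m i
            by (rule D[OF pos(1,2)])
          have u: "m + i \<notin> set u"
            using le(2)[of "m + i"] pos by auto
          have lenu: "length w = length u + 2"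
            using len iu by simp
          have letters_rest: "w' \<noteq> [] \<and> 0 \<notin> set w' \<and> (w' = [m + i] \<or> m + i \<notin> set w')"
            if "w' \<in> set rest" for w'
          proof -
            have "w' \<noteq> []" "0 \<notin> set w'" using that rest by auto
            moreover have "m + i \<notin> set w'" if "2 \<le> length w'"
              using max[of w' "m + i"] \<open>w' \<in> set rest\<close> rest(3) that pos by fastforce
            moreover have "w' = [m + i] \<or> m + i \<notin> set w'" if "\<not> 2 \<le> length w'"
              using that \<open>w' \<noteq> []\<close> by (cases w' rule: list.exhaust; cases "tl w'") auto
            ultimately show ?thesis by blast
          qed
          \<comment> \<open>\<open>e1\<close> and \<open>e2\<close> are the errors of the two first-order formulas, and the derivation
            is applied to \<open>f * r\<close>.\<close>
          define e1 where "e1 = D m i (brk p ((m + i) # u)) - scl ?c (brk p (m # i # u))"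
          define S where "S = (\<Sum>vs\<leftarrow>insertions rest. brk_prod p vs)"
          define e2 where "e2 = D m i (brk_prod p rest) - scl ?c S"
          define f where "f = brk p ((m + i) # u)"
          define r where "r = brk_prod p rest"
          have f: "cfilt (length u) f"
            unfolding f_def using cfilt_brk[of "(m + i) # u" p] by simp
          have r: "cfilt (depth rest) r"
            unfolding r_def by (rule cfilt_brk_prod[OF rest(1)])
          have "cfilt (length u + 2) e1"
            unfolding e1_def by (rule D_brk_hit[OF pos(3) u])
          then have "cfilt (length u + 2 + depth rest) (e1 * r)"
            by (rule cfilt.mult[OF _ r])
          then have e1K: "e1 * r \<in> K"
            by (intro high) (simp add: k lenu)
          have "cfilt (depth rest + 2) e2"
            unfolding e2_def S_def by (rule D_brk_prod[OF letters_rest])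
          then have "cfilt (length u + (depth rest + 2)) (f * e2)"
            by (rule cfilt.mult[OF f])
          then have e2K: "f * e2 \<in> K"
            by (intro high) (simp add: k lenu)
          have "cfilt (k - 1) (f * r)"
            using cfilt.mult[OF f r] by (simp add: k lenu)
          then have "D m i (f * r) \<in> K"
            by (rule DK[OF pos(1,2)])
          moreover have "D m i (f * r) = (scl ?c (brk p (m # i # u) * r + f * S) + f * e2) + e1 * r"
          proof -
            have "D m i f = e1 + scl ?c (brk p (m # i # u))"
              by (simp add: e1_def f_def)
            moreover have "D m i r = e2 + scl ?c S"
              by (simp add: e2_def r_def)
            ultimately show ?thesis
              unfolding D_mult scl_add
              by (simp add: distrib_left distrib_right scl_mult_left scl_mult_right add.assoc add.left_commute)
          qed
          ultimately have "scl ?c (brk p (m # i # u) * r + f * S) \<in> K"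
            using subspace_add_cancel[OF K _ e1K] subspace_add_cancel[OF K _ e2K] by metis
          moreover have "?c \<noteq> 0"
            using pos by (simp del: of_nat_add)
          ultimately have main: "brk p (m # i # u) * r + f * S \<in> K"
            by (rule subspace_scale_cancel[OF K, rotated])
          have fS: "f * S = (\<Sum>vs\<leftarrow>insertions rest. f * brk_prod p vs)"
            unfolding S_def by (rule sum_list_const_mult[symmetric])
          have sum_w: "sum_list w = m + i + sum_list u"
            using arg_cong[OF v(2), of sum_mset] iu by (simp add: sum_mset_sum_list[symmetric])
          have sum_ws: "N = sum_list w + sum_list (concat rest)"
            using Suc.prems(4) by (simp add: ws rest_def)
          have "brk p (m # i # u) * r \<in> K"
          proof (cases "u = []")
            case False
            have "f * brk_prod p vs \<in> K" if ins: "vs \<in> set (insertions rest)" for vs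
            proof -
              obtain xs ys where xy: "rest = xs @ [m + i] # ys" "vs = xs @ [m, i] # ys"
                using insertionsD[OF ins] by blast
              let ?z = "(m + i) # u"
              have "brk_prod p (?z # vs) \<in> K"
              proof (rule Suc.IH[of _ ?z "m + i"])
                show "[] \<notin> set (?z # vs)" "0 \<notin> \<Union>(set ` set (?z # vs))"
                  using rest(1,2) pos unfolding xy by auto
                show "depth (?z # vs) = k"
                  unfolding k lenu xy by simp
                show "sum_list (concat (?z # vs)) = N"
                  unfolding sum_ws sum_w xy by simp
                show "N < m + i + t" using Suc.prems(8) pos(2) by simp
              qed (use False in \<open>auto simp: Suc_le_eq\<close>)
              then show ?thesis by (simp add: f_def)
            qed
            then have "f * S \<in> K"
              unfolding fS by (intro subspace_sum_list K)
            then show ?thesis by (rule subspace_add_cancel[OF K main])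
          next
            case True
            let ?b = "brk p [m, i]"
            have "f * brk_prod p vs - ?b * r \<in> K" if ins: "vs \<in> set (insertions rest)" for vs
            proof -
              obtain xs ys where xy: "rest = xs @ [m + i] # ys" "vs = xs @ [m, i] # ys"
                using insertionsD[OF ins] by blast
              let ?x = "brk_prod p xs" and ?y = "brk_prod p ys"
              have xs: "[] \<notin> set xs" and ys: "[] \<notin> set ys" using rest(1) xy by auto
              have "cfilt (Suc (0 + depth xs + 1)) (p (m + i) * ?x * ?b - ?b * ?x * p (m + i))"
                using cfilt_brk[of "[m, i]" p]
                by (intro cfilt_reverse3 cfilt.any cfilt_brk_prod xs) simp
              then have "cfilt (Suc (0 + depth xs + 1) + depth ys)
                  ((p (m + i) * ?x * ?b - ?b * ?x * p (m + i)) * ?y)"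
                by (intro cfilt.mult cfilt_brk_prod ys)
              moreover have "Suc (0 + depth xs + 1) + depth ys = Suc k"
                unfolding k lenu xy using True by simp
              moreover have "(p (m + i) * ?x * ?b - ?b * ?x * p (m + i)) * ?y = f * brk_prod p vs - ?b * r"
                unfolding f_def r_def xy True
                by (simp add: left_diff_distrib mult.assoc)
              ultimately show ?thesis by (metis high)
            qed
            then have "(\<Sum>vs\<leftarrow>insertions rest. f * brk_prod p vs - ?b * r) \<in> K"
              by (intro subspace_sum_list K)
            moreover have "(\<Sum>vs\<leftarrow>L. f * brk_prod p vs - ?b * r)
                = (\<Sum>vs\<leftarrow>L. f * brk_prod p vs) - scl (of_nat (length L)) (?b * r)" for L
              by (induction L) (simp_all add: scl_add_left)
            ultimately have "f * S - scl (of_nat (length (insertions rest))) (?b * r) \<in> K"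
              unfolding fS by simp
            then have "(brk p (m # i # u) * r + f * S)
                - (f * S - scl (of_nat (length (insertions rest))) (?b * r)) \<in> K"
              by (intro ncp.subspace_diff[OF K main])
            moreover have "(brk p (m # i # u) * r + f * S)
                - (f * S - scl (of_nat (length (insertions rest))) (?b * r))
              = scl (of_nat (Suc (length (insertions rest)))) (?b * r)"
              unfolding True by (simp add: scl_add_left)
            ultimately have "scl (of_nat (Suc (length (insertions rest)))) (?b * r) \<in> K"
              by simp
            then have "?b * r \<in> K"
              by (rule subspace_scale_cancel[OF K, rotated]) (simp del: of_nat_Suc)
            then show ?thesis unfolding True .
          qed
          then show ?thesis using v iu by (simp add: r_def)
        qed
      qed
      ultimately have "brk p w * brk_prod p rest \<in> K" by (rule linop_span)
      then show ?thesis by simp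
    qed
    \<comment> \<open>Moving the bracket to the front costs a commutator.\<close>
    moreover have "cfilt (Suc k) (brk_prod p ws - brk_prod p (w # rest))"
    proof -
      have w: "w \<noteq> []" and us: "[] \<notin> set us" and vs: "[] \<notin> set vs"
        using Suc.prems(1) ws by auto
      have "cfilt (Suc (depth us + (length w - 1)) + depth vs)
          (cmt (brk_prod p us) (brk p w) * brk_prod p vs)"
        by (intro cfilt.mult cfilt.comm cfilt_brk cfilt_brk_prod w us vs)
      moreover have "Suc (depth us + (length w - 1)) + depth vs = Suc k"
        unfolding k rest_def by simp
      moreover have "cmt (brk_prod p us) (brk p w) * brk_prod p vs
          = brk_prod p ws - brk_prod p (w # rest)"
        unfolding ws rest_def by (simp add: left_diff_distrib mult.assoc)
      ultimately show ?thesis by metis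
    qed
    ultimately show ?thesis by (rule exchange)
  qed
qed

text \<open>
  The criterion used below to show that everything in \<open>C\<^sub>k\<close> has some linear property: it suffices
  to treat \<open>C\<^sub>k\<^sub>+\<^sub>1\<close> and the images of \<open>C\<^sub>k\<^sub>-\<^sub>1\<close> under bracket insertions.
\<close>

lemma cfilt_in_subspace:
  fixes p :: "nat \<Rightarrow> ('b::monoid_add \<Rightarrow>\<^sub>0 'f::field_char_0)"
  assumes gen: "\<And>x. x \<in> ncp.span (bracket_products p {0<..} 0)"
    and D: "\<And>a b. 0 < a \<Longrightarrow> 0 < b \<Longrightarrow> bracket_insertion p (D a b) a b"
    and K: "ncp.subspace K"
    and high: "\<And>x. cfilt (Suc k) x \<Longrightarrow> x \<in> K"
    and DK: "\<And>a b x. 0 < a \<Longrightarrow> 0 < b \<Longrightarrow> cfilt (k - 1) x \<Longrightarrow> D a b x \<in> K"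
    and "0 < k" "cfilt k x"
  shows "x \<in> K"
proof -
  have "bracket_products p {0<..} k \<subseteq> K"
  proof
    fix y assume "y \<in> bracket_products p {0<..} k"
    then obtain ws where y: "y = brk_prod p ws"
      and ws: "[] \<notin> set ws" "\<Union>(set ` set ws) \<subseteq> {0<..}" "k \<le> depth ws"
      unfolding bracket_products_def by blast
    show "y \<in> K"
    proof (cases "depth ws = k")
      case False
      with ws have "cfilt (Suc k) y"
        unfolding y by (intro cfilt_mono[OF cfilt_brk_prod]) auto
      then show ?thesis by (rule high)
    next
      case True
      have "\<exists>w\<in>set ws. 2 \<le> length w"
      proof (rule ccontr)
        assume "\<not> ?thesis"
        then have "depth ws = 0"
          unfolding depth_def by (force simp: sum_list_eq_0_iff not_le)
        with True \<open>0 < k\<close> show False by simp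
      qed
      then obtain w where w: "w \<in> set ws" "2 \<le> length w" by blast
      then have "hd w \<in> set w" by (intro hd_in_set) auto
      then obtain m where m: "m \<in> set w" by blast
      have pos: "0 \<notin> \<Union>(set ` set ws)" using ws(2) by auto
      then have "0 < m" using w m by (metis UN_I gr0I)
      then show ?thesis
        unfolding y
        by (intro brk_prod_in_subspace[OF D K high DK ws(1) pos True refl w m,
              where t = "sum_list (concat ws)"]) auto
    qed
  qed
  then have "ncp.span (bracket_products p {0<..} k) \<subseteq> K"
    by (rule ncp.span_minimal[OF _ K])
  then show ?thesis
    using cfilt_span[OF gen \<open>cfilt k x\<close>] by blast
qed

section \<open>Noncommutative symmetric functions\<close>

type_synonym 'f ncsym = "nat word \<Rightarrow>\<^sub>0 'f"

text \<open>
  The letter \<open>c\<close> stands for the complete function of degree \<open>c + 1\<close>, so that every letter has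
  positive degree and the complete function of degree 0 is the unit.
\<close>

definition hsym :: "nat \<Rightarrow> 'f::field ncsym" where
  "hsym n = (case n of 0 \<Rightarrow> 1 | Suc c \<Rightarrow> letter c)"

lemma hsym_simps [simp]: "hsym 0 = 1" "hsym (Suc c) = letter c"
  by (simp_all add: hsym_def)

text \<open>Newton's identity \<open>newton\<close>, solved for the power sum of highest degree.\<close>

fun psym :: "nat \<Rightarrow> 'f::field ncsym" where
  "psym n = scl (of_nat n) (hsym n) - (\<Sum>i\<in>{1..<n}. psym i * hsym (n - i))"

declare psym.simps [simp del]

lemma psym_zero [simp]: "psym 0 = 0"
  by (simp add: psym.simps[of 0])

lemma sum_atLeast1_split: "0 < (n::nat) \<Longrightarrow> (\<Sum>i\<in>{1..n}. f i) = (\<Sum>i\<in>{1..<n}. f i) + (f n :: 'a::comm_monoid_add)"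
  by (cases n) (simp_all add: atLeastLessThanSuc_atLeastAtMost)

lemma newton: "(\<Sum>i\<in>{1..n}. psym i * hsym (n - i)) = scl (of_nat n) (hsym n)"
proof (cases "n = 0")
  case False
  then show ?thesis
    by (subst sum_atLeast1_split) (simp_all add: psym.simps[of n])
qed simp

lemma psym_generate:
  fixes x :: "'f::field_char_0 ncsym"
  shows "x \<in> ncp.span (bracket_products psym {0<..} 0)"
proof -
  let ?A = "ncp.span (bracket_products psym {0<..} 0) :: 'f ncsym set"
  have mult: "x * y \<in> ?A" if "x \<in> ?A" "y \<in> ?A" for x y
    using span_bracket_products_mult[OF that] by simp
  have one: "1 \<in> ?A"
    using bracket_productsI[of "[]" "{0<..}" 0 "psym :: nat \<Rightarrow> 'f ncsym"] by (simp add: ncp.span_base)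
  have p: "psym i \<in> ?A" if "0 < i" for i
    using bracket_productsI[of "[[i]]" "{0<..}" 0 "psym :: nat \<Rightarrow> 'f ncsym"] that by (simp add: ncp.span_base)
  have h: "hsym n \<in> ?A" for n
  proof (induction n rule: less_induct)
    case (less n)
    show ?case
    proof (cases "n = 0")
      case False
      have "scl (of_nat n) (hsym n) \<in> ?A"
        unfolding newton[symmetric] by (intro ncp.span_sum mult p less.IH) auto
      then show ?thesis
        by (rule subspace_scale_cancel[OF ncp.subspace_span, rotated]) (simp add: False)
    qed (simp add: one)
  qed
  have "basis (Word w) \<in> ?A" for w
  proof (induction w)
    case Nil
    then show ?case using one by (simp add: Word_Nil)
  next
    case (Cons c w)
    then show ?case using h[of "Suc c"] by (simp add: basis_Cons mult)
  qed
  then have basis: "basis w \<in> ?A" for w by (cases w) simp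
  show ?thesis
    by (induction x rule: poly_mapping_linear_induct)
       (simp_all add: basis ncp.span_zero ncp.span_add ncp.span_scale)
qed

fun insert_word :: "'f ncsym \<Rightarrow> nat \<Rightarrow> nat list \<Rightarrow> 'f::field ncsym" where
  "insert_word u d [] = 0"
| "insert_word u d (c # w) =
     (if d \<le> Suc c then u * hsym (Suc c - d) else 0) * basis (Word w) + letter c * insert_word u d w"

text \<open>
  The derivation that maps the complete function of degree \<open>n\<close> to \<open>u\<close> times the one of degree
  \<open>n - d\<close>. Prescribing it on complete functions, rather than on power sums, makes it compatible, for
  primitive \<open>u\<close>, with cutting set compositions; see \<open>cut_insert_bracket\<close>.
\<close>

definition insert_bracket :: "'f ncsym \<Rightarrow> nat \<Rightarrow> 'f ncsym \<Rightarrow> 'f::field ncsym" where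
  "insert_bracket u d = lin (\<lambda>w. insert_word u d (letters w))"

lemma insert_word_append:
  "insert_word u d (v @ w) = insert_word u d v * basis (Word w) + basis (Word v) * insert_word u d w"
proof (induction v)
  case (Cons c v)
  have "basis (Word (v @ w)) = basis (Word v) * (basis (Word w) :: 'a ncsym)"
    by (simp only: Word_append basis_add)
  then show ?case
    by (simp only: append_Cons insert_word.simps Cons basis_Cons distrib_left distrib_right mult.assoc add.assoc)
qed (simp add: Word_Nil)

lemma insert_bracket_derivation: "derivation (insert_bracket u d)"
proof -
  let ?D = "insert_bracket u d"
  have D: "linop ?D" by (simp add: insert_bracket_def)
  note lin = linop_add[OF D] linop_scl[OF D]
  have basis: "?D (basis v * basis w) = ?D (basis v) * basis w + basis v * ?D (basis w)" for v w
    using insert_word_append[of u d "letters v" "letters w"]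
    by (simp add: insert_bracket_def flip: basis_add)
  have left: "?D (basis v * y) = ?D (basis v) * y + basis v * ?D y" for v y
    by (rule linop_ext[of "\<lambda>y. ?D (basis v * y)" "\<lambda>y. ?D (basis v) * y + basis v * ?D y"])
       (simp_all add: linop_def lin basis distrib_left scl_add scl_mult_right ac_simps)
  have "?D (x * y) = ?D x * y + x * ?D y" for x y
    by (rule linop_ext[of "\<lambda>x. ?D (x * y)" "\<lambda>x. ?D x * y + x * ?D y"])
       (simp_all add: linop_def lin left distrib_right scl_add scl_mult_left ac_simps)
  then show ?thesis using D by (simp add: derivation_def)
qed

lemma insert_bracket_hsym:
  assumes "0 < d"
  shows "insert_bracket u d (hsym n) = (if d \<le> n then u * hsym (n - d) else 0)"
proof (cases n)
  case 0
  have "insert_bracket u d 1 = insert_word u d []"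
    unfolding single_one[symmetric] insert_bracket_def lin_basis by simp
  then show ?thesis using 0 assms by simp
next
  case (Suc c)
  have "insert_bracket u d (letter c) = insert_word u d [c]"
    by (simp add: insert_bracket_def letter_def)
  then show ?thesis using Suc by (simp add: Word_Nil)
qed

text \<open>
  The claimed values satisfy the recursion that results from applying the derivation to Newton's
  identity.
\<close>

lemma insert_bracket_psym:
  fixes u :: "'f::field ncsym"
  assumes d: "0 < d"
  shows "0 < n \<Longrightarrow> insert_bracket u d (psym n) =
    (if n < d then 0 else if n = d then scl (of_nat d) u else cmt u (psym (n - d)))"
proof (induction n rule: less_induct)
  case (less n)
  let ?D = "insert_bracket u d :: 'f ncsym \<Rightarrow> 'f ncsym"
  define q where "q n = (if n < d then 0 else if n = d then scl (of_nat d) u else cmt u (psym (n - d)))" for n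
  have D: "linop ?D" and leibniz: "?D (x * y) = ?D x * y + x * ?D y" for x y
    using insert_bracket_derivation[of u d] by (simp_all add: derivation_def)
  let ?T = "\<Sum>i\<in>{1..n}. psym i * ?D (hsym (n - i))"
  have "scl (of_nat n) (?D (hsym n)) = ?D (\<Sum>i\<in>{1..n}. psym i * hsym (n - i))"
    by (simp only: newton linop_scl[OF D])
  also have "\<dots> = (\<Sum>i\<in>{1..n}. ?D (psym i) * hsym (n - i)) + ?T"
    by (simp add: linop_sum[OF D] leibniz sum.distrib)
  finally have 1: "scl (of_nat n) (?D (hsym n)) = (\<Sum>i\<in>{1..n}. ?D (psym i) * hsym (n - i)) + ?T" .
  have 2: "scl (of_nat n) (?D (hsym n)) = (\<Sum>i\<in>{1..n}. q i * hsym (n - i)) + ?T"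
  proof (cases "n < d")
    case True
    then show ?thesis
      by (auto simp: insert_bracket_hsym[OF d] q_def intro!: sum.neutral)
  next
    case False
    then obtain m where m: "n = d + m" by (metis le_Suc_ex not_less)
    have T: "?T = (\<Sum>i\<in>{1..m}. psym i * (u * hsym (m - i)))"
    proof (rule sum.mono_neutral_cong_right)
      show "\<forall>i\<in>{1..n} - {1..m}. psym i * ?D (hsym (n - i)) = 0"
        using d by (auto simp: insert_bracket_hsym[OF d] m)
    qed (use d in \<open>auto simp: insert_bracket_hsym[OF d] m\<close>)
    have "(\<Sum>i\<in>{1..n}. q i * hsym (n - i)) = (\<Sum>i\<in>{d..n}. q i * hsym (n - i))"
      by (rule sum.mono_neutral_right) (use d in \<open>auto simp: q_def\<close>)
    also have "\<dots> = (\<Sum>j\<in>{0..m}. q (j + d) * hsym (m - j))"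
      using sum.shift_bounds_cl_nat_ivl[of "\<lambda>i. q i * hsym (n - i)" 0 d m] by (simp add: m add.commute)
    also have "\<dots> = q d * hsym m + (\<Sum>j\<in>{1..m}. q (j + d) * hsym (m - j))"
      by (simp add: sum.atLeast_Suc_atMost)
    also have "(\<Sum>j\<in>{1..m}. q (j + d) * hsym (m - j))
        = (\<Sum>j\<in>{1..m}. u * (psym j * hsym (m - j))) - (\<Sum>j\<in>{1..m}. psym j * (u * hsym (m - j)))"
      unfolding sum_subtractf[symmetric]
      by (intro sum.cong refl) (auto simp: q_def left_diff_distrib mult.assoc)
    also have "(\<Sum>j\<in>{1..m}. u * (psym j * hsym (m - j))) = u * scl (of_nat m) (hsym m)"
      unfolding newton[symmetric] sum_distrib_left ..
    finally have "(\<Sum>i\<in>{1..n}. q i * hsym (n - i)) + ?T = q d * hsym m + u * scl (of_nat m) (hsym m)"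
      using T by simp
    also have "\<dots> = scl (of_nat n) (?D (hsym n))"
      using False by (simp add: insert_bracket_hsym[OF d] m q_def scl_mult_left scl_mult_right scl_add_left)
    finally show ?thesis ..
  qed
  have "(\<Sum>i\<in>{1..<n}. ?D (psym i) * hsym (n - i)) = (\<Sum>i\<in>{1..<n}. q i * hsym (n - i))"
    using less.IH by (intro sum.cong refl) (auto simp: q_def)
  then have "?D (psym n) = q n"
    using 1 2 sum_atLeast1_split[OF less.prems, of "\<lambda>i. ?D (psym i) * hsym (n - i)"]
      sum_atLeast1_split[OF less.prems, of "\<lambda>i. q i * hsym (n - i)"] by simp
  then show ?case by (simp add: q_def)
qed

lemma cfilt_insert_bracket:
  assumes "cfilt 1 u"
  shows "cfilt 1 (insert_bracket u d x)"
proof -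
  have w: "cfilt 1 (insert_word u d w)" for w
  proof (induction w)
    case (Cons c w)
    have "cfilt 1 (if d \<le> Suc c then u * hsym (Suc c - d) else 0)"
      using cfilt_multR[OF assms] by (simp add: cfilt.zero)
    then show ?case
      unfolding insert_word.simps by (intro cfilt.add cfilt_multR cfilt_multL[OF Cons])
  qed (simp add: cfilt.zero)
  show ?thesis
    unfolding insert_bracket_def
    by (induction x rule: poly_mapping_linear_induct)
       (simp_all add: w[simplified] lin_zero lin_add lin_scl cfilt.zero cfilt.add cfilt_scl)
qed

lemma cfilt_cmt: "cfilt 1 (cmt x y)"
  using cfilt.comm[OF cfilt.any cfilt.any, of x y] by simp

abbreviation pair_insertion :: "nat \<Rightarrow> nat \<Rightarrow> 'f ncsym \<Rightarrow> 'f::field ncsym" where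
  "pair_insertion a b \<equiv> insert_bracket (cmt (psym a) (psym b)) (a + b)"

lemma bracket_insertion_psym:
  assumes "0 < a" "0 < b"
  shows "bracket_insertion psym (pair_insertion a b :: 'f ncsym \<Rightarrow> 'f::field_char_0 ncsym) a b"
proof
  let ?u = "cmt (psym a) (psym b) :: 'f ncsym"
  show "derivation (pair_insertion a b :: 'f ncsym \<Rightarrow> _)"
    by (rule insert_bracket_derivation)
  show "pair_insertion a b (psym (a + b)) = scl (of_nat (a + b)) ?u"
    using assms by (simp add: insert_bracket_psym)
  show "cfilt 2 (pair_insertion a b (psym i :: 'f ncsym))" if "0 < i" "i \<noteq> a + b" for i
  proof -
    have "cfilt 2 (cmt ?u (psym (i - (a + b))))"
      using cfilt.comm[OF cfilt_cmt cfilt.any, of "psym a" "psym b :: 'f ncsym" "psym (i - (a + b))"]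
      by (simp only: One_nat_def add_0_right numeral_2_eq_2)
    moreover have "pair_insertion a b (psym i) = (if i < a + b then 0 else cmt ?u (psym (i - (a + b))))"
      using insert_bracket_psym[of "a + b" i ?u] that assms by auto
    ultimately show ?thesis
      by (cases "i < a + b") (simp_all only: if_True if_False cfilt.zero)
  qed
qed

section \<open>The left action of set lists and the commutator filtration\<close>

definition wedge_lin :: "'a set list \<Rightarrow> ('a set word \<Rightarrow>\<^sub>0 'f) \<Rightarrow> 'a set word \<Rightarrow>\<^sub>0 'f::field" where
  "wedge_lin P = lin (\<lambda>w. basis (Word (wedge P (letters w))))"

lemma linop_wedge_lin [simp]: "linop (wedge_lin P)"
  by (simp add: wedge_lin_def)

lemma wedge_lin_basis [simp]: "wedge_lin P (basis w) = basis (Word (wedge P (letters w)))"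
  by (simp add: wedge_lin_def)

text \<open>
  Multiplying from the left by a list of several blocks is not a homomorphism for concatenation. It
  becomes a product of homomorphisms, one for each block, once the argument has been duplicated by
  the diagonal, which is a homomorphism.
\<close>

definition diag :: "('a::monoid_add \<Rightarrow>\<^sub>0 'f) \<Rightarrow> 'a \<times> 'a \<Rightarrow>\<^sub>0 'f::field" where
  "diag = lin (\<lambda>w. basis (w, w))"

lemma linop_diag: "linop diag"
  by (simp add: diag_def)

lemma diag_mult: "diag (x * y) = diag x * diag y"
  unfolding diag_def by (rule lin_mult) (simp add: mult_single plus_prod_def)

text \<open>
  The spans are closed under commutators because
  \<open>[a \<otimes> b, c \<otimes> d] = [a, c] \<otimes> b d + c a \<otimes> [b, d]\<close>.
\<close>

lemma cfilt_tensor_span: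
  fixes z :: "'a::monoid_add \<times> 'b::monoid_add \<Rightarrow>\<^sub>0 'f::field"
  shows "cfilt k z \<Longrightarrow> z \<in> ncp.span {tens x y | x y s t. cfilt s x \<and> cfilt t y \<and> k \<le> s + t}"
    (is "_ \<Longrightarrow> z \<in> ncp.span (?T k)")
proof (induction rule: cfilt.induct)
  case (any z)
  have "basis w \<in> ?T 0" for w
    using cfilt.any tens_basis[of "fst w" "snd w"] by (metis (mono_tags, lifting) add_0 le0 mem_Collect_eq prod.collapse)
  then have basis: "basis w \<in> ncp.span (?T 0)" for w
    by (rule ncp.span_base)
  show ?case
    by (induction z rule: poly_mapping_linear_induct)
       (rule ncp.span_zero basis ncp.span_add ncp.span_scale; assumption?)+
next
  case (mult s x t y)
  show ?case
  proof (rule bilinear_span[OF linop_times mult.IH])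
    fix a b assume "a \<in> ?T s" "b \<in> ?T t"
    then obtain x y s1 s2 x' y' t1 t2 where *: "a = tens x y" "cfilt s1 x" "cfilt s2 y" "s \<le> s1 + s2"
      "b = tens x' y'" "cfilt t1 x'" "cfilt t2 y'" "t \<le> t1 + t2" by blast
    have "a * b = tens (x * x') (y * y')" by (simp add: * tens_mult)
    moreover have "cfilt (s1 + t1) (x * x')" "cfilt (s2 + t2) (y * y')"
      by (intro cfilt.mult *)+
    moreover have "s + t \<le> (s1 + t1) + (s2 + t2)" using * by simp
    ultimately show "a * b \<in> ncp.span (?T (s + t))"
      by (intro ncp.span_base) blast
  qed
next
  case (comm s x t y)
  show ?case
  proof (rule bilinear_span[OF linop_cmt comm.IH])
    fix a b assume "a \<in> ?T s" "b \<in> ?T t"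
    then obtain x y s1 s2 x' y' t1 t2 where *: "a = tens x y" "cfilt s1 x" "cfilt s2 y" "s \<le> s1 + s2"
      "b = tens x' y'" "cfilt t1 x'" "cfilt t2 y'" "t \<le> t1 + t2" by blast
    have tens_diff: "tens (u - u') v = tens u v - tens u' v" "tens v (u - u') = tens v u - tens v u'"
      for u u' :: "'c::monoid_add \<Rightarrow>\<^sub>0 'f" and v :: "'d::monoid_add \<Rightarrow>\<^sub>0 'f"
      using linop_diff[OF linop_tens(1)[OF linop_ident], of u u' v]
        linop_diff[OF linop_tens(2)[OF linop_ident], of v u u'] by simp_all
    have "cmt a b = tens (cmt x x') (y * y') + tens (x' * x) (cmt y y')"
      by (simp add: * tens_mult tens_diff)
    moreover have "tens (cmt x x') (y * y') \<in> ?T (Suc (s + t))"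
    proof -
      have "cfilt (Suc (s1 + t1)) (cmt x x')" "cfilt (s2 + t2) (y * y')"
        by (intro cfilt.comm cfilt.mult *)+
      moreover have "Suc (s + t) \<le> Suc (s1 + t1) + (s2 + t2)" using * by simp
      ultimately show ?thesis by blast
    qed
    moreover have "tens (x' * x) (cmt y y') \<in> ?T (Suc (s + t))"
    proof -
      have "cfilt (t1 + s1) (x' * x)" "cfilt (Suc (s2 + t2)) (cmt y y')"
        by (intro cfilt.comm cfilt.mult *)+
      moreover have "Suc (s + t) \<le> (t1 + s1) + Suc (s2 + t2)" using * by simp
      ultimately show ?thesis by blast
    qed
    ultimately show "cmt a b \<in> ncp.span (?T (Suc (s + t)))"
      by (simp only: ncp.span_add ncp.span_base)
  qed
next
  case (weaken k x)
  have "?T (Suc k) \<subseteq> ?T k" using Suc_leD by blast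
  then show ?case using weaken.IH ncp.span_mono by blast
next
  case (zero k)
  show ?case by (rule ncp.span_zero)
next
  case (add k x y)
  from add.IH show ?case by (rule ncp.span_add)
qed

lemma subspace_cfilt: "ncp.subspace {x. cfilt k x}"
  by (rule ncp.subspaceI) (auto intro: cfilt.zero cfilt.add cfilt_scl)

lemma cfilt_diag_eval:
  assumes "cfilt k x" "linop M"
    and "\<And>s t a b. cfilt s a \<Longrightarrow> cfilt t b \<Longrightarrow> cfilt (s + t + j) (M (tens a b))"
  shows "cfilt (k + j) (M (diag x))"
proof -
  have "cfilt k (diag x)"
    by (rule cfilt_hom[OF assms(1)])
       (simp_all add: diag_mult linop_zero[OF linop_diag] linop_add[OF linop_diag] linop_diff[OF linop_diag])
  then have "diag x \<in> ncp.span {tens x y | x y s t. cfilt s x \<and> cfilt t y \<and> k \<le> s + t}"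
    by (rule cfilt_tensor_span)
  then have "M (diag x) \<in> {x. cfilt (k + j) x}"
  proof (rule linop_span[OF assms(2) _ subspace_cfilt])
    fix z :: "'a \<times> 'a \<Rightarrow>\<^sub>0 'b" assume "z \<in> {tens x y | x y s t. cfilt s x \<and> cfilt t y \<and> k \<le> s + t}"
    then obtain a b s t where "z = tens a b" "cfilt s a" "cfilt t b" "k \<le> s + t" by blast
    then show "M z \<in> {x. cfilt (k + j) x}"
      using cfilt_mono[OF assms(3)] by simp
  qed
  then show ?thesis by simp
qed

definition wedge_pair :: "'a set list \<Rightarrow> 'a set list \<Rightarrow>
    ('a set word \<times> 'a set word \<Rightarrow>\<^sub>0 'f) \<Rightarrow> 'a set word \<Rightarrow>\<^sub>0 'f::field" where
  "wedge_pair P Q = lin (\<lambda>vw. wedge_lin P (basis (fst vw)) * wedge_lin Q (basis (snd vw)))"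

definition wedge_pair_swapped :: "'a set list \<Rightarrow> 'a set list \<Rightarrow>
    ('a set word \<times> 'a set word \<Rightarrow>\<^sub>0 'f) \<Rightarrow> 'a set word \<Rightarrow>\<^sub>0 'f::field" where
  "wedge_pair_swapped P Q = lin (\<lambda>vw. wedge_lin Q (basis (snd vw)) * wedge_lin P (basis (fst vw)))"

lemma linop_wedge_pair: "linop (wedge_pair P Q)" "linop (wedge_pair_swapped P Q)"
  by (simp_all add: wedge_pair_def wedge_pair_swapped_def)

lemma wedge_lin_append:
  "wedge_lin (P @ Q) x = wedge_pair P Q (diag x)"
  "wedge_lin (Q @ P) x = wedge_pair_swapped P Q (diag x)"
  unfolding wedge_pair_def wedge_pair_swapped_def
  by (rule linop_ext[OF linop_wedge_lin linop_comp[OF linop_lin linop_diag]],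
      simp add: diag_def wedge_append mult_single flip: Word_append)+

lemma wedge_pair_tens:
  "wedge_pair P Q (tens a b) = wedge_lin P a * wedge_lin Q b"
  "wedge_pair_swapped P Q (tens a b) = wedge_lin Q b * wedge_lin P a"
proof -
  have eval: "F (tens a b) = G a b"
    if "linop F" "\<And>b. linop (\<lambda>a. G a b)" "\<And>a. linop (G a)" "\<And>v w. F (basis (v, w)) = G (basis v) (basis w)"
    for F :: "('a set word \<times> 'a set word \<Rightarrow>\<^sub>0 'b) \<Rightarrow> 'a set word \<Rightarrow>\<^sub>0 'b" and G
  proof (rule linop_ext[of "\<lambda>a. F (tens a b)" "\<lambda>a. G a b"])
    fix v
    show "F (tens (basis v) b) = G (basis v) b"
      by (rule linop_ext[OF linop_comp[OF that(1) linop_tens(2)[OF linop_ident]] that(3)])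
         (simp add: tens_basis that(4))
  qed (rule linop_comp[OF that(1) linop_tens(1)[OF linop_ident]] that(2))+
  show "wedge_pair P Q (tens a b) = wedge_lin P a * wedge_lin Q b"
    by (rule eval[OF linop_wedge_pair(1)]; simp add: wedge_pair_def wedge_lin_def linop_simps)
  show "wedge_pair_swapped P Q (tens a b) = wedge_lin Q b * wedge_lin P a"
    by (rule eval[OF linop_wedge_pair(2), where G = "\<lambda>a b. wedge_lin Q b * wedge_lin P a"];
        simp add: wedge_pair_swapped_def wedge_lin_def linop_simps)
qed

lemma cfilt_wedge_lin: "cfilt k x \<Longrightarrow> cfilt k (wedge_lin P x)"
proof (induction P arbitrary: k x)
  case Nil
  show ?case
    by (rule cfilt_hom[OF Nil, of "wedge_lin []"])
       (simp_all add: wedge_lin_def lin_zero lin_add lin_diff lin_mult wedge_Nil Word_Nil)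
next
  case (Cons A P)
  have single: "cfilt k (wedge_lin [A] x)" if "cfilt k x" for k and x :: "'a set word \<Rightarrow>\<^sub>0 'b"
  proof (rule cfilt_hom[OF that, of "wedge_lin [A]"])
    show "wedge_lin [A] (x * y) = wedge_lin [A] x * wedge_lin [A] y" for x y :: "'a set word \<Rightarrow>\<^sub>0 'b"
      unfolding wedge_lin_def
      by (rule lin_mult) (simp add: wedge_Cons wedge_Nil mult_single flip: Word_append)
  qed (simp_all add: wedge_lin_def lin_zero lin_add lin_diff)
  have "cfilt (k + 0) (wedge_lin ([A] @ P) x)"
    unfolding wedge_lin_append(1)
    by (rule cfilt_diag_eval[OF Cons.prems linop_wedge_pair(1)])
       (simp add: wedge_pair_tens cfilt.mult single Cons.IH)
  then show ?case by simp
qed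

text \<open>On a pure tensor, the two orders differ by a commutator.\<close>

lemma cfilt_wedge_lin_swap:
  assumes "cfilt k x"
  shows "cfilt (Suc k) (wedge_lin (P @ Q) x - wedge_lin (Q @ P) x)"
proof -
  have "cfilt (k + 1) (wedge_pair P Q (diag x) - wedge_pair_swapped P Q (diag x))"
    by (rule cfilt_diag_eval[OF assms linop_minus[OF linop_wedge_pair]])
       (simp add: wedge_pair_tens cfilt.comm cfilt_wedge_lin)
  then show ?thesis
    unfolding wedge_lin_append(1)[of P Q] wedge_lin_append(2)[of Q P] by simp
qed

lemma cfilt_wedge_lin_append:
  fixes x :: "'a set word \<Rightarrow>\<^sub>0 'f::field"
  assumes step: "\<And>k (x :: 'a set word \<Rightarrow>\<^sub>0 'f). cfilt k x \<Longrightarrow> cfilt (Suc k) (wedge_lin P x - wedge_lin P' x)"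
    and x: "cfilt k x"
  shows "cfilt (Suc k) (wedge_lin (P @ Q) x - wedge_lin (P' @ Q) x)"
    and "cfilt (Suc k) (wedge_lin (Q @ P) x - wedge_lin (Q @ P') x)"
proof -
  have "cfilt (k + 1) (wedge_pair P Q (diag x) - wedge_pair P' Q (diag x))"
  proof (rule cfilt_diag_eval[OF x linop_minus[OF linop_wedge_pair(1) linop_wedge_pair(1)]])
    fix s t and a b :: "'a set word \<Rightarrow>\<^sub>0 'f" assume "cfilt s a" "cfilt t b"
    then have "cfilt (Suc s + t) ((wedge_lin P a - wedge_lin P' a) * wedge_lin Q b)"
      by (intro cfilt.mult step cfilt_wedge_lin)
    then show "cfilt (s + t + 1) (wedge_pair P Q (tens a b) - wedge_pair P' Q (tens a b))"
      by (simp add: wedge_pair_tens left_diff_distrib)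
  qed
  then show "cfilt (Suc k) (wedge_lin (P @ Q) x - wedge_lin (P' @ Q) x)"
    by (simp add: wedge_lin_append(1))
  have "cfilt (k + 1) (wedge_pair Q P (diag x) - wedge_pair Q P' (diag x))"
  proof (rule cfilt_diag_eval[OF x linop_minus[OF linop_wedge_pair(1) linop_wedge_pair(1)]])
    fix s t and a b :: "'a set word \<Rightarrow>\<^sub>0 'f" assume "cfilt s a" "cfilt t b"
    then have "cfilt (s + Suc t) (wedge_lin Q a * (wedge_lin P b - wedge_lin P' b))"
      by (intro cfilt.mult step cfilt_wedge_lin)
    then show "cfilt (s + t + 1) (wedge_pair Q P (tens a b) - wedge_pair Q P' (tens a b))"
      by (simp add: wedge_pair_tens right_diff_distrib)
  qed
  then show "cfilt (Suc k) (wedge_lin (Q @ P) x - wedge_lin (Q @ P') x)"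
    by (simp add: wedge_lin_append(1))
qed

text \<open>
  The step from the radical to the filtration: rearranging blocks of the left factor gains one
  degree.
\<close>

lemma cfilt_wedge_lin_perm:
  "mset P = mset P' \<Longrightarrow> cfilt k x \<Longrightarrow> cfilt (Suc k) (wedge_lin P x - wedge_lin P' x)"
proof (induction P arbitrary: P' k x)
  case Nil
  then show ?case by (simp add: cfilt.zero)
next
  case (Cons A P)
  then have "A \<in> set P'" by (metis list.set_intros(1) mset_eq_setD)
  then obtain U V where P': "P' = U @ A # V"
    by (meson split_list)
  have "mset P = mset (U @ V)" using Cons.prems(1) P' by simp
  then have "cfilt (Suc k) (wedge_lin ([A] @ P) x - wedge_lin ([A] @ (U @ V)) x)"
    by (intro cfilt_wedge_lin_append(2)[OF Cons.IH] Cons.prems)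
  moreover have "cfilt (Suc k) (wedge_lin (([A] @ U) @ V) x - wedge_lin ((U @ [A]) @ V) x)"
    by (intro cfilt_wedge_lin_append(1) cfilt_wedge_lin_swap Cons.prems)
  ultimately have "cfilt (Suc k) ((wedge_lin ([A] @ P) x - wedge_lin ([A] @ (U @ V)) x)
      + (wedge_lin (([A] @ U) @ V) x - wedge_lin ((U @ [A]) @ V) x))"
    by (rule cfilt.add)
  then show ?case by (simp add: P')
qed

section \<open>Symmetric functions as sums of ordered set partitions\<close>

definition block :: "'a set \<Rightarrow> 'a set word \<Rightarrow>\<^sub>0 'f::field" where
  "block S = (if S = {} then 1 else letter S)"

text \<open>
  The sum of all ordered partitions of \<open>S\<close> with prescribed block sizes; see \<open>lookup_expand_word\<close>.
\<close>

fun expand_word :: "'a set \<Rightarrow> nat list \<Rightarrow> 'a set word \<Rightarrow>\<^sub>0 'f::field" where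
  "expand_word S [] = (if S = {} then 1 else 0)"
| "expand_word S (c # w) = (\<Sum>A | A \<subseteq> S \<and> card A = Suc c. letter A * expand_word (S - A) w)"

definition expand :: "'a set \<Rightarrow> 'f ncsym \<Rightarrow> 'a set word \<Rightarrow>\<^sub>0 'f::field" where
  "expand S = lin (\<lambda>w. expand_word S (letters w))"

lemma linop_expand [simp]: "linop (expand S)"
  by (simp add: expand_def)

lemmas expand_linear = linop_zero[OF linop_expand] linop_add[OF linop_expand] linop_diff[OF linop_expand]
  linop_scl[OF linop_expand] linop_sum[OF linop_expand]

lemma expand_basis: "expand S (basis (Word w)) = expand_word S w"
  by (simp add: expand_def)

lemma expand_one: "expand S 1 = (if S = {} then 1 else 0)"
  using expand_basis[of S "[]"] by (simp add: Word_Nil)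

lemma expand_letter:
  assumes "finite S"
  shows "expand S (letter c) = (if card S = Suc c then letter S else 0)"
proof -
  have "expand S (letter c) = (\<Sum>A | A \<subseteq> S \<and> card A = Suc c. letter A * (if S - A = {} then 1 else 0))"
    by (simp add: letter_def expand_basis)
  also have "\<dots> = (\<Sum>A | A \<subseteq> S \<and> card A = Suc c. if A = S then letter A else 0)"
    by (intro sum.cong refl) auto
  also have "\<dots> = (if card S = Suc c then letter S else 0)"
    using assms by simp
  finally show ?thesis .
qed

lemma expand_hsym: "finite S \<Longrightarrow> expand S (hsym n) = (if card S = n then block S else 0)"
  by (cases n) (auto simp: expand_one expand_letter block_def)

lemma sum_Pow_Pow:
  assumes "finite S"
  shows "(\<Sum>A\<in>Pow S. \<Sum>B\<in>Pow A. g B (A - B) (S - A)) = (\<Sum>B\<in>Pow S. \<Sum>A\<in>Pow (S - B). g B A (S - B - A))"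
proof -
  have fin: "finite A" if "A \<in> Pow S" for A
    using that assms finite_subset by auto
  have "(\<Sum>A\<in>Pow S. \<Sum>B\<in>Pow A. g B (A - B) (S - A))
      = (\<Sum>(A, B)\<in>Sigma (Pow S) Pow. g B (A - B) (S - A))"
    using assms fin by (intro sum.Sigma) auto
  also have "\<dots> = (\<Sum>(B, A)\<in>Sigma (Pow S) (\<lambda>B. Pow (S - B)). g B A (S - B - A))"
    by (rule sum.reindex_bij_witness[where i = "\<lambda>(B, A). (A \<union> B, B)" and j = "\<lambda>(A, B). (B, A - B)"])
       (auto intro!: arg_cong[where f = "g _ _"])
  also have "\<dots> = (\<Sum>B\<in>Pow S. \<Sum>A\<in>Pow (S - B). g B A (S - B - A))"
    using assms fin by (intro sum.Sigma[symmetric]) auto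
  finally show ?thesis .
qed

lemma expand_word_Cons:
  assumes "finite S"
  shows "(expand_word S (c # w) :: 'a set word \<Rightarrow>\<^sub>0 'f::field)
    = (\<Sum>A\<in>Pow S. (if card A = Suc c then letter A else 0) * expand_word (S - A) w)"
proof -
  have "(\<Sum>A\<in>Pow S. (if card A = Suc c then letter A else 0) * (expand_word (S - A) w :: 'a set word \<Rightarrow>\<^sub>0 'f))
      = (\<Sum>A\<in>Pow S. if card A = Suc c then letter A * expand_word (S - A) w else 0)"
    by (intro sum.cong refl) simp
  also have "\<dots> = (\<Sum>A | A \<in> Pow S \<and> card A = Suc c. letter A * expand_word (S - A) w)"
    using assms by (intro sum.inter_filter[symmetric]) simp
  finally show ?thesis by simp
qed

lemma expand_word_append:
  "finite S \<Longrightarrow> (expand_word S (v @ w) :: 'a set word \<Rightarrow>\<^sub>0 'f::field) = (\<Sum>A\<in>Pow S. expand_word A v * expand_word (S - A) w)"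
proof (induction v arbitrary: S)
  case Nil
  have "(\<Sum>A\<in>Pow S. expand_word A [] * (expand_word (S - A) w :: 'a set word \<Rightarrow>\<^sub>0 'f))
      = (\<Sum>A\<in>Pow S. if A = {} then expand_word (S - A) w else 0)"
    by (intro sum.cong refl) simp
  then show ?case using Nil by simp
next
  case (Cons c v)
  let ?l = "\<lambda>A. if card A = Suc c then letter A else 0"
  let ?g = "\<lambda>B A C. ?l B * (expand_word A v * expand_word C w) :: 'a set word \<Rightarrow>\<^sub>0 'f"
  have fin: "finite A" if "A \<in> Pow S" for A
    using that Cons.prems finite_subset by auto
  have "expand_word S ((c # v) @ w) = (\<Sum>B\<in>Pow S. \<Sum>A\<in>Pow (S - B). ?g B A (S - B - A))"
    using Cons by (simp add: expand_word_Cons sum_distrib_left del: expand_word.simps)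
  also have "\<dots> = (\<Sum>A\<in>Pow S. \<Sum>B\<in>Pow A. ?g B (A - B) (S - A))"
    by (rule sum_Pow_Pow[symmetric, OF Cons.prems])
  also have "\<dots> = (\<Sum>A\<in>Pow S. expand_word A (c # v) * expand_word (S - A) w)"
    by (intro sum.cong refl)
       (simp add: expand_word_Cons[OF fin] sum_distrib_right mult.assoc del: expand_word.simps)
  finally show ?case .
qed

text \<open>An ordered partition into two groups of blocks splits the ground set in two.\<close>

lemma expand_mult:
  assumes "finite S"
  shows "expand S (x * y) = (\<Sum>A\<in>Pow S. expand A x * expand (S - A) y)"
proof -
  have basis: "expand S (basis v * basis w) = (\<Sum>A\<in>Pow S. expand A (basis v) * expand (S - A) (basis w))" for v w
    using expand_word_append[OF assms, of "letters v" "letters w"]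
    by (simp add: expand_def flip: basis_add)
  have "expand S (basis v * y) = (\<Sum>A\<in>Pow S. expand A (basis v) * expand (S - A) y)" for v
    by (rule linop_ext[of "\<lambda>y. expand S (basis v * y)" "\<lambda>y. \<Sum>A\<in>Pow S. expand A (basis v) * expand (S - A) y"])
       (simp_all add: linop_def basis expand_linear distrib_left scl_mult_right scl_sum sum.distrib)
  then show ?thesis
    by (rule linop_ext[of "\<lambda>x. expand S (x * y)" "\<lambda>x. \<Sum>A\<in>Pow S. expand A x * expand (S - A) y", rotated 2])
       (simp_all add: linop_def expand_linear distrib_right scl_mult_left scl_sum sum.distrib)
qed

text \<open>
  Homogeneity is expressed through expansions, which is how it is used; the first argument only
  fixes the type of the labels.
\<close>

definition homog :: "'a itself \<Rightarrow> nat \<Rightarrow> 'f::field ncsym \<Rightarrow> bool" where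
  "homog _ n x \<longleftrightarrow> (\<forall>S :: 'a set. finite S \<longrightarrow> card S \<noteq> n \<longrightarrow> expand S x = 0)"

lemma homogD: "homog TYPE('a) n x \<Longrightarrow> finite (S :: 'a set) \<Longrightarrow> card S \<noteq> n \<Longrightarrow> expand S x = 0"
  by (simp add: homog_def)

lemma homog_diff: "homog T n x \<Longrightarrow> homog T n y \<Longrightarrow> homog T n (x - y)"
  and homog_scl: "homog T n x \<Longrightarrow> homog T n (scl c x)"
  by (simp_all add: homog_def expand_linear)

lemma homog_sum: "(\<And>a. a \<in> A \<Longrightarrow> homog T n (f a)) \<Longrightarrow> homog T n (sum f A)"
  by (simp add: homog_def expand_linear)

lemma homog_hsym: "homog T n (hsym n)"
  by (simp add: homog_def expand_hsym)

lemma homog_mult: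
  assumes "homog T m x" "homog T n y"
  shows "homog T (m + n) (x * y)"
  unfolding homog_def
proof (intro allI impI)
  fix S :: "'a set" assume S: "finite S" "card S \<noteq> m + n"
  have "expand A x * expand (S - A) y = 0" if "A \<in> Pow S" for A
  proof (cases "card A = m")
    case True
    have "card (S - A) \<noteq> n"
      using S True that card_mono[of S A] finite_subset[of A S] by (auto simp: card_Diff_subset)
    then show ?thesis using assms(2) S(1) by (simp add: homog_def)
  next
    case False
    then show ?thesis using assms(1) S(1) that finite_subset[of A S] by (simp add: homog_def)
  qed
  then show "expand S (x * y) = 0"
    by (simp add: expand_mult[OF S(1)])
qed

lemma homog_psym: "homog T n (psym n :: 'f::field ncsym)"
proof (induction n rule: less_induct)
  case (less n)
  have "homog T n (psym i * hsym (n - i) :: 'f ncsym)" if "i \<in> {1..<n}" for i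
    using homog_mult[OF less.IH homog_hsym, of i "n - i"] that by simp
  then show ?case
    unfolding psym.simps[of n] by (intro homog_diff homog_scl homog_hsym homog_sum)
qed

lemma homog_cmt: "homog T m x \<Longrightarrow> homog T n y \<Longrightarrow> homog T (m + n) (cmt x y)"
  using homog_mult[of T m x n y] homog_mult[of T n y m x] by (simp add: add.commute homog_diff)


section \<open>Primitive elements\<close>

text \<open>
  The coproduct, seen on labels: every block is divided into its parts inside and outside of \<open>B\<close>.
\<close>

definition cut_at :: "'a set \<Rightarrow> ('a set word \<Rightarrow>\<^sub>0 'f) \<Rightarrow> 'a set word \<times> 'a set word \<Rightarrow>\<^sub>0 'f::field" where
  "cut_at B = lin (\<lambda>w. basis (Word (wedge [B] (letters w)), Word (wedge [- B] (letters w))))"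

lemma linop_cut_at [simp]: "linop (cut_at B)"
  by (simp add: cut_at_def)

lemmas cut_at_linear = linop_zero[OF linop_cut_at] linop_add[OF linop_cut_at] linop_diff[OF linop_cut_at]
  linop_scl[OF linop_cut_at] linop_sum[OF linop_cut_at]

lemma cut_mult: "cut_at B (x * y) = cut_at B x * cut_at B y"
  unfolding cut_at_def
  by (rule lin_mult) (simp add: wedge_Cons wedge_Nil mult_single plus_prod_def flip: Word_append)

lemma cut_one: "cut_at B 1 = 1"
  unfolding single_one[symmetric] cut_at_def lin_basis
  by (simp add: wedge_Cons wedge_Nil Word_Nil zero_prod_def)

lemma cut_letter:
  fixes S B :: "'a set"
  assumes "S \<noteq> {}"
  shows "cut_at B (letter S) = (tens (block (S \<inter> B)) (block (S - B)) :: _ \<Rightarrow>\<^sub>0 'f::field)"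
proof -
  have block: "(block A :: _ \<Rightarrow>\<^sub>0 'f) = basis (Word (filter (\<lambda>C. C \<noteq> {}) [A]))" for A :: "'a set"
    by (simp add: block_def letter_def Word_Nil)
  show ?thesis
    unfolding block tens_basis
    by (simp add: cut_at_def letter_def wedge_Cons wedge_Nil Int_commute Diff_eq)
qed

lemma cut_block: "cut_at B (block S) = tens (block (S \<inter> B)) (block (S - B))"
proof (cases "S = {}")
  case True
  then show ?thesis by (simp add: block_def cut_one tens_one)
next
  case False
  then have "cut_at B (block S) = cut_at B (letter S)" by (simp add: block_def)
  then show ?thesis using False by (simp add: cut_letter)
qed

lemma cut_expand:
  assumes "finite A"
  shows "A \<subseteq> B \<Longrightarrow> cut_at B (expand A x) = tens (expand A x) 1"
    and "A \<inter> B = {} \<Longrightarrow> cut_at B (expand A x) = tens 1 (expand A x)"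
proof -
  have tl: "linop (\<lambda>x. tens (expand A x) (1 :: 'a set word \<Rightarrow>\<^sub>0 'b))" "linop (\<lambda>x. tens (1 :: 'a set word \<Rightarrow>\<^sub>0 'b) (expand A x))" for A :: "'a set"
    by (rule linop_tens, rule linop_expand)+
  have prod: "tens (x * y) (1 :: 'a set word \<Rightarrow>\<^sub>0 'b) = tens x 1 * tens y 1" "tens (1 :: 'a set word \<Rightarrow>\<^sub>0 'b) (x * y) = tens 1 x * tens 1 y"
    for x y :: "'a set word \<Rightarrow>\<^sub>0 'b"
    by (simp_all add: tens_mult)
  have lsum: "tens (sum f I) (1 :: 'a set word \<Rightarrow>\<^sub>0 'b) = (\<Sum>i\<in>I. tens (f i) 1)" "tens (1 :: 'a set word \<Rightarrow>\<^sub>0 'b) (sum f I) = (\<Sum>i\<in>I. tens 1 (f i))"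
    for f :: "'c \<Rightarrow> 'a set word \<Rightarrow>\<^sub>0 'b" and I
    using linop_sum[OF linop_tens(1)[OF linop_ident], of f I "1 :: 'a set word \<Rightarrow>\<^sub>0 'b"]
      linop_sum[OF linop_tens(2)[OF linop_ident], of "1 :: 'a set word \<Rightarrow>\<^sub>0 'b" f I] by simp_all
  have letter_sub: "cut_at B (letter S) = tens (letter S) 1" if "S \<noteq> {}" "S \<subseteq> B" for S :: "'a set"
    using cut_letter[OF that(1), of B] that by (simp add: block_def Int_absorb2 Diff_eq_empty_iff[THEN iffD2])
  have letter_dis: "cut_at B (letter S) = tens 1 (letter S)" if "S \<noteq> {}" "S \<inter> B = {}" for S :: "'a set"
    using cut_letter[OF that(1), of B] that by (simp add: block_def Diff_triv)
  have sub: "A \<subseteq> B \<Longrightarrow> cut_at B (expand_word A w) = tens (expand_word A w :: 'a set word \<Rightarrow>\<^sub>0 'b) 1" for w A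
  proof (induction w arbitrary: A)
    case (Cons c w)
    have "cut_at B (letter S * expand_word (A - S) w) = tens (letter S * (expand_word (A - S) w :: 'a set word \<Rightarrow>\<^sub>0 'b)) 1"
      if "S \<subseteq> A" "card S = Suc c" for S
    proof -
      have "S \<noteq> {}" "S \<subseteq> B" "A - S \<subseteq> B" using that Cons.prems by auto
      then show ?thesis by (simp add: cut_mult letter_sub Cons.IH prod)
    qed
    then show ?case by (simp add: cut_at_linear lsum)
  qed (simp add: cut_one cut_at_linear tens_one)
  have dis: "A \<inter> B = {} \<Longrightarrow> cut_at B (expand_word A w) = tens 1 (expand_word A w :: 'a set word \<Rightarrow>\<^sub>0 'b)" for w A
  proof (induction w arbitrary: A)
    case (Cons c w)
    have "cut_at B (letter S * expand_word (A - S) w) = tens 1 (letter S * (expand_word (A - S) w :: 'a set word \<Rightarrow>\<^sub>0 'b))"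
      if "S \<subseteq> A" "card S = Suc c" for S
    proof -
      have "S \<noteq> {}" "S \<inter> B = {}" "(A - S) \<inter> B = {}" using that Cons.prems by auto
      then show ?thesis by (simp add: cut_mult letter_dis Cons.IH prod)
    qed
    then show ?case by (simp add: cut_at_linear lsum)
  qed (simp add: cut_one cut_at_linear tens_one)
  show "A \<subseteq> B \<Longrightarrow> cut_at B (expand A x) = tens (expand A x) 1"
    by (rule linop_ext[OF linop_comp[OF linop_cut_at linop_expand] tl(1)]) (simp add: expand_def sub)
  show "A \<inter> B = {} \<Longrightarrow> cut_at B (expand A x) = tens 1 (expand A x)"
    by (rule linop_ext[OF linop_comp[OF linop_cut_at linop_expand] tl(2)]) (simp add: expand_def dis)
qed

definition primitive :: "'a itself \<Rightarrow> 'f::field ncsym \<Rightarrow> bool" where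
  "primitive _ x \<longleftrightarrow>
    (\<forall>S B :: 'a set. finite S \<longrightarrow> S \<inter> B \<noteq> {} \<longrightarrow> S - B \<noteq> {} \<longrightarrow> cut_at B (expand S x) = 0)"

lemma primitiveD:
  "primitive TYPE('a) x \<Longrightarrow> finite (S :: 'a set) \<Longrightarrow> S \<inter> B \<noteq> {} \<Longrightarrow> S - B \<noteq> {} \<Longrightarrow> cut_at B (expand S x) = 0"
  by (simp add: primitive_def)

text \<open>
  Cutting a sum over all ways to choose the part that is expanded. A choice inside \<open>B\<close> contributes
  to the first factor, a choice outside to the second; the choices that meet both sides are kept as
  they are.
\<close>

lemma cut_block_sum:
  fixes S B :: "'a set" and V :: "'a set \<Rightarrow> 'f::field ncsym"
  assumes S: "finite S" and zero: "expand ({} :: 'a set) (V {}) = 0"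
  defines "U \<equiv> \<lambda>S. \<Sum>A\<in>Pow S. expand A (V A) * block (S - A)"
  shows "cut_at B (U S) = tens (U (S \<inter> B)) (block (S - B)) + tens (block (S \<inter> B)) (U (S - B)) +
    (\<Sum>A | A \<subseteq> S \<and> A \<inter> B \<noteq> {} \<and> A - B \<noteq> {}.
       cut_at B (expand A (V A)) * tens (block ((S - A) \<inter> B)) (block (S - A - B)))"
proof -
  let ?t = "\<lambda>A. cut_at B (expand A (V A)) * tens (block ((S - A) \<inter> B)) (block (S - A - B))"
  let ?X = "{A. A \<subseteq> S \<and> A \<inter> B \<noteq> {} \<and> A - B \<noteq> {}}"
  have fin: "finite A" if "A \<subseteq> S" for A using that S finite_subset by blast
  have cutU: "cut_at B (U S) = (\<Sum>A\<in>Pow S. ?t A)"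
    by (simp add: U_def cut_at_linear cut_mult cut_block)
  have t0: "?t {} = 0" by (simp only: zero cut_at_linear mult_zero_left)
  have lsum: "tens (sum f I) y = (\<Sum>i\<in>I. tens (f i) y)" "tens y (sum f I) = (\<Sum>i\<in>I. tens y (f i))"
    for f :: "'a set \<Rightarrow> 'a set word \<Rightarrow>\<^sub>0 'f" and I and y :: "'a set word \<Rightarrow>\<^sub>0 'f"
    using linop_sum[OF linop_tens(1)[OF linop_ident], of f I y]
      linop_sum[OF linop_tens(2)[OF linop_ident], of y f I] by simp_all
  have left: "(\<Sum>A\<in>Pow (S \<inter> B). ?t A) = tens (U (S \<inter> B)) (block (S - B))"
    unfolding U_def lsum
  proof (rule sum.cong[OF refl])
    fix A assume A: "A \<in> Pow (S \<inter> B)"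
    then have "(S - A) \<inter> B = S \<inter> B - A" "S - A - B = S - B" "A \<subseteq> S" by auto
    then show "?t A = tens (expand A (V A) * block (S \<inter> B - A)) (block (S - B))"
      using A fin[of A] by (simp add: cut_expand(1) tens_mult)
  qed
  have right: "(\<Sum>A\<in>Pow (S - B). ?t A) = tens (block (S \<inter> B)) (U (S - B))"
    unfolding U_def lsum
  proof (rule sum.cong[OF refl])
    fix A assume A: "A \<in> Pow (S - B)"
    then have "(S - A) \<inter> B = S \<inter> B" "S - A - B = S - B - A" "A \<inter> B = {}" "A \<subseteq> S" by auto
    then show "?t A = tens (block (S \<inter> B)) (expand A (V A) * block (S - B - A))"
      using A fin[of A] by (simp add: cut_expand(2) tens_mult)
  qed
  have "Pow S - {{}} = ((Pow (S \<inter> B) - {{}}) \<union> (Pow (S - B) - {{}})) \<union> ?X"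
    by auto
  then have "(\<Sum>A\<in>Pow S - {{}}. ?t A) = (\<Sum>A\<in>((Pow (S \<inter> B) - {{}}) \<union> (Pow (S - B) - {{}})) \<union> ?X. ?t A)"
    by simp
  also have "\<dots> = (\<Sum>A\<in>(Pow (S \<inter> B) - {{}}) \<union> (Pow (S - B) - {{}}). ?t A) + (\<Sum>A\<in>?X. ?t A)"
    by (rule sum.union_disjoint) (use S in auto)
  also have "(\<Sum>A\<in>(Pow (S \<inter> B) - {{}}) \<union> (Pow (S - B) - {{}}). ?t A)
      = (\<Sum>A\<in>Pow (S \<inter> B) - {{}}. ?t A) + (\<Sum>A\<in>Pow (S - B) - {{}}. ?t A)"
    by (rule sum.union_disjoint) (use S in auto)
  finally have sum: "(\<Sum>A\<in>Pow S - {{}}. ?t A)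
      = (\<Sum>A\<in>Pow (S \<inter> B) - {{}}. ?t A) + (\<Sum>A\<in>Pow (S - B) - {{}}. ?t A) + (\<Sum>A\<in>?X. ?t A)" .
  have remove: "(\<Sum>A\<in>Pow R - {{}}. ?t A) = (\<Sum>A\<in>Pow R. ?t A)" if "finite R" for R
  proof -
    have "(\<Sum>A\<in>Pow R. ?t A) = ?t {} + (\<Sum>A\<in>Pow R - {{}}. ?t A)"
      by (rule sum.remove) (use that in auto)
    then show ?thesis unfolding t0 by simp
  qed
  have "finite (S \<inter> B)" "finite (S - B)" using S by auto
  then show ?thesis
    using sum unfolding cutU remove[OF S] by (simp only: remove left right)
qed

text \<open>
  Newton's identity after expansion; by homogeneity only the degree \<open>|A|\<close> survives on \<open>A\<close>.
\<close>

lemma newton_block: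
  assumes S: "finite (S :: 'a set)"
  shows "(\<Sum>A\<in>Pow S. expand A (psym (card A)) * block (S - A))
       = (scl (of_nat (card S)) (block S) :: _ \<Rightarrow>\<^sub>0 'f::field)"
proof -
  let ?n = "card S"
  have "scl (of_nat ?n) (block S) = (expand S (scl (of_nat ?n) (hsym ?n)) :: _ \<Rightarrow>\<^sub>0 'f)"
    by (simp add: expand_linear expand_hsym[OF S])
  also have "\<dots> = (\<Sum>i\<in>{1..?n}. \<Sum>A\<in>Pow S. expand A (psym i) * expand (S - A) (hsym (?n - i)))"
    unfolding newton[symmetric] expand_linear by (simp only: expand_mult[OF S])
  also have "\<dots> = (\<Sum>A\<in>Pow S. \<Sum>i\<in>{1..?n}. expand A (psym i) * expand (S - A) (hsym (?n - i)))"
    by (rule sum.swap)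
  also have "\<dots> = (\<Sum>A\<in>Pow S. expand A (psym (card A)) * block (S - A))"
  proof (rule sum.cong[OF refl])
    fix A assume A: "A \<in> Pow S"
    then have fin: "finite A" "finite (S - A)" using S finite_subset by auto
    have card: "card (S - A) = ?n - card A" "card A \<le> ?n"
      using A S by (auto simp: card_Diff_subset[OF fin(1)] card_mono)
    have "(\<Sum>i\<in>{1..?n}. expand A (psym i) * expand (S - A) (hsym (?n - i)))
        = (\<Sum>i\<in>{1..?n}. if i = card A then expand A (psym i) * (block (S - A) :: _ \<Rightarrow>\<^sub>0 'f) else 0)"
      by (intro sum.cong refl)
         (auto simp: expand_hsym[OF fin(2)] card(1) homogD[OF homog_psym fin(1)])
    also have "\<dots> = expand A (psym (card A)) * block (S - A)"
      using card(2) by (cases "card A = 0") (auto simp: expand_linear)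
    finally show "(\<Sum>i\<in>{1..?n}. expand A (psym i) * expand (S - A) (hsym (?n - i)))
      = expand A (psym (card A)) * (block (S - A) :: _ \<Rightarrow>\<^sub>0 'f)" .
  qed
  finally show ?thesis ..
qed

text \<open>
  Cut the expanded Newton identity. By induction, the only mixed term that can survive is the one of
  the full set, and the other terms cancel because \<open>|S| = |S \<inter> B| + |S - B|\<close>.
\<close>

lemma primitive_psym: "primitive TYPE('a) (psym n :: 'f::field ncsym)"
proof (induction n rule: less_induct)
  case (less n)
  show ?case
    unfolding primitive_def
  proof (intro allI impI)
    fix S B :: "'a set" assume S: "finite S" and mixed: "S \<inter> B \<noteq> {}" "S - B \<noteq> {}"
    show "cut_at B (expand S (psym n :: 'f ncsym)) = 0"
    proof (cases "card S = n")
      case False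
      then show ?thesis by (simp add: homogD[OF homog_psym S] cut_at_linear)
    next
      case n: True
      let ?V = "\<lambda>A :: 'a set. psym (card A) :: 'f ncsym"
      let ?X = "{A. A \<subseteq> S \<and> A \<inter> B \<noteq> {} \<and> A - B \<noteq> {}}"
      let ?t = "\<lambda>A. cut_at B (expand A (?V A)) * tens (block ((S - A) \<inter> B)) (block (S - A - B))"
      have fin: "finite (S \<inter> B)" "finite (S - B)" using S by auto
      have "card S = card (S \<inter> B) + card (S - B)"
        using S by (simp add: card_Int_Diff)
      then have eq: "cut_at B (scl (of_nat (card S)) (block S))
          = tens (scl (of_nat (card (S \<inter> B))) (block (S \<inter> B))) (block (S - B))
          + tens (block (S \<inter> B)) (scl (of_nat (card (S - B))) (block (S - B)) :: _ \<Rightarrow>\<^sub>0 'f)"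
        by (simp add: cut_at_linear cut_block tens_linear scl_add_left)
      have zero: "expand ({} :: 'a set) (?V {}) = 0" by (simp add: expand_linear)
      note sum = cut_block_sum[of S ?V B, OF S zero,
          unfolded newton_block[OF S] newton_block[OF fin(1)] newton_block[OF fin(2)]]
      have "(\<Sum>A\<in>?X. ?t A) = 0"
        using sum unfolding eq by simp
      also have "(\<Sum>A\<in>?X. ?t A) = ?t S + (\<Sum>A\<in>?X - {S}. ?t A)"
        using S mixed by (intro sum.remove) auto
      also have "(\<Sum>A\<in>?X - {S}. ?t A) = 0"
      proof (rule sum.neutral, rule ballI)
        fix A assume A: "A \<in> ?X - {S}"
        then have "card A < n"
          using n psubset_card_mono[OF S, of A] by auto
        then have "cut_at B (expand A (?V A)) = 0"
          using less.IH[of "card A"] A finite_subset[OF _ S] by (intro primitiveD) auto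
        then show "?t A = 0" by simp
      qed
      finally show ?thesis using n by (simp add: block_def tens_one)
    qed
  qed
qed

text \<open>
  The right-hand side is symmetric in \<open>x\<close> and \<open>y\<close>, so it cancels for the commutator.
\<close>

lemma cut_expand_mult:
  assumes x: "primitive TYPE('a) x" "homog TYPE('a) m x" "0 < m"
    and y: "primitive TYPE('a) y" "homog TYPE('a) n y" "0 < n"
    and S: "finite (S :: 'a set)" "S \<inter> B \<noteq> {}" "S - B \<noteq> {}"
  shows "cut_at B (expand S (x * y)) =
    tens (expand (S \<inter> B) x) (expand (S - B) y) + tens (expand (S \<inter> B) y) (expand (S - B) x)"
proof -
  let ?t = "\<lambda>A. cut_at B (expand A x) * cut_at B (expand (S - A) y)"
  have fin: "finite (S \<inter> B)" "finite (S - B)" using S by auto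
  have "cut_at B (expand S (x * y)) = (\<Sum>A\<in>Pow S. ?t A)"
    by (simp add: expand_mult[OF S(1)] cut_at_linear cut_mult)
  also have "\<dots> = (\<Sum>A\<in>{S \<inter> B, S - B}. ?t A)"
  proof (rule sum.mono_neutral_right)
    show "\<forall>A\<in>Pow S - {S \<inter> B, S - B}. ?t A = 0"
    proof
      fix A assume A: "A \<in> Pow S - {S \<inter> B, S - B}"
      have finA: "finite A" "finite (S - A)" using A S finite_subset by auto
      have zero: "cut_at B (expand ({} :: 'a set) x) = 0" "cut_at B (expand ({} :: 'a set) y) = 0"
        using homogD[OF x(2), of "{}"] homogD[OF y(2), of "{}"] x(3) y(3)
        by (auto simp: cut_at_linear)
      show "?t A = 0"
      proof (rule ccontr)
        assume nz: "?t A \<noteq> 0"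
        then have "A \<noteq> {}" "S - A \<noteq> {}"
          using zero by (metis mult_zero_left, metis mult_zero_right)
        moreover have "A \<inter> B = {} \<or> A - B = {}"
          using nz primitiveD[OF x(1) finA(1), of B] by (metis mult_zero_left)
        moreover have "(S - A) \<inter> B = {} \<or> S - A - B = {}"
          using nz primitiveD[OF y(1) finA(2), of B] by (metis mult_zero_right)
        ultimately show False using A S(2,3) by blast
      qed
    qed
  qed (use S in auto)
  also have "\<dots> = ?t (S \<inter> B) + ?t (S - B)"
    using S by (subst sum.insert) auto
  also have "?t (S \<inter> B) = tens (expand (S \<inter> B) x) (expand (S - B) y)"
  proof -
    have "S - S \<inter> B = S - B" by auto
    then show ?thesis
      using cut_expand(1)[OF fin(1), of B x] cut_expand(2)[OF fin(2), of B y]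
      by (simp add: tens_mult Diff_disjoint Int_commute)
  qed
  also have "?t (S - B) = tens (expand (S \<inter> B) y) (expand (S - B) x)"
  proof -
    have "S - (S - B) = S \<inter> B" by auto
    then show ?thesis
      using cut_expand(1)[OF fin(1), of B y] cut_expand(2)[OF fin(2), of B x]
      by (simp add: tens_mult Diff_disjoint Int_commute)
  qed
  finally show ?thesis .
qed

lemma primitive_cmt:
  assumes "primitive TYPE('a) x" "homog TYPE('a) m x" "0 < m"
    and "primitive TYPE('a) y" "homog TYPE('a) n y" "0 < n"
  shows "primitive TYPE('a) (cmt x y)"
  unfolding primitive_def
  using cut_expand_mult[OF assms] cut_expand_mult[OF assms(4-6) assms(1-3)]
  by (simp add: expand_linear cut_at_linear)


section \<open>Insertion of a primitive element is a right multiplication\<close>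

definition ordered_partitions :: "'a set \<Rightarrow> 'a set list set" where
  "ordered_partitions S = {P. {} \<notin> set P \<and> sorted_wrt disjnt P \<and> \<Union>(set P) = S}"

lemma ordered_partitions_Cons:
  "A # P \<in> ordered_partitions S \<longleftrightarrow> A \<noteq> {} \<and> A \<subseteq> S \<and> P \<in> ordered_partitions (S - A)"
  by (auto simp: ordered_partitions_def disjnt_def)

lemma ordered_partitions_Nil: "[] \<in> ordered_partitions S \<longleftrightarrow> S = {}"
  by (auto simp: ordered_partitions_def)

text \<open>
  Multiplication by the first block sees the part inside this block, multiplication by the remaining
  blocks sees the part outside.
\<close>

lemma wedge_lin_Cons:
  assumes "\<And>C. C \<in> set P \<Longrightarrow> A \<inter> C = {}"
  shows "wedge_lin (A # P) x = lin (\<lambda>vw. basis (fst vw) * wedge_lin P (basis (snd vw))) (cut_at A x)"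
proof -
  have "wedge P (filter (\<lambda>C. C \<noteq> {}) (map ((\<inter>) (- A)) Q)) = wedge P Q" for Q
    using assms
  proof (induction P)
    case (Cons C P)
    have "filter (\<lambda>C. C \<noteq> {}) (map ((\<inter>) C) (filter (\<lambda>C. C \<noteq> {}) (map ((\<inter>) (- A)) Q)))
        = filter (\<lambda>C. C \<noteq> {}) (map ((\<inter>) C) Q)"
    proof (induction Q)
      case (Cons D Q)
      have "C \<inter> (- A \<inter> D) = C \<inter> D" using \<open>\<And>E. E \<in> set (C # P) \<Longrightarrow> A \<inter> E = {}\<close>[of C] by auto
      then show ?case using Cons by auto
    qed simp
    then show ?case using Cons by (simp add: wedge_Cons)
  qed (simp add: wedge_Nil)
  note absorb = this
  show ?thesis
    by (rule linop_ext[OF linop_wedge_lin linop_comp[OF linop_lin linop_cut_at]])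
       (simp add: absorb cut_at_def wedge_Cons wedge_Nil mult_single flip: Word_append)
qed

lemma wedge_lin_block:
  assumes "P \<in> ordered_partitions S"
  shows "wedge_lin P (block S) = basis (Word P)"
proof (cases "S = {}")
  case True
  then have "P = []" using assms by (cases P) (auto simp: ordered_partitions_def)
  then show ?thesis
    using True wedge_lin_basis[of "[]" 0] by (simp add: block_def wedge_Nil Word_Nil)
next
  case False
  have "\<forall>A\<in>set P. A \<noteq> {} \<and> A \<subseteq> S" using assms by (auto simp: ordered_partitions_def)
  then have "wedge P [S] = P"
    by (induction P) (auto simp: wedge_Cons wedge_Nil Int_absorb2)
  then show ?thesis using False by (simp add: block_def letter_def)
qed

text \<open>
  The derivation of the free algebra on sets that replaces a letter \<open>A\<close> by \<open>U A\<close>, on a word.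
\<close>

fun derive_word :: "('a set \<Rightarrow> 'a set word \<Rightarrow>\<^sub>0 'f) \<Rightarrow> 'a set list \<Rightarrow> 'a set word \<Rightarrow>\<^sub>0 'f::field" where
  "derive_word U [] = 0"
| "derive_word U (A # P) = U A * basis (Word P) + letter A * derive_word U P"

text \<open>
  The hypothesis says that \<open>U\<close> behaves like an infinitesimal deformation of the one-block
  composition, on which left multiplication by \<open>P\<close> returns \<open>P\<close>. Peeling off one block of \<open>P\<close>
  after the other gives the derivation.
\<close>

lemma wedge_lin_derive:
  assumes cut: "\<And>S B. finite S \<Longrightarrow>
      cut_at B (U S) = tens (U (S \<inter> B)) (block (S - B)) + tens (block (S \<inter> B)) (U (S - B))"
    and empty: "U {} = 0"
  shows "finite S \<Longrightarrow> P \<in> ordered_partitions S \<Longrightarrow> wedge_lin P (U S) = derive_word U P"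
proof (induction P arbitrary: S)
  case Nil
  then show ?case by (simp add: ordered_partitions_Nil empty linop_zero[OF linop_wedge_lin])
next
  case (Cons A P)
  from Cons.prems have A: "A \<noteq> {}" "A \<subseteq> S" and P: "P \<in> ordered_partitions (S - A)"
    by (simp_all add: ordered_partitions_Cons)
  have "A \<inter> C = {}" if "C \<in> set P" for C
    using that P by (auto simp: ordered_partitions_def)
  then have "wedge_lin (A # P) (U S)
      = lin (\<lambda>vw. basis (fst vw) * wedge_lin P (basis (snd vw))) (cut_at A (U S))"
    by (rule wedge_lin_Cons)
  also have "\<dots> = lin basis (U (S \<inter> A)) * lin (\<lambda>w. wedge_lin P (basis w)) (block (S - A))
      + lin basis (block (S \<inter> A)) * lin (\<lambda>w. wedge_lin P (basis w)) (U (S - A))"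
    unfolding cut[OF Cons.prems(1)] lin_add 
    by (simp only: lin_tens[where \<phi> = basis and \<psi> = "\<lambda>w. wedge_lin P (basis w)"])
  also have "\<dots> = U (S \<inter> A) * basis (Word P) + block (S \<inter> A) * derive_word U P"
  proof -
    have "lin basis x = x" for x :: "'a set word \<Rightarrow>\<^sub>0 'b"
      by (rule linop_ext[OF linop_lin linop_ident]) simp
    moreover have "lin (\<lambda>w. wedge_lin P (basis w)) x = wedge_lin P x" for x :: "'a set word \<Rightarrow>\<^sub>0 'b"
      by (rule linop_ext[OF linop_lin linop_wedge_lin]) simp
    moreover have "wedge_lin P (U (S - A)) = derive_word U P"
      using Cons.prems(1) P by (intro Cons.IH) auto
    ultimately show ?thesis by (simp only: wedge_lin_block[OF P])
  qed
  finally show ?case using A by (simp add: Int_absorb1 block_def)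
qed

lemma expand_insert_bracket:
  fixes u :: "'f::field ncsym" and S :: "'a set"
  assumes u: "homog TYPE('a) d u" and d: "0 < d"
  defines "U \<equiv> \<lambda>S :: 'a set. expand S (insert_bracket u d (hsym (card S)))"
  assumes S: "finite S"
  shows "expand S (insert_bracket u d x) = lin (\<lambda>w. derive_word U (letters w)) (expand S x)"
proof -
  let ?D = "lin (\<lambda>w. derive_word U (letters w))"
  have D_letter: "?D (letter A * x) = U A * x + letter A * ?D x" for A x
  proof (rule linop_ext[of "\<lambda>x. ?D (letter A * x)" "\<lambda>x. U A * x + letter A * ?D x"])
    fix w
    show "?D (letter A * basis w) = U A * basis w + letter A * ?D (basis w)"
    proof -
      have eq: "letter A * basis w = (basis (Word (A # letters w)) :: _ \<Rightarrow>\<^sub>0 'f)"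
        by (simp add: basis_Cons)
      show ?thesis unfolding eq by simp
    qed
  qed (simp_all add: linop_def lin_add lin_scl distrib_left scl_mult_right scl_add ac_simps)
  have homog: "homog TYPE('a) n (insert_bracket u d (hsym n))" for n
    using homog_mult[OF u homog_hsym, of "n - d"] by (auto simp: insert_bracket_hsym[OF d] homog_def expand_linear)
  have img: "insert_bracket u d (hsym (Suc c)) = (if d \<le> Suc c then u * hsym (Suc c - d) else 0)" for c
    by (rule insert_bracket_hsym[OF d])
  have word: "expand S (insert_word u d w) = ?D (expand_word S w)" if "finite S" for w and S :: "'a set"
    using that
  proof (induction w arbitrary: S)
    case Nil
    have "?D 1 = 0"
      unfolding single_one[symmetric] lin_basis by simp
    then show ?case by (simp add: expand_linear lin_zero)
  next
    case (Cons c w)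
    have fin: "finite A" "finite (S - A)" if "A \<in> Pow S" for A
      using that Cons.prems finite_subset by auto
    have "expand S (insert_word u d (c # w))
        = (\<Sum>A\<in>Pow S. expand A (insert_bracket u d (hsym (Suc c))) * expand (S - A) (basis (Word w)))
        + (\<Sum>A\<in>Pow S. expand A (letter c) * expand (S - A) (insert_word u d w))"
      unfolding insert_word.simps img[symmetric] expand_linear by (simp only: expand_mult[OF Cons.prems])
    also have "\<dots> = (\<Sum>A\<in>Pow S. if card A = Suc c then ?D (letter A * expand_word (S - A) w) else 0)"
      unfolding sum.distrib[symmetric]
    proof (rule sum.cong[OF refl])
      fix A assume A: "A \<in> Pow S"
      show "expand A (insert_bracket u d (hsym (Suc c))) * expand (S - A) (basis (Word w))
          + expand A (letter c) * expand (S - A) (insert_word u d w)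
          = (if card A = Suc c then ?D (letter A * expand_word (S - A) w) else 0)"
      proof (cases "card A = Suc c")
        case True
        then have "expand A (insert_bracket u d (hsym (Suc c))) = U A"
          unfolding U_def by (simp only: True)
        then show ?thesis
          using True by (simp add: D_letter expand_basis Cons.IH[OF fin(2)[OF A]] expand_letter[OF fin(1)[OF A]]
                del: hsym_simps)
      next
        case False
        then show ?thesis
          by (simp add: homogD[OF homog fin(1)[OF A]] expand_letter[OF fin(1)[OF A]] del: hsym_simps)
      qed
    qed
    also have "\<dots> = (\<Sum>A | A \<in> Pow S \<and> card A = Suc c. ?D (letter A * expand_word (S - A) w))"
      using Cons.prems by (intro sum.inter_filter[symmetric]) simp
    also have "\<dots> = ?D (expand_word S (c # w))"
      by (simp add: lin_sum)
    finally show ?case .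
  qed
  show ?thesis
    by (rule linop_ext[OF linop_comp[OF linop_expand] linop_comp[OF linop_lin linop_expand]])
       (simp_all add: insert_bracket_def expand_def word[unfolded expand_def, OF S])
qed

lemma cut_insert_bracket:
  fixes u :: "'f::field ncsym" and S B :: "'a set"
  assumes u: "homog TYPE('a) d u" "primitive TYPE('a) u" and d: "0 < d"
  defines "U \<equiv> \<lambda>S :: 'a set. expand S (insert_bracket u d (hsym (card S)))"
  assumes S: "finite S"
  shows "cut_at B (U S) = tens (U (S \<inter> B)) (block (S - B)) + tens (block (S \<inter> B)) (U (S - B))"
proof -
  have zero: "expand ({} :: 'a set) u = 0"
    using homogD[OF u(1), of "{}"] d by simp
  have U: "U S = (\<Sum>A\<in>Pow S. expand A u * block (S - A))" if S: "finite S" for S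
  proof (cases "d \<le> card S")
    case True
    have "U S = (\<Sum>A\<in>Pow S. expand A u * expand (S - A) (hsym (card S - d)))"
      using True by (simp add: U_def insert_bracket_hsym[OF d] expand_mult[OF S])
    also have "\<dots> = (\<Sum>A\<in>Pow S. expand A u * block (S - A))"
    proof (rule sum.cong[OF refl])
      fix A assume A: "A \<in> Pow S"
      then have fin: "finite A" "finite (S - A)" using S finite_subset by auto
      show "expand A u * expand (S - A) (hsym (card S - d)) = expand A u * block (S - A)"
      proof (cases "card A = d")
        case True
        then have "card (S - A) = card S - d" using A fin by (simp add: card_Diff_subset)
        then show ?thesis by (simp add: expand_hsym[OF fin(2)])
      qed (simp add: homogD[OF u(1) fin(1)])
    qed
    finally show ?thesis .
  next
    case False
    have "expand A u = 0" if "A \<in> Pow S" for A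
      using that False card_mono[OF S, of A] S finite_subset[of A S] by (intro homogD[OF u(1)]) auto
    then show ?thesis using False by (simp add: U_def insert_bracket_hsym[OF d] expand_linear)
  qed
  have "finite (S \<inter> B)" "finite (S - B)" using S by auto
  moreover have "cut_at B (expand A u) = 0" if "A \<subseteq> S" "A \<inter> B \<noteq> {}" "A - B \<noteq> {}" for A
    using that finite_subset[OF _ S] by (intro primitiveD[OF u(2)]) auto
  ultimately show ?thesis
    using cut_block_sum[OF S, of "\<lambda>_. u" B] zero by (simp add: U S)
qed

section \<open>Expansions and shapes\<close>

definition shape :: "'a set list \<Rightarrow> nat list" where
  "shape P = map (\<lambda>A. card A - 1) P"

lemma lookup_letter_mult:
  fixes x :: "'a set word \<Rightarrow>\<^sub>0 'f::field"
  shows "lookup (letter A * x) (Word P) = (case P of [] \<Rightarrow> 0 | B # Q \<Rightarrow> if A = B then lookup x (Word Q) else 0)"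
proof (induction x rule: poly_mapping_linear_induct)
  case (basis w)
  have "letter A * basis w = (basis (Word (A # letters w)) :: _ \<Rightarrow>\<^sub>0 'f)"
    by (simp add: basis_Cons)
  then show ?case
    by (cases w) (auto simp: lookup_single when_def split: list.split)
qed (auto simp: distrib_left lookup_add scl_mult_right split: list.split)

lemma lookup_expand_word:
  "finite S \<Longrightarrow> lookup (expand_word S w) (Word P)
    = (if P \<in> ordered_partitions S \<and> shape P = w then 1 else 0 :: 'f::field)"
proof (induction w arbitrary: S P)
  case Nil
  then show ?case
    by (cases P) (auto simp: lookup_one when_def shape_def ordered_partitions_Nil zero_word_def)
next
  case (Cons c w)
  let ?\<A> = "{A. A \<subseteq> S \<and> card A = Suc c}"
  have fin: "finite ?\<A>" using Cons.prems by simp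
  have "lookup (expand_word S (c # w)) (Word P)
      = (\<Sum>A\<in>?\<A>. lookup (letter A * expand_word (S - A) w) (Word P) :: 'f)"
    by (simp add: lookup_sum)
  also have "\<dots> = (if P \<in> ordered_partitions S \<and> shape P = c # w then 1 else 0)"
  proof (cases P)
    case Nil
    then show ?thesis by (simp add: lookup_letter_mult shape_def)
  next
    case P: (Cons B Q)
    have "(\<Sum>A\<in>?\<A>. lookup (letter A * expand_word (S - A) w) (Word P) :: 'f)
        = (\<Sum>A\<in>?\<A>. if A = B then lookup (expand_word (S - B) w) (Word Q) else 0)"
      by (intro sum.cong refl) (simp add: P lookup_letter_mult)
    also have "\<dots> = (if B \<subseteq> S \<and> card B = Suc c then lookup (expand_word (S - B) w) (Word Q) else 0)"
      using fin by simp
    also have "lookup (expand_word (S - B) w) (Word Q)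
        = (if Q \<in> ordered_partitions (S - B) \<and> shape Q = w then 1 else 0 :: 'f)"
      by (rule Cons.IH) (use Cons.prems in simp)
    also have "(if B \<subseteq> S \<and> card B = Suc c then
          (if Q \<in> ordered_partitions (S - B) \<and> shape Q = w then 1 else 0 :: 'f) else 0)
        = (if P \<in> ordered_partitions S \<and> shape P = c # w then 1 else 0)"
    proof (cases "B \<subseteq> S")
      case True
      then have "finite B" using Cons.prems finite_subset by blast
      then have "B \<noteq> {} \<and> card B - 1 = c \<longleftrightarrow> card B = Suc c"
        by (cases "card B") auto
      then show ?thesis
        using True by (auto simp: P ordered_partitions_Cons shape_def)
    qed (simp add: P ordered_partitions_Cons)
    finally show ?thesis .
  qed
  finally show ?case .
qed

lemma lookup_expand:
  assumes "finite S"
  shows "lookup (expand S z) (Word P) = (if P \<in> ordered_partitions S then lookup z (Word (shape P)) else 0)"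
proof (induction z rule: poly_mapping_linear_induct)
  case (basis w)
  then show ?case
    using lookup_expand_word[OF assms, of "letters w" P]
    by (cases w) (auto simp: expand_def lookup_single when_def)
qed (auto simp: expand_linear lookup_add)

lemma length_ordered_partition:
  "finite S \<Longrightarrow> P \<in> ordered_partitions S \<Longrightarrow> length P \<le> card S"
proof (induction P arbitrary: S)
  case (Cons A P)
  then have "A \<noteq> {}" "A \<subseteq> S" "P \<in> ordered_partitions (S - A)"
    by (simp_all add: ordered_partitions_Cons)
  moreover have "card (S - A) < card S"
    using calculation Cons.prems(1) by (intro psubset_card_mono) auto
  ultimately show ?case
    using Cons.IH[of "S - A"] Cons.prems(1) by simp
qed simp

text \<open>
  The expansion over a fixed set is not multiplicative, but \<open>expand_mult\<close> turns the expansion of a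
  commutator into a sum of commutators, one for each way to split the set.
\<close>

lemma cfilt_expand:
  "cfilt k z \<Longrightarrow> finite S \<Longrightarrow> cfilt k (expand S z)"
proof (induction arbitrary: S rule: cfilt.induct)
  case (mult s x t y)
  have "cfilt (s + t) (expand A x * expand (S - A) y)" if "A \<in> Pow S" for A
    using that mult.prems finite_subset by (intro cfilt.mult mult.IH) auto
  then show ?case by (simp only: expand_mult[OF mult.prems] cfilt_sum)
next
  case (comm s x t y)
  have "(\<Sum>A\<in>Pow S. expand A y * expand (S - A) x) = (\<Sum>A\<in>Pow S. expand (S - A) y * expand A x)"
    by (rule sum.reindex_bij_witness[where i = "\<lambda>A. S - A" and j = "\<lambda>A. S - A"])
       (auto simp: double_diff)
  then have "expand S (cmt x y) = (\<Sum>A\<in>Pow S. cmt (expand A x) (expand (S - A) y))"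
    by (simp add: expand_linear expand_mult[OF comm.prems] sum_subtractf)
  moreover have "cfilt (Suc (s + t)) (cmt (expand A x) (expand (S - A) y))" if "A \<in> Pow S" for A
    using that comm.prems finite_subset by (intro cfilt.comm comm.IH) auto
  ultimately show ?case by (simp only: cfilt_sum)
next
  case (weaken k x)
  then show ?case using cfilt.weaken by blast
qed (simp_all only: expand_linear cfilt.any cfilt.zero cfilt.add)

text \<open>
  The weight of a letter is chosen to make \<open>forget\<close> inverse to \<open>expand\<close> up to a constant: the number
  of ordered partitions with given block sizes is a multinomial coefficient.
\<close>

definition forget :: "('a set word \<Rightarrow>\<^sub>0 'f) \<Rightarrow> 'f::field_char_0 ncsym" where
  "forget = lift (\<lambda>A. scl (fact (card A)) (hsym (card A)))"

lemma forget_expand_word: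
  "finite S \<Longrightarrow> forget (expand_word S w) =
    (if sum_list (map Suc w) = card S then scl (fact (card S)) (basis (Word w)) else 0 :: 'f::field_char_0 ncsym)"
proof (induction w arbitrary: S)
  case Nil
  then show ?case
    by (auto simp: forget_def linop_zero[OF linop_lift] Word_Nil)
next
  case (Cons c w)
  let ?\<A> = "{A. A \<subseteq> S \<and> card A = Suc c}"
  let ?x = "basis (Word (c # w)) :: 'f ncsym"
  have "forget (expand_word S (c # w)) = (\<Sum>A\<in>?\<A>. forget (letter A) * (forget (expand_word (S - A) w) :: 'f ncsym))"
    by (simp add: forget_def linop_sum[OF linop_lift] lift_mult)
  also have "\<dots> = (\<Sum>A\<in>?\<A>. if sum_list (map Suc (c # w)) = card S
      then scl (fact (Suc c) * fact (card S - Suc c)) ?x else 0)"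
  proof (rule sum.cong[OF refl])
    fix A assume A: "A \<in> ?\<A>"
    then have card: "card (S - A) = card S - Suc c" "Suc c \<le> card S"
      using Cons.prems finite_subset[of A S] card_mono[of S A] by (auto simp: card_Diff_subset)
    have "finite (S - A)" using Cons.prems by simp
    from Cons.IH[OF this] show "forget (letter A) * (forget (expand_word (S - A) w) :: 'f ncsym)
      = (if sum_list (map Suc (c # w)) = card S then scl (fact (Suc c) * fact (card S - Suc c)) ?x else 0)"
      using A card by (auto simp: forget_def basis_Cons scl_mult_left scl_mult_right)
  qed
  also have "\<dots> = (if sum_list (map Suc (c # w)) = card S then scl (fact (card S)) ?x else 0)"
  proof (cases "sum_list (map Suc (c # w)) = card S")
    case True
    then have "Suc c \<le> card S" by simp
    have "(fact (Suc c) * fact (card S - Suc c) * of_nat (card S choose Suc c) :: 'f) = fact (card S)"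
      using \<open>Suc c \<le> card S\<close> by (metis binomial_fact_lemma of_nat_fact of_nat_mult)
    moreover have "card ?\<A> = card S choose Suc c"
      using n_subsets[OF Cons.prems, of "Suc c"] by simp
    ultimately show ?thesis
      using True by (simp add: scl_of_nat[symmetric] mult.commute del: fact_Suc)
  qed simp
  finally show ?case .
qed

lemma expand_forget:
  fixes z :: "'f::field_char_0 ncsym"
  assumes "finite S"
  shows "expand S (forget (expand S z)) = scl (fact (card S)) (expand S z)"
proof (rule linop_ext[where x = z and F = "\<lambda>z :: 'f ncsym. expand S (forget (expand S z))"
      and G = "\<lambda>z :: 'f ncsym. scl (fact (card S)) (expand S z)"])
  show "linop (\<lambda>z :: 'f ncsym. expand S (forget (expand S z)))"
    unfolding forget_def by (rule linop_comp[OF linop_expand linop_comp[OF linop_lift linop_expand]])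
  show "linop (\<lambda>z :: 'f ncsym. scl (fact (card S)) (expand S z))"
    by (rule linop_scl_fun[OF linop_expand])
  fix w :: "nat word"
  have zero: "expand_word S v = (0 :: _ \<Rightarrow>\<^sub>0 'f)" if "sum_list (map Suc v) \<noteq> card S" for v
    using that assms
  proof (induction v arbitrary: S)
    case (Cons c v)
    have "expand_word (S - A) v = (0 :: _ \<Rightarrow>\<^sub>0 'f)" if "A \<subseteq> S" "card A = Suc c" for A
      using Cons.prems that finite_subset[of A S] card_mono[of S A]
      by (intro Cons.IH) (auto simp: card_Diff_subset)
    then show ?case by simp
  qed auto
  show "expand S (forget (expand S (basis w :: 'f ncsym))) = scl (fact (card S)) (expand S (basis w))"
    by (cases w) (auto simp: expand_basis forget_expand_word[OF assms] zero expand_linear)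
qed

lemma cfilt_forget: "cfilt k x \<Longrightarrow> cfilt k (forget x)"
  unfolding forget_def by (rule cfilt_lift)


section \<open>Vanishing of the commutator filtration\<close>

text \<open>
  Constant terms do not contribute to commutators. Hence in positive degree the elements have no
  constant term, and every commutator adds a letter.
\<close>

lemma cfilt_long_words:
  fixes x :: "'a word \<Rightarrow>\<^sub>0 'f::field"
  assumes "cfilt k x" "0 < k" "w \<in> keys x"
  shows "k < length (letters w)"
proof -
  define long where "long k y \<longleftrightarrow> (\<forall>w\<in>keys y. k < length (letters w))" for k and y :: "'a word \<Rightarrow>\<^sub>0 'f"
  have long_add: "long k (y + z)" if "long k y" "long k z" for k y z
    using that keys_add[of y z] unfolding long_def by blast
  have long_scl: "long k (scl c y)" if "long k y" for k c y
    using that unfolding long_def by (auto simp: in_keys_iff)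
  have long_diff: "long k (y - z)" if "long k y" "long k z" for k y z
    using long_add[OF that(1) long_scl[OF that(2), of "- 1"]] by (simp add: scl_minus_one)
  have long_mult: "long (Suc (j + k)) (y * z)" if "long j y" "long k z" for j k y z
    using that keys_mult[of y z] unfolding long_def by fastforce
  have long_mono: "long j y" if "long k y" "j \<le> k" for j k y
    using that unfolding long_def by fastforce
  have long_zero: "long k 0" for k by (simp add: long_def)
  have "\<exists>c y. x = scl c 1 + y \<and> long k y \<and> (0 < k \<longrightarrow> c = 0)"
    using assms(1)
  proof (induction rule: cfilt.induct)
    case (any x)
    let ?c = "lookup x 0"
    have "long 0 (x - scl ?c 1)"
      unfolding long_def
    proof
      fix w assume "w \<in> keys (x - scl ?c 1)"
      then have "w \<noteq> 0" by (auto simp: in_keys_iff lookup_minus)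
      then show "0 < length (letters w)" by (cases w) (auto simp: zero_word_def)
    qed
    then show ?case by (intro exI[of _ ?c] exI[of _ "x - scl ?c 1"]) simp
  next
    case (zero k)
    show ?case by (intro exI[of _ 0] exI[of _ 0]) (simp add: long_zero)
  next
    case (add k x y)
    then obtain c x' d y' where "x = scl c 1 + x'" "long k x'" "0 < k \<longrightarrow> c = 0"
      "y = scl d 1 + y'" "long k y'" "0 < k \<longrightarrow> d = 0" by blast
    then show ?case
      by (intro exI[of _ "c + d"] exI[of _ "x' + y'"]) (simp add: long_add scl_add_left)
  next
    case (mult s x t y)
    then obtain c x' d y' where x: "x = scl c 1 + x'" "long s x'" "0 < s \<longrightarrow> c = 0"
      and y: "y = scl d 1 + y'" "long t y'" "0 < t \<longrightarrow> d = 0" by blast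
    have "x * y = scl (c * d) 1 + (scl c y' + scl d x' + x' * y')"
      unfolding x(1) y(1) by (simp add: distrib_left distrib_right scl_mult_left scl_mult_right scl_add mult.commute[of d c] ac_simps)
    moreover have "long (s + t) (scl c y')"
      using x(3) y(2) long_zero by (cases "s = 0") (auto simp: long_scl)
    moreover have "long (s + t) (scl d x')"
      using y(3) x(2) long_zero by (cases "t = 0") (auto simp: long_scl)
    moreover have "long (s + t) (x' * y')"
      by (rule long_mono[OF long_mult[OF x(2) y(2)]]) simp
    moreover have "0 < s + t \<longrightarrow> c * d = 0" using x(3) y(3) by auto
    ultimately show ?case
      by (intro exI[of _ "c * d"] exI[of _ "scl c y' + scl d x' + x' * y'"] conjI long_add)
  next
    case (comm s x t y)
    then obtain c x' d y' where x: "x = scl c 1 + x'" "long s x'" and y: "y = scl d 1 + y'" "long t y'"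
      by blast
    have "cmt x y = cmt x' y'"
      unfolding x(1) y(1) by (simp add: distrib_left distrib_right scl_mult_left scl_mult_right scl_add mult.commute[of d c] ac_simps)
    moreover have "long (Suc (s + t)) (cmt x' y')"
      using long_mult[OF x(2) y(2)] long_mult[OF y(2) x(2)] by (simp add: long_diff add.commute)
    ultimately show ?case by (intro exI[of _ 0] exI[of _ "cmt x y"]) simp
  next
    case (weaken k x)
    then obtain c y where "x = scl c 1 + y" "long (Suc k) y" "c = 0" by auto
    then show ?case by (intro exI[of _ 0] exI[of _ y]) (auto intro: long_mono)
  qed
  then have "long k x" using \<open>0 < k\<close> by auto
  then show ?thesis using assms(3) by (simp add: long_def)
qed

lemma cfilt_commutative:
  fixes x :: "'a::comm_ring_1"
  shows "cfilt k x \<Longrightarrow> 0 < k \<Longrightarrow> x = 0"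
proof (induction rule: cfilt.induct)
  case (mult s x t y)
  then show ?case by (cases "0 < s") auto
qed (auto simp: mult.commute)


section \<open>The Solomon-Tits algebra inside the free algebra\<close>

lemma set_comps_ordered_partitions: "set_comps n = ordered_partitions {1..n}"
  unfolding ordered_partitions_def by (rule Set.set_eqI) (simp only: set_comps_alt mem_Collect_eq)

definition words_of :: "nat \<Rightarrow> (nat set list \<Rightarrow> 'f) \<Rightarrow> nat set word \<Rightarrow>\<^sub>0 'f::field" where
  "words_of n f = (\<Sum>P\<in>set_comps n. scl (f P) (basis (Word P)))"

lemma lookup_words_of: "lookup (words_of n f) (Word P) = (if P \<in> set_comps n then f P else 0)"
proof -
  have "lookup (words_of n f) (Word P) = (\<Sum>Q\<in>set_comps n. if Q = P then f Q else 0)"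
    unfolding words_of_def lookup_sum by (intro sum.cong refl) (simp add: lookup_single when_def)
  then show ?thesis by (simp add: finite_set_comps)
qed

lemma words_of_eq_iff:
  assumes "f \<in> carrier (solomon_tits n)" "g \<in> carrier (solomon_tits n)"
  shows "words_of n f = words_of n g \<longleftrightarrow> f = g"
proof
  assume eq: "words_of n f = words_of n g"
  show "f = g"
  proof
    fix P
    show "f P = g P"
    proof (cases "P \<in> set_comps n")
      case True
      then show ?thesis
        using arg_cong[OF eq, of "\<lambda>x. lookup x (Word P)"] by (simp add: lookup_words_of)
    qed (use assms in \<open>simp add: solomon_tits_def\<close>)
  qed
qed simp

lemma words_of_add: "words_of n (f \<oplus>\<^bsub>solomon_tits n\<^esub> g) = words_of n f + words_of n g"
  by (simp add: words_of_def solomon_tits_def scl_add_left sum.distrib)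

lemma words_of_mult:
  "words_of n (f \<otimes>\<^bsub>solomon_tits n\<^esub> g) = (\<Sum>P\<in>set_comps n. scl (f P) (wedge_lin P (words_of n g)))"
proof (rule poly_mapping_eqI)
  fix w :: "nat set word"
  let ?h = "\<lambda>T. lookup (basis (Word T)) w :: 'a"
  have "lookup (words_of n (f \<otimes>\<^bsub>solomon_tits n\<^esub> g)) w = (\<Sum>T\<in>set_comps n. (f \<otimes>\<^bsub>solomon_tits n\<^esub> g) T * ?h T)"
    by (simp add: words_of_def lookup_sum)
  also have "\<dots> = (\<Sum>P\<in>set_comps n. \<Sum>Q\<in>set_comps n. f P * g Q * ?h (wedge P Q))"
    by (rule sum_mult_weighted)
  also have "\<dots> = lookup (\<Sum>P\<in>set_comps n. scl (f P) (wedge_lin P (words_of n g))) w"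
    by (simp add: words_of_def lookup_sum linop_sum[OF linop_wedge_lin] linop_scl[OF linop_wedge_lin]
        sum_distrib_left mult.assoc)
  finally show "lookup (words_of n (f \<otimes>\<^bsub>solomon_tits n\<^esub> g)) w
      = lookup (\<Sum>P\<in>set_comps n. scl (f P) (wedge_lin P (words_of n g))) w" .
qed

text \<open>The coefficients of the image under the support map.\<close>

definition class_sum :: "nat \<Rightarrow> (nat set list \<Rightarrow> 'f) \<Rightarrow> nat set set \<Rightarrow> 'f::field" where
  "class_sum n f X = (\<Sum>P | P \<in> set_comps n \<and> set P = X. f P)"

lemma mset_eq_set_comps:
  assumes "P \<in> set_comps n" "Q \<in> set_comps n"
  shows "mset P = mset Q \<longleftrightarrow> set P = set Q"
proof -
  have "{} \<notin> set P \<Longrightarrow> sorted_wrt disjnt P \<Longrightarrow> distinct P" for P :: "nat set list"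
    by (induction P) (auto simp: disjnt_def)
  then have "distinct P" "distinct Q" using assms by (auto simp: set_comps_alt)
  then show ?thesis by (simp add: set_eq_iff_mset_eq_distinct)
qed

lemma sum_over_classes:
  assumes "\<And>X. class_sum n f X = 0"
  shows "(\<Sum>P\<in>set_comps n. scl (f P) (G (set P))) = 0"
proof -
  have "(\<Sum>P\<in>set_comps n. scl (f P) (G (set P)))
      = (\<Sum>X\<in>set ` set_comps n. \<Sum>P | P \<in> set_comps n \<and> set P = X. scl (f P) (G (set P)))"
    by (rule sum.image_gen[OF finite_set_comps])
  also have "\<dots> = (\<Sum>X\<in>set ` set_comps n. scl (class_sum n f X) (G X))"
    unfolding class_sum_def by (intro sum.cong refl) (simp add: ncp.scale_sum_left)
  finally show ?thesis using assms by simp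
qed

text \<open>
  If all class sums vanish, every composition may be replaced by its difference to a fixed
  representative of its class.
\<close>

lemma cfilt_words_of_mult:
  assumes f: "\<And>X. class_sum n f X = 0" and g: "cfilt k (words_of n g)"
  shows "cfilt (Suc k) (words_of n (f \<otimes>\<^bsub>solomon_tits n\<^esub> g))"
proof -
  let ?g = "words_of n g"
  define rep where "rep X = (SOME P. P \<in> set_comps n \<and> set P = X)" for X
  have rep: "rep (set P) \<in> set_comps n \<and> set (rep (set P)) = set P" if "P \<in> set_comps n" for P
    unfolding rep_def by (rule someI[of _ P]) (use that in simp)
  have "words_of n (f \<otimes>\<^bsub>solomon_tits n\<^esub> g)
      = (\<Sum>P\<in>set_comps n. scl (f P) (wedge_lin P ?g)) - (\<Sum>P\<in>set_comps n. scl (f P) (wedge_lin (rep (set P)) ?g))"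
    unfolding words_of_mult sum_over_classes[OF f, of "\<lambda>X. wedge_lin (rep X) ?g"] by simp
  also have "\<dots> = (\<Sum>P\<in>set_comps n. scl (f P) (wedge_lin P ?g - wedge_lin (rep (set P)) ?g))"
    by (simp add: scl_diff sum_subtractf)
  finally show ?thesis
    by (simp only:) (intro cfilt_sum cfilt_scl cfilt_wedge_lin_perm g,
        use rep mset_eq_set_comps in blast)
qed

text \<open>The passage from words to multisets is a homomorphism to a commutative ring.\<close>

lemma class_sum_cfilt:
  assumes "cfilt 1 (words_of n f)"
  shows "class_sum n f X = 0"
proof (cases "\<exists>Q\<in>set_comps n. set Q = X")
  case True
  then obtain Q where Q: "Q \<in> set_comps n" "set Q = X" by blast
  let ?M = "lin (\<lambda>w. basis (mset (letters w))) :: (nat set word \<Rightarrow>\<^sub>0 'a) \<Rightarrow> nat set multiset \<Rightarrow>\<^sub>0 'a"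
  have "?M (x * y) = ?M x * ?M y" for x y
    by (rule lin_mult) (simp add: mult_single)
  then have "cfilt 1 (?M (words_of n f))"
    by (intro cfilt_hom[OF assms, of ?M]) (simp_all add: lin_zero lin_add lin_diff)
  then have "?M (words_of n f) = 0"
    by (rule cfilt_commutative) simp
  then have "0 = lookup (?M (words_of n f)) (mset Q)" by simp
  also have "\<dots> = (\<Sum>P\<in>set_comps n. if set P = X then f P else 0)"
    unfolding words_of_def lin_sum lin_scl lin_basis lookup_sum
    using mset_eq_set_comps[OF _ Q(1)] Q(2)
    by (intro sum.cong refl) (simp add: lookup_single when_def)
  also have "\<dots> = class_sum n f X"
    unfolding class_sum_def by (intro sum.inter_filter[symmetric] finite_set_comps)
  finally show ?thesis ..
next
  case False
  then have "{P. P \<in> set_comps n \<and> set P = X} = {}" by blast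
  then show ?thesis unfolding class_sum_def by (simp only: sum.empty)
qed

lemma cfilt_words_of:
  assumes "f \<in> carrier (solomon_tits n)" "\<And>X. class_sum n f X = 0"
  shows "cfilt 1 (words_of n f)"
  using cfilt_words_of_mult[OF assms(2) cfilt.any, of "\<one>\<^bsub>solomon_tits n\<^esub>"] mult_one(2)[OF assms(1)]
  by simp


section \<open>Characters\<close>

definition finer :: "nat set set \<Rightarrow> nat set list \<Rightarrow> bool" where
  "finer X P \<longleftrightarrow> (\<forall>A\<in>X. \<exists>B\<in>set P. A \<subseteq> B)"

definition character :: "nat \<Rightarrow> nat set set \<Rightarrow> (nat set list \<Rightarrow> 'f) \<Rightarrow> 'f::field" where
  "character n X f = (\<Sum>P\<in>set_comps n. f P * (if finer X P then 1 else 0))"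

lemma character_mult:
  assumes "{} \<notin> X"
  shows "character n X (f \<otimes>\<^bsub>solomon_tits n\<^esub> g) = character n X f * character n X g"
proof -
  have wedge: "set (wedge P Q) = {A \<inter> B | A B. A \<in> set P \<and> B \<in> set Q} - {{}}" for P Q :: "nat set list"
    by (auto simp: wedge_def)
  have finer_wedge: "finer X (wedge P Q) \<longleftrightarrow> finer X P \<and> finer X Q" for P Q
  proof
    assume *: "finer X (wedge P Q)"
    have "\<exists>B\<in>set P. \<exists>C\<in>set Q. A \<subseteq> B \<inter> C" if A: "A \<in> X" for A
    proof -
      obtain D where "D \<in> set (wedge P Q)" "A \<subseteq> D"
        using * A by (auto simp: finer_def)
      then show ?thesis unfolding wedge by blast
    qed
    then show "finer X P \<and> finer X Q" unfolding finer_def by (meson le_inf_iff)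
  next
    assume *: "finer X P \<and> finer X Q"
    show "finer X (wedge P Q)"
      unfolding finer_def
    proof
      fix A assume "A \<in> X"
      with * obtain B C where "B \<in> set P" "C \<in> set Q" "A \<subseteq> B \<inter> C"
        unfolding finer_def by (meson le_inf_iff)
      moreover have "A \<noteq> {}" using assms \<open>A \<in> X\<close> by metis
      ultimately have "B \<inter> C \<in> set (wedge P Q)" unfolding wedge by auto
      then show "\<exists>B\<in>set (wedge P Q). A \<subseteq> B" using \<open>A \<subseteq> B \<inter> C\<close> by (rule bexI[rotated])
    qed
  qed
  show ?thesis
    unfolding character_def sum_mult_weighted sum_product
    by (intro sum.cong refl) (simp add: finer_wedge)
qed

lemma character_one:
  assumes "{} \<notin> X" "\<Union>X \<subseteq> {1..n}"
  shows "character n X (\<lambda>P. c * \<one>\<^bsub>solomon_tits n\<^esub> P) = c"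
proof -
  let ?e = "filter (\<lambda>C. C \<noteq> {}) [{1..n}]"
  have "finer X ?e" using assms by (fastforce simp: finer_def)
  have "character n X (\<lambda>P. c * \<one>\<^bsub>solomon_tits n\<^esub> P) = (\<Sum>P\<in>set_comps n. if P = ?e then c * (if finer X ?e then 1 else 0) else 0)"
    unfolding character_def
    by (intro sum.cong refl) (simp only: solomon_tits_def monoid.select_convs split: if_split, auto)
  also have "\<dots> = c * (if finer X ?e then 1 else 0)"
    using one_comp[of n] by (simp only: sum.delta[OF finite_set_comps] if_True)
  finally show ?thesis using \<open>finer X ?e\<close> by simp
qed

text \<open>
  A character adds up the class sums of all coarser set partitions, so the class sums vanish one
  after the other, from coarse to fine. The number of coarser compositions serves as the measure of
  the induction.
\<close>

lemma character_class_sum: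
  assumes "\<And>P. P \<in> set_comps n \<Longrightarrow> character n (set P) f = 0"
  shows "class_sum n f X = 0"
proof (cases "\<exists>Q\<in>set_comps n. set Q = X")
  case True
  then obtain Q where "Q \<in> set_comps n" "set Q = X" by blast
  have "class_sum n f (set Q) = 0" if "Q \<in> set_comps n" for Q
    using that
  proof (induction "card {P \<in> set_comps n. finer (set Q) P}" arbitrary: Q rule: less_induct)
    case less
    let ?F = "{P \<in> set_comps n. finer (set Q) P}"
    have refl: "finer (set P) P" for P by (auto simp: finer_def)
    have antisym: "set P \<subseteq> set Q" if P: "P \<in> set_comps n" and finer: "finer (set Q) P" "finer (set P) Q" for P Q
    proof
      fix A assume A: "A \<in> set P"
      then obtain B where B: "B \<in> set Q" "A \<subseteq> B" using finer(2) by (auto simp: finer_def)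
      then obtain A' where A': "A' \<in> set P" "B \<subseteq> A'" using finer(1) by (auto simp: finer_def)
      have "{} \<notin> set P" "sorted_wrt disjnt P" using P by (auto simp: set_comps_alt)
      then have "A = A' \<or> A \<inter> A' = {}"
        using A A'(1) by (induction P) (auto simp: disjnt_def)
      moreover have "A \<noteq> {}" using A \<open>{} \<notin> set P\<close> by metis
      moreover have "A \<inter> A' = A" using B(2) A'(2) by auto
      ultimately have "A = A'" by auto
      then show "A \<in> set Q" using A'(2) B by auto
    qed
    have zero: "(\<Sum>P | P \<in> ?F \<and> set P = Y. f P) = 0" if "Y \<in> set ` ?F - {set Q}" for Y
    proof -
      obtain P where P: "P \<in> set_comps n" "finer (set Q) P" "set P = Y" "set P \<noteq> set Q"
        using \<open>Y \<in> _\<close> by blast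
      have "\<not> finer (set P) Q"
        using antisym[OF P(1) P(2)] antisym[OF less.prems _ P(2)] P(4) by blast
      moreover have "finer (set Q) R" if "finer (set P) R" for R
        using that P(2) unfolding finer_def by (meson subset_trans)
      ultimately have "{R \<in> set_comps n. finer (set P) R} \<subset> ?F"
        using less.prems refl[of Q] by blast
      then have "class_sum n f (set P) = 0"
        by (intro less.hyps P(1) psubset_card_mono) (simp_all add: finite_set_comps)
      moreover have "{R. R \<in> ?F \<and> set R = Y} = {R. R \<in> set_comps n \<and> set R = Y}"
        using P(2,3) by (auto simp: finer_def)
      ultimately show ?thesis using P(3) by (simp add: class_sum_def)
    qed
    have fin: "finite ?F" by (simp add: finite_set_comps)
    have "0 = character n (set Q) f"
      using assms[OF less.prems] by simp
    also have "\<dots> = (\<Sum>P\<in>?F. f P)"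
      unfolding character_def sum.inter_filter[OF finite_set_comps] by (intro sum.cong refl) auto
    also have "\<dots> = (\<Sum>Y\<in>set ` ?F. \<Sum>P | P \<in> ?F \<and> set P = Y. f P)"
      by (rule sum.image_gen[OF fin])
    also have "\<dots> = (\<Sum>Y\<in>{set Q}. \<Sum>P | P \<in> ?F \<and> set P = Y. f P)"
      using fin less.prems refl[of Q] zero by (intro sum.mono_neutral_right) auto
    also have "\<dots> = class_sum n f (set Q)"
      unfolding class_sum_def by (auto simp: finer_def intro!: sum.cong)
    finally show ?case ..
  qed
  then show ?thesis using \<open>Q \<in> _\<close> \<open>set Q = X\<close> by blast
next
  case False
  then have "{P. P \<in> set_comps n \<and> set P = X} = {}" by blast
  then show ?thesis unfolding class_sum_def by (simp only: sum.empty)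
qed

section \<open>Left ideals and the Jacobson radical\<close>

context ring
begin

lemma left_idealI:
  assumes "H \<subseteq> carrier R" "\<zero> \<in> H" "\<And>x y. x \<in> H \<Longrightarrow> y \<in> H \<Longrightarrow> x \<oplus> y \<in> H"
    and "\<And>a x. a \<in> carrier R \<Longrightarrow> x \<in> H \<Longrightarrow> a \<otimes> x \<in> H"
  shows "left_ideal H R"
proof (intro left_ideal.intro left_ideal_axioms.intro additive_subgroupI ring_axioms assms(4))
  show "subgroup H (add_monoid R)"
  proof (rule group.subgroupI[OF a_group])
    fix x assume x: "x \<in> H"
    then have "(\<ominus> \<one>) \<otimes> x \<in> H" by (intro assms(4)) simp_all
    moreover have "(\<ominus> \<one>) \<otimes> x = \<ominus> x" using x assms(1) by (simp add: l_minus subset_iff)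
    ultimately show "inv\<^bsub>add_monoid R\<^esub> x \<in> H" by (simp add: a_inv_def)
  qed (use assms(1-3) in auto)
qed

lemma left_idealD:
  assumes "left_ideal H R"
  shows "H \<subseteq> carrier R" "\<zero> \<in> H" "\<And>x y. x \<in> H \<Longrightarrow> y \<in> H \<Longrightarrow> x \<oplus> y \<in> H"
    "\<And>a x. a \<in> carrier R \<Longrightarrow> x \<in> H \<Longrightarrow> a \<otimes> x \<in> H"
proof -
  interpret left_ideal H R by (rule assms)
  show "H \<subseteq> carrier R" by (rule a_subset)
  show "\<zero> \<in> H" by (rule zero_closed)
  show "\<And>x y. x \<in> H \<Longrightarrow> y \<in> H \<Longrightarrow> x \<oplus> y \<in> H" by (rule a_closed)
  show "\<And>a x. a \<in> carrier R \<Longrightarrow> x \<in> H \<Longrightarrow> a \<otimes> x \<in> H" by (rule I_l_closed)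
qed

lemma max_left_idealD: "max_left_ideal M R \<Longrightarrow> left_ideal M R"
  by (rule max_left_ideal.axioms(1))

lemma left_ideal_jacobson_rad: "left_ideal (jacobson_rad R) R"
proof (rule left_idealI)
  note M = left_idealD[OF max_left_idealD]
  show "jacobson_rad R \<subseteq> carrier R" "\<zero> \<in> jacobson_rad R"
    using M(2) by (auto simp: jacobson_rad_def)
  show "x \<oplus> y \<in> jacobson_rad R" if "x \<in> jacobson_rad R" "y \<in> jacobson_rad R" for x y
    unfolding jacobson_rad_def
  proof (intro CollectI conjI allI impI)
    show "x \<oplus> y \<in> carrier R" using that by (simp add: jacobson_rad_def)
    show "x \<oplus> y \<in> M" if "max_left_ideal M R" for M
      using \<open>x \<in> _\<close> \<open>y \<in> _\<close> that by (intro M(3)[OF that]) (simp_all add: jacobson_rad_def)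
  qed
  show "a \<otimes> x \<in> jacobson_rad R" if "a \<in> carrier R" "x \<in> jacobson_rad R" for a x
    unfolding jacobson_rad_def
  proof (intro CollectI conjI allI impI)
    show "a \<otimes> x \<in> carrier R" using that by (simp add: jacobson_rad_def)
    show "a \<otimes> x \<in> M" if "max_left_ideal M R" for M
      using \<open>a \<in> _\<close> \<open>x \<in> _\<close> that by (intro M(4)[OF that]) (simp_all add: jacobson_rad_def)
  qed
qed

text \<open>
  If a maximal left ideal missed an element of \<open>N\<close>, then \<open>1 = m + y\<close> with \<open>m\<close> in the maximal ideal
  and \<open>y\<close> nilpotent.
\<close>

lemma nil_left_ideal_subset_jacobson_rad:
  assumes N: "left_ideal N R" and nil: "\<And>x. x \<in> N \<Longrightarrow> \<exists>m::nat. x [^] m = \<zero>"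
  shows "N \<subseteq> jacobson_rad R"
proof -
  have "x \<in> M" if x: "x \<in> N" and M: "max_left_ideal M R" for x M
  proof (rule ccontr)
    assume "x \<notin> M"
    interpret M: max_left_ideal M R by (rule M)
    note Nid = left_idealD[OF N] and Mid = left_idealD[OF max_left_idealD[OF M]]
    let ?J = "{m \<oplus> y | m y. m \<in> M \<and> y \<in> N}"
    have J: "left_ideal ?J R"
    proof (rule left_idealI)
      show "?J \<subseteq> carrier R" using Nid(1) Mid(1) by auto
      have "\<zero> \<oplus> \<zero> \<in> ?J" using Nid(2) Mid(2) by blast
      then show "\<zero> \<in> ?J" by simp
    next
      fix u v assume "u \<in> ?J" "v \<in> ?J"
      then obtain m y m' y' where *: "u = m \<oplus> y" "v = m' \<oplus> y'" "m \<in> M" "m' \<in> M" "y \<in> N" "y' \<in> N" by blast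
      then have "u \<oplus> v = (m \<oplus> m') \<oplus> (y \<oplus> y')"
        using Nid(1) Mid(1) by (simp add: subset_iff a_ac)
      then show "u \<oplus> v \<in> ?J" using * Nid(3) Mid(3) by blast
    next
      fix a u assume a: "a \<in> carrier R" and "u \<in> ?J"
      then obtain m y where *: "u = m \<oplus> y" "m \<in> M" "y \<in> N" by blast
      then have "a \<otimes> u = a \<otimes> m \<oplus> a \<otimes> y"
        using a Nid(1) Mid(1) by (simp add: subset_iff r_distr)
      then show "a \<otimes> u \<in> ?J" using * a Nid(4) Mid(4) by blast
    qed
    moreover have "M \<subseteq> ?J"
    proof
      fix m assume "m \<in> M"
      then have "m \<oplus> \<zero> = m" using Mid(1) by auto
      moreover have "m \<oplus> \<zero> \<in> ?J" using \<open>m \<in> M\<close> Nid(2) by blast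
      ultimately show "m \<in> ?J" by metis
    qed
    moreover have "x \<in> ?J"
    proof -
      have "\<zero> \<oplus> x = x" using x Nid(1) by auto
      moreover have "\<zero> \<oplus> x \<in> ?J" using x Mid(2) by blast
      ultimately show ?thesis by metis
    qed
    ultimately have "?J \<noteq> M" using \<open>x \<notin> M\<close> by metis
    then have "?J = carrier R"
      using M.I_maximal[OF J \<open>M \<subseteq> ?J\<close> left_idealD(1)[OF J]] by simp
    then have "\<one> \<in> ?J" using one_closed by simp
    then obtain m y where one: "\<one> = m \<oplus> y" and m: "m \<in> M" and y: "y \<in> N" by blast
    have mc: "m \<in> carrier R" and yc: "y \<in> carrier R" using m y Nid(1) Mid(1) by auto
    \<comment> \<open>Modulo the left ideal \<open>M\<close>, right multiplication by \<open>y\<close> is the identity.\<close>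
    have "\<exists>m'\<in>M. \<one> = m' \<oplus> y [^] j" for j :: nat
    proof (induction j)
      case 0
      then show ?case using Mid(2) by (intro bexI[of _ \<zero>]) auto
    next
      case (Suc j)
      then obtain m' where m': "m' \<in> M" "\<one> = m' \<oplus> y [^] j" by blast
      have "y [^] j = y [^] j \<otimes> (m \<oplus> y)" unfolding one[symmetric] using yc by simp
      also have "\<dots> = y [^] j \<otimes> m \<oplus> y [^] Suc j" using mc yc by (simp add: r_distr)
      finally have "\<one> = (m' \<oplus> y [^] j \<otimes> m) \<oplus> y [^] Suc j"
        using m' mc yc Mid(1) by (simp add: a_assoc subset_iff)
      moreover have "m' \<oplus> y [^] j \<otimes> m \<in> M" using m' m yc by (intro Mid(3,4)) auto
      ultimately show ?case by blast
    qed
    moreover obtain j :: nat where "y [^] j = \<zero>" using nil[OF y] by blast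
    ultimately obtain m' where "m' \<in> M" "\<one> = m' \<oplus> \<zero>" by metis
    then have "\<one> \<in> M" using Mid(1) by auto
    have "carrier R \<subseteq> M"
    proof
      fix a assume "a \<in> carrier R"
      then show "a \<in> M" using Mid(4)[OF _ \<open>\<one> \<in> M\<close>, of a] by simp
    qed
    then have "carrier R = M" using Mid(1) by (rule subset_antisym)
    then show False using M.I_notcarr by simp
  qed
  then show ?thesis
    using left_idealD(1)[OF N] by (auto simp: jacobson_rad_def)
qed

lemma max_left_ideal_kernel:
  fixes \<chi> :: "'a \<Rightarrow> 'k::field"
  assumes add: "\<And>x y. x \<in> carrier R \<Longrightarrow> y \<in> carrier R \<Longrightarrow> \<chi> (x \<oplus> y) = \<chi> x + \<chi> y"
    and mult: "\<And>x y. x \<in> carrier R \<Longrightarrow> y \<in> carrier R \<Longrightarrow> \<chi> (x \<otimes> y) = \<chi> x * \<chi> y"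
    and onto: "\<And>c. \<exists>x\<in>carrier R. \<chi> x = c"
    and one: "\<chi> \<one> = 1"
  shows "max_left_ideal {x \<in> carrier R. \<chi> x = 0} R"
proof -
  let ?M = "{x \<in> carrier R. \<chi> x = 0}"
  have "\<chi> \<zero> + \<chi> \<zero> = \<chi> \<zero> + 0" using add[of \<zero> \<zero>] by (simp only: l_zero zero_closed add_0_right)
  then have zero: "\<chi> \<zero> = 0" by (rule add_left_imp_eq)
  have neg: "\<chi> (\<ominus> x) = - \<chi> x" if "x \<in> carrier R" for x
    using add[of x "\<ominus> x"] that zero neg_eq_iff_add_eq_0[of "\<chi> x" "\<chi> (\<ominus> x)"] by (simp add: r_neg)
  have M: "left_ideal ?M R"
    by (rule left_idealI) (auto simp: zero add mult)
  show ?thesis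
  proof (intro max_left_ideal.intro max_left_ideal_axioms.intro M)
    show "carrier R \<noteq> ?M"
    proof
      assume "carrier R = ?M"
      then have "\<chi> \<one> = 0" using one_closed by blast
      then show False using one by simp
    qed
  next
    fix J assume J: "left_ideal J R" "?M \<subseteq> J" "J \<subseteq> carrier R"
    show "J = ?M \<or> J = carrier R"
    proof (cases "J = ?M")
      case False
      then obtain x where x: "x \<in> J" "x \<in> carrier R" "\<chi> x \<noteq> 0" using J(2,3) by blast
      obtain s where s: "s \<in> carrier R" "\<chi> s = inverse (\<chi> x)" using onto by blast
      have sx: "s \<otimes> x \<in> J" "s \<otimes> x \<in> carrier R" using left_idealD(4)[OF J(1)] s x by auto
      have "\<one> \<oplus> \<ominus> (s \<otimes> x) \<in> ?M"
        using s x sx by (simp add: add neg mult one)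
      then have "(\<one> \<oplus> \<ominus> (s \<otimes> x)) \<oplus> s \<otimes> x \<in> J"
        by (intro left_idealD(3)[OF J(1) subsetD[OF J(2)] sx(1)])
      then have "\<one> \<in> J" using sx by (simp add: a_assoc l_neg)
      then have "carrier R \<subseteq> J" using left_idealD(4)[OF J(1), of _ \<one>] by auto
      then show ?thesis using J(3) by blast
    qed simp
  qed
qed

lemma rad_pow_closed:
  "rad_pow R k \<subseteq> carrier R"
  "\<zero> \<in> rad_pow R k"
  "x \<in> rad_pow R k \<Longrightarrow> y \<in> rad_pow R k \<Longrightarrow> x \<oplus> y \<in> rad_pow R k"
  "a \<in> carrier R \<Longrightarrow> x \<in> rad_pow R k \<Longrightarrow> a \<otimes> x \<in> rad_pow R k"
proof -
  note J = left_idealD[OF left_ideal_jacobson_rad]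
  have "left_ideal (rad_pow R k) R"
  proof (induction k)
    case 0
    show ?case by (rule left_idealI) auto
  next
    case (Suc k)
    note I = left_idealD[OF Suc.IH]
    show ?case
    proof (rule left_idealI)
      show sub: "rad_pow R (Suc k) \<subseteq> carrier R"
      proof
        fix x assume "x \<in> rad_pow R (Suc k)"
        then have "x \<in> ideal_prod R (jacobson_rad R) (rad_pow R k)" by simp
        then show "x \<in> carrier R" by induction (use J(1) I(1) in auto)
      qed
      have "\<zero> \<otimes> \<zero> \<in> ideal_prod R (jacobson_rad R) (rad_pow R k)"
        by (intro ideal_prod.prod J(2) I(2))
      then show "\<zero> \<in> rad_pow R (Suc k)" by simp
      show "x \<oplus> y \<in> rad_pow R (Suc k)" if "x \<in> rad_pow R (Suc k)" "y \<in> rad_pow R (Suc k)" for x y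
        using that by (simp add: ideal_prod.sum)
      show "a \<otimes> x \<in> rad_pow R (Suc k)" if a: "a \<in> carrier R" and x: "x \<in> rad_pow R (Suc k)" for a x
      proof -
        have "x \<in> ideal_prod R (jacobson_rad R) (rad_pow R k)" using x by simp
        then have "x \<in> carrier R \<and> a \<otimes> x \<in> ideal_prod R (jacobson_rad R) (rad_pow R k)"
        proof induction
          case (prod i j)
          then have "i \<in> carrier R" "j \<in> carrier R" using J(1) I(1) by auto
          moreover have "(a \<otimes> i) \<otimes> j \<in> ideal_prod R (jacobson_rad R) (rad_pow R k)"
            by (intro ideal_prod.prod J(4) a prod)
          ultimately show ?case using a by (simp add: m_assoc)
        next
          case (sum x y)
          then show ?case using a by (simp add: r_distr ideal_prod.sum)
        qed
        then show ?thesis by simp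
      qed
    qed
  qed
  note I = left_idealD[OF this]
  show "rad_pow R k \<subseteq> carrier R" "\<zero> \<in> rad_pow R k"
    "x \<in> rad_pow R k \<Longrightarrow> y \<in> rad_pow R k \<Longrightarrow> x \<oplus> y \<in> rad_pow R k"
    "a \<in> carrier R \<Longrightarrow> x \<in> rad_pow R k \<Longrightarrow> a \<otimes> x \<in> rad_pow R k"
    by (simp_all only: I)
qed

lemma rad_pow_mult_rad:
  "f \<in> rad_pow R k \<Longrightarrow> g \<in> jacobson_rad R \<Longrightarrow> f \<otimes> g \<in> rad_pow R (Suc k)"
proof (induction k arbitrary: f)
  case 0
  note J = left_idealD[OF left_ideal_jacobson_rad]
  have "f \<otimes> g \<in> jacobson_rad R" using 0 by (intro J(4)) auto
  then have "(f \<otimes> g) \<otimes> \<one> \<in> rad_pow R (Suc 0)" by (simp add: ideal_prod.prod)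
  moreover have "(f \<otimes> g) \<otimes> \<one> = f \<otimes> g" using \<open>f \<otimes> g \<in> jacobson_rad R\<close> J(1) by auto
  ultimately show ?case by simp
next
  case (Suc k)
  note J = left_idealD[OF left_ideal_jacobson_rad]
  have g: "g \<in> carrier R" using Suc.prems(2) J(1) by auto
  have "f \<in> ideal_prod R (jacobson_rad R) (rad_pow R k)" using Suc.prems by simp
  then have "f \<in> carrier R \<and> f \<otimes> g \<in> rad_pow R (Suc (Suc k))"
  proof induction
    case (prod i j)
    then have "i \<in> carrier R" "j \<in> carrier R" using J(1) rad_pow_closed(1) by auto
    moreover have "i \<otimes> (j \<otimes> g) \<in> ideal_prod R (jacobson_rad R) (rad_pow R (Suc k))"
      by (intro ideal_prod.prod prod Suc.IH Suc.prems(2))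
    ultimately show ?case using g by (simp add: m_assoc)
  next
    case (sum x y)
    then show ?case using g by (simp add: l_distr ideal_prod.sum)
  qed
  then show ?case by simp
qed

end


section \<open>The radical of an algebra of set compositions\<close>

lemma solomon_tits_simps:
  "\<zero>\<^bsub>solomon_tits n\<^esub> = (\<lambda>P. 0)" "f \<oplus>\<^bsub>solomon_tits n\<^esub> g = (\<lambda>P. f P + g P)"
  by (simp_all add: solomon_tits_def)

definition scalar :: "nat \<Rightarrow> 'f \<Rightarrow> nat set list \<Rightarrow> 'f::field" where
  "scalar n c = (\<lambda>P. c * \<one>\<^bsub>solomon_tits n\<^esub> P)"

lemma scalar_mult:
  assumes "f \<in> carrier (solomon_tits n)"
  shows "scalar n c \<otimes>\<^bsub>solomon_tits n\<^esub> f = (\<lambda>P. c * f P)"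
proof
  fix R
  have "(scalar n c \<otimes>\<^bsub>solomon_tits n\<^esub> f) R = c * (\<one>\<^bsub>solomon_tits n\<^esub> \<otimes>\<^bsub>solomon_tits n\<^esub> f) R"
    unfolding mult_alt scalar_def sum_distrib_left by (intro sum.cong refl) auto
  then show "(scalar n c \<otimes>\<^bsub>solomon_tits n\<^esub> f) R = c * f R"
    by (simp add: mult_one(1)[OF assms])
qed

text \<open>
  The Solomon-Tits algebra and its invariants are treated together: both are subrings that contain
  the scalars.
\<close>

locale comp_subalgebra =
  fixes n :: nat and K :: "(nat set list \<Rightarrow> 'f::field) set"
  assumes subring: "subring K (solomon_tits n)" and scalar: "\<And>c. scalar n c \<in> K"
begin

abbreviation "R \<equiv> (solomon_tits n)\<lparr>carrier := K\<rparr>"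

lemma K_subset: "K \<subseteq> carrier (solomon_tits n)"
  using subringE(1)[OF subring] .

sublocale ring R
  by (rule ring.subring_is_ring[OF ring_solomon_tits subring])

text \<open>
  Kernels of characters are maximal left ideals, so radical elements have vanishing class sums.
  Conversely, the powers of an element of the right-hand side climb up the filtration, whose words
  finally become longer than any composition.
\<close>

lemma jacobson_rad_eq: "jacobson_rad R = {f \<in> K. cfilt 1 (words_of n f)}"
proof
  show "jacobson_rad R \<subseteq> {f \<in> K. cfilt 1 (words_of n f)}"
  proof
    fix f assume f: "f \<in> jacobson_rad R"
    then have fK: "f \<in> K" by (simp add: jacobson_rad_def)
    have "character n (set P) f = 0" if P: "P \<in> set_comps n" for P
    proof -
      have P': "{} \<notin> set P" "\<Union>(set P) \<subseteq> {1..n}" using P by (auto simp: set_comps_alt)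
      have "max_left_ideal {f \<in> carrier R. character n (set P) f = 0} R"
      proof (rule max_left_ideal_kernel)
        show "character n (set P) (x \<oplus>\<^bsub>R\<^esub> y) = character n (set P) x + character n (set P) y" for x y
          by (simp add: character_def solomon_tits_simps distrib_right sum.distrib)
        show "character n (set P) (x \<otimes>\<^bsub>R\<^esub> y) = character n (set P) x * character n (set P) y" for x y
          using character_mult[OF P'(1)] by simp
        show "\<exists>x\<in>carrier R. character n (set P) x = c" for c
          using character_one[OF P', of c] scalar[of c] by (auto simp: scalar_def)
        show "character n (set P) \<one>\<^bsub>R\<^esub> = 1"
          using character_one[OF P', of 1] by simp
      qed
      then show ?thesis using f by (auto simp: jacobson_rad_def)
    qed
    then have "class_sum n f X = 0" for X
      by (rule character_class_sum)
    then have "cfilt 1 (words_of n f)"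
      using fK K_subset by (intro cfilt_words_of) auto
    then show "f \<in> {f \<in> K. cfilt 1 (words_of n f)}"
      using fK by simp
  qed
next
  let ?N = "{f \<in> K. cfilt 1 (words_of n f)}"
  show "?N \<subseteq> jacobson_rad R"
  proof (rule nil_left_ideal_subset_jacobson_rad)
    show "left_ideal ?N R"
    proof (rule left_idealI)
      have "\<zero>\<^bsub>R\<^esub> \<in> K" using zero_closed by simp
      moreover have "words_of n \<zero>\<^bsub>R\<^esub> = 0" by (simp add: words_of_def solomon_tits_simps)
      ultimately show "\<zero>\<^bsub>R\<^esub> \<in> ?N" by (simp add: cfilt.zero)
      show "x \<oplus>\<^bsub>R\<^esub> y \<in> ?N" if "x \<in> ?N" "y \<in> ?N" for x y
        using that add.m_closed[of x y] by (simp add: words_of_add cfilt.add)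
      show "a \<otimes>\<^bsub>R\<^esub> x \<in> ?N" if "a \<in> carrier R" "x \<in> ?N" for a x
        using that m_closed[of a x] by (simp add: words_of_mult cfilt_sum cfilt_scl cfilt_wedge_lin)
    qed auto
  next
    fix f assume f: "f \<in> ?N"
    have pow: "f [^]\<^bsub>R\<^esub> m \<in> K \<and> cfilt m (words_of n (f [^]\<^bsub>R\<^esub> m))" for m :: nat
    proof (induction m)
      case 0
      then show ?case using one_closed by (simp add: cfilt.any)
    next
      case (Suc m)
      have "f [^]\<^bsub>R\<^esub> Suc m = f \<otimes>\<^bsub>solomon_tits n\<^esub> (f [^]\<^bsub>R\<^esub> m)"
        using nat_pow_Suc2[of f m] f by simp
      moreover have "cfilt (Suc m) (words_of n (f \<otimes>\<^bsub>solomon_tits n\<^esub> (f [^]\<^bsub>R\<^esub> m)))"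
        using f Suc.IH by (intro cfilt_words_of_mult class_sum_cfilt) auto
      ultimately show ?case using nat_pow_closed[of f "Suc m"] f by simp
    qed
    have "(f [^]\<^bsub>R\<^esub> Suc n) P = 0" for P
    proof (cases "P \<in> set_comps n")
      case True
      then have "length P \<le> n"
        using length_ordered_partition[of "{1..n}" P] by (simp add: set_comps_ordered_partitions)
      then have "Word P \<notin> keys (words_of n (f [^]\<^bsub>R\<^esub> Suc n))"
        using cfilt_long_words[OF conjunct2[OF pow[of "Suc n"]], of "Word P"] by auto
      then show ?thesis using True by (simp add: in_keys_iff lookup_words_of del: nat_pow_Suc)
    next
      case False
      then show ?thesis using pow[of "Suc n"] K_subset by (auto simp: solomon_tits_def simp del: nat_pow_Suc)
    qed
    then have "f [^]\<^bsub>R\<^esub> Suc n = \<zero>\<^bsub>R\<^esub>"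
      by (intro ext) (simp add: solomon_tits_simps del: nat_pow_Suc)
    then show "\<exists>m::nat. f [^]\<^bsub>R\<^esub> m = \<zero>\<^bsub>R\<^esub>" by blast
  qed
qed

lemma rad_pow_cfilt: "f \<in> rad_pow R k \<Longrightarrow> cfilt k (words_of n f)"
proof (induction k arbitrary: f)
  case 0
  show ?case by (rule cfilt.any)
next
  case (Suc k)
  then have "f \<in> ideal_prod R (jacobson_rad R) (rad_pow R k)" by simp
  then show ?case
  proof induction
    case (prod i j)
    then have "cfilt 1 (words_of n i)" by (simp add: jacobson_rad_eq)
    then show ?case
      using cfilt_words_of_mult[OF class_sum_cfilt Suc.IH[OF prod(2)], of i] by simp
  next
    case (sum x y)
    then show ?case by (simp add: words_of_add cfilt.add)
  qed
qed

end

lemma solomon_tits_subalgebra: "comp_subalgebra n (carrier (solomon_tits n :: (nat set list \<Rightarrow> 'f::field) ring))"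
proof (rule comp_subalgebra.intro)
  interpret ring "solomon_tits n :: (nat set list \<Rightarrow> 'f::field) ring" by (rule ring_solomon_tits)
  show "subring (carrier (solomon_tits n)) (solomon_tits n :: (nat set list \<Rightarrow> 'f) ring)"
    by (rule subringI) auto
  show "scalar n c \<in> carrier (solomon_tits n :: (nat set list \<Rightarrow> 'f) ring)" for c
    using one_closed by (auto simp: scalar_def solomon_tits_def)
qed

lemma invariant_subalgebra: "comp_subalgebra n (carrier (invariant_algebra n :: (nat set list \<Rightarrow> 'f::field) ring))"
proof (rule comp_subalgebra.intro)
  show sub: "subring (carrier (invariant_algebra n)) (solomon_tits n :: (nat set list \<Rightarrow> 'f) ring)"
    by (rule subring_invariant_algebra)
  show "scalar n c \<in> carrier (invariant_algebra n :: (nat set list \<Rightarrow> 'f) ring)" for c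
    using subringE(3)[OF sub] by (auto simp: scalar_def invariant_alt solomon_tits_def)
qed

lemma invariant_algebra_eq:
  "invariant_algebra n = (solomon_tits n)\<lparr>carrier := carrier (invariant_algebra n)\<rparr>"
  by (simp add: invariant_algebra_def)

section \<open>Invariants are expansions\<close>

lemma exists_block_bijection:
  assumes "length P = length Q" "map card P = map card Q"
    and "sorted_wrt disjnt P" "sorted_wrt disjnt Q" "finite (\<Union>(set P))" "finite (\<Union>(set Q))"
  shows "\<exists>f. bij_betw f (\<Union>(set P)) (\<Union>(set Q)) \<and> map (image f) P = Q"
  using assms
proof (induction P Q rule: list_induct2)
  case Nil
  then show ?case by (simp add: bij_betw_def)
next
  case (Cons A P B Q)
  then obtain f where f: "bij_betw f (\<Union>(set P)) (\<Union>(set Q))" "map (image f) P = Q" by auto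
  have "finite A" "finite B" "card A = card B" using Cons.prems by auto
  then obtain g where g: "bij_betw g A B" using finite_same_card_bij by blast
  let ?h = "\<lambda>x. if x \<in> A then g x else f x"
  have disj: "A \<inter> \<Union>(set P) = {}" "B \<inter> \<Union>(set Q) = {}"
    using Cons.prems by (auto simp: disjnt_def)
  have "bij_betw ?h (A \<union> \<Union>(set P)) (B \<union> \<Union>(set Q))"
  proof (rule bij_betw_combine[OF _ _ disj(2)])
    show "bij_betw ?h A B" using g by (rule bij_betw_cong[THEN iffD1, rotated]) simp
    show "bij_betw ?h (\<Union>(set P)) (\<Union>(set Q))"
      using f(1) by (rule bij_betw_cong[THEN iffD1, rotated]) (use disj(1) in auto)
  qed
  moreover have "map (image ?h) (A # P) = B # Q"
  proof -
    have "?h ` A = B" using g by (simp add: bij_betw_def)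
    moreover have "map (image ?h) P = map (image f) P"
    proof (rule map_cong[OF refl])
      fix C assume "C \<in> set P"
      then show "?h ` C = f ` C" using disj(1) by (intro image_cong refl) auto
    qed
    ultimately show ?thesis using f(2) by simp
  qed
  ultimately show ?case by (intro exI[of _ ?h]) (simp only: list.set Union_insert simp_thms)
qed

lemma same_shape_permutation:
  assumes P: "P \<in> set_comps n" and Q: "Q \<in> set_comps n" and shape: "shape P = shape Q"
  shows "\<exists>\<pi>. \<pi> permutes {1..n} \<and> perm_comp \<pi> P = Q"
proof -
  have card: "map card P = map Suc (shape P)" if "P \<in> set_comps n" for P
  proof -
    have "card A = Suc (card A - 1)" if A: "A \<in> set P" for A
    proof -
      have "A \<subseteq> {1..n}" "A \<noteq> {}" using A \<open>P \<in> _\<close> by (auto simp: set_comps_alt)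
      then have "0 < card A" by (meson card_gt_0_iff finite_atLeastAtMost finite_subset)
      then show ?thesis by simp
    qed
    then show ?thesis by (simp add: shape_def)
  qed
  have un: "\<Union>(set P) = {1..n}" "\<Union>(set Q) = {1..n}" "sorted_wrt disjnt P" "sorted_wrt disjnt Q"
    using P Q by (simp_all add: set_comps_alt)
  have "map card P = map card Q" using card[OF P] card[OF Q] shape by simp
  then obtain f where f: "bij_betw f {1..n} {1..n}" "map (image f) P = Q"
    using exists_block_bijection[of P Q] un map_eq_imp_length_eq[of card P card Q] by auto
  let ?\<pi> = "\<lambda>x. if x \<in> {1..n} then f x else x"
  have "bij_betw ?\<pi> {1..n} {1..n}"
    using f(1) by (rule bij_betw_cong[THEN iffD1, rotated]) simp
  then have "?\<pi> permutes {1..n}"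
    by (rule bij_imp_permutes) auto
  moreover have "perm_comp ?\<pi> P = map (image f) P"
    unfolding perm_comp_def
  proof (rule map_cong[OF refl])
    fix C assume "C \<in> set P"
    then show "?\<pi> ` C = f ` C" using un(1) by (intro image_cong refl) auto
  qed
  ultimately show ?thesis using f(2) by metis
qed

text \<open>
  The invariant whose coefficient at a composition is read off from the block sizes; its word form is
  an expansion by \<open>words_of_collapse\<close>.
\<close>

definition collapse :: "nat \<Rightarrow> 'f::field ncsym \<Rightarrow> nat set list \<Rightarrow> 'f" where
  "collapse n z P = (if P \<in> set_comps n then lookup z (Word (shape P)) else 0)"

lemma words_of_collapse: "words_of n (collapse n z) = expand {1..n} z"
proof (rule poly_mapping_eqI)
  fix w :: "nat set word"
  show "lookup (words_of n (collapse n z)) w = lookup (expand {1..n} z) w"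
    by (cases w) (simp add: lookup_words_of lookup_expand collapse_def set_comps_ordered_partitions)
qed

lemma collapse_invariant: "collapse n z \<in> carrier (invariant_algebra n)"
  unfolding invariant_alt
proof (intro conjI allI impI ballI)
  show "collapse n z \<in> carrier (solomon_tits n)"
    by (simp add: solomon_tits_def collapse_def)
  fix \<pi> P assume \<pi>: "\<pi> permutes {1..n}" and P: "P \<in> set_comps n"
  have "shape (perm_comp \<pi> P) = shape P"
    using card_image[OF inj_on_subset[OF permutes_inj[OF \<pi>] subset_UNIV]]
    by (simp add: shape_def perm_comp_def comp_def)
  then show "collapse n z (perm_comp \<pi> P) = collapse n z P"
    using P perm_comp_closed[OF \<pi> P] by (simp add: collapse_def)
qed

lemma collapse_closed: "collapse n z \<in> carrier (solomon_tits n)"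
  by (simp add: solomon_tits_def collapse_def)

lemma collapse_linear:
  "collapse n 0 = (\<lambda>P. 0)" "collapse n (x + y) = (\<lambda>P. collapse n x P + collapse n y P)"
  "collapse n (scl c x) = (\<lambda>P. c * collapse n x P)"
  by (auto simp: collapse_def lookup_add)

lemma invariant_is_collapse:
  assumes f: "f \<in> carrier (invariant_algebra n)"
  shows "\<exists>z. f = collapse n z"
proof -
  define rep where "rep w = (SOME P. P \<in> set_comps n \<and> shape P = w)" for w
  have rep: "rep (shape P) \<in> set_comps n \<and> shape (rep (shape P)) = shape P" if "P \<in> set_comps n" for P
    unfolding rep_def by (rule someI[of _ P]) (use that in simp)
  have f_rep: "f (rep (shape P)) = f P" if P: "P \<in> set_comps n" for P
  proof -
    obtain \<pi> where \<pi>: "\<pi> permutes {1..n}" "perm_comp \<pi> P = rep (shape P)"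
      using same_shape_permutation[OF P, of "rep (shape P)"] rep[OF P] by auto
    have "f (perm_comp \<pi> P) = f P" using f P \<pi>(1) unfolding invariant_alt by blast
    then show ?thesis by (simp only: \<pi>(2))
  qed
  let ?z = "\<Sum>w\<in>shape ` set_comps n. scl (f (rep w)) (basis (Word w))"
  have "f P = collapse n ?z P" for P
  proof (cases "P \<in> set_comps n")
    case True
    have "lookup ?z (Word (shape P)) = (\<Sum>w\<in>shape ` set_comps n. if w = shape P then f (rep w) else 0)"
      unfolding lookup_sum by (intro sum.cong refl) (simp add: lookup_single when_def)
    also have "\<dots> = f P"
      using True finite_set_comps[of n] by (simp add: f_rep)
    finally show ?thesis using True by (simp add: collapse_def)
  next
    case False
    then show ?thesis using f by (simp add: collapse_def invariant_alt solomon_tits_def)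
  qed
  then show ?thesis by blast
qed

text \<open>
  The filtration degree of an invariant is transported to the symmetric functions by \<open>forget\<close>, which
  inverts the expansion up to \<open>n!\<close>.
\<close>

lemma invariant_cfilt:
  fixes f :: "nat set list \<Rightarrow> 'f::field_char_0"
  assumes f: "f \<in> carrier (invariant_algebra n)" and "cfilt k (words_of n f)"
  shows "\<exists>z. cfilt k z \<and> f = collapse n z"
proof -
  obtain z where z: "f = collapse n z" using invariant_is_collapse[OF f] by blast
  let ?y = "scl (inverse (fact n)) (forget (words_of n f))"
  have "expand {1..n} ?y = expand {1..n} z"
    using expand_forget[of "{1..n}" z] by (simp add: z words_of_collapse expand_linear)
  then have "words_of n (collapse n ?y) = words_of n f"
    by (simp add: z words_of_collapse)
  then have "collapse n ?y = f"
    using f collapse_invariant[of n ?y] by (subst (asm) words_of_eq_iff) (auto simp: invariant_alt)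
  moreover have "cfilt k ?y"
    by (intro cfilt_scl cfilt_forget assms(2))
  ultimately show ?thesis by metis
qed

text \<open>
  Cutting the expansions of \<open>D h\<^sub>n\<close> satisfies the Leibniz rule because the inserted commutator is
  primitive. Therefore multiplying them from the left by a composition acts as the derivation, block
  by block.
\<close>

lemma collapse_pair_insertion:
  fixes z :: "'f::field_char_0 ncsym"
  assumes "0 < a" "0 < b"
  shows "collapse n (pair_insertion a b z)
       = collapse n z \<otimes>\<^bsub>solomon_tits n\<^esub> collapse n (pair_insertion a b (hsym n))"
proof -
  let ?u = "cmt (psym a) (psym b) :: 'f ncsym" and ?d = "a + b" and ?S = "{1..n}"
  let ?U = "\<lambda>S :: nat set. expand S (pair_insertion a b (hsym (card S)) :: 'f ncsym)"
  have d: "0 < ?d" using assms by simp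
  have homog: "homog TYPE(nat) ?d ?u"
    by (intro homog_cmt homog_psym)
  have prim: "primitive TYPE(nat) ?u"
    by (rule primitive_cmt[OF primitive_psym homog_psym assms(1) primitive_psym homog_psym assms(2)])
  have "?U {} = 0"
    using assms insert_bracket_hsym[OF d, of ?u 0] by (simp add: expand_linear)
  then have wedge_eq: "wedge_lin P (?U ?S) = derive_word ?U P" if "P \<in> set_comps n" for P
    using that by (intro wedge_lin_derive cut_insert_bracket[OF homog prim d])
      (simp_all add: set_comps_ordered_partitions)
  have "words_of n (collapse n z \<otimes>\<^bsub>solomon_tits n\<^esub> collapse n (pair_insertion a b (hsym n)))
      = (\<Sum>P\<in>set_comps n. scl (collapse n z P) (wedge_lin P (?U ?S)))"
    by (simp add: words_of_mult words_of_collapse)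
  also have "\<dots> = lin (\<lambda>w. derive_word ?U (letters w)) (words_of n (collapse n z))"
    by (simp only: words_of_def lin_sum lin_scl lin_basis word.sel wedge_eq cong: sum.cong)
  also have "\<dots> = expand ?S (pair_insertion a b z)"
    unfolding words_of_collapse by (rule expand_insert_bracket[OF homog d, symmetric]) simp
  finally have "words_of n (collapse n z \<otimes>\<^bsub>solomon_tits n\<^esub> collapse n (pair_insertion a b (hsym n)))
      = words_of n (collapse n (pair_insertion a b z))"
    by (simp only: words_of_collapse)
  then show ?thesis
    by (rule words_of_eq_iff[THEN iffD1, OF mult_closed collapse_closed, symmetric])
qed

text \<open>
  The outer induction supplies that insertions into \<open>C\<^sub>k\<close> give elements of the radical power
  \<open>k + 1\<close>; the inner one goes down on the filtration degree, from degrees beyond \<open>n\<close> where nothing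
  is left.
\<close>

lemma cfilt_collapse_rad_pow:
  fixes z :: "'f::field_char_0 ncsym"
  shows "cfilt k z \<Longrightarrow> collapse n z \<in> rad_pow (invariant_algebra n) k"
proof (induction k arbitrary: z)
  case 0
  show ?case by (simp add: collapse_invariant)
next
  case (Suc k)
  note IH = Suc.IH
  let ?B = "invariant_algebra n :: (nat set list \<Rightarrow> 'f) ring"
  interpret B: comp_subalgebra n "carrier ?B" by (rule invariant_subalgebra)
  have B: "B.R = ?B" by (rule invariant_algebra_eq[symmetric])
  note closed = B.rad_pow_closed[unfolded B]
  have mult: "f \<otimes>\<^bsub>?B\<^esub> g = f \<otimes>\<^bsub>solomon_tits n\<^esub> g" and add: "f \<oplus>\<^bsub>?B\<^esub> g = (\<lambda>P. f P + g P)"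
    and zero: "\<zero>\<^bsub>?B\<^esub> = (\<lambda>P. 0)" for f g
    by (simp_all add: invariant_algebra_def solomon_tits_simps)
  let ?I = "{z. collapse n z \<in> rad_pow ?B (Suc k)}"
  have I: "ncp.subspace ?I"
  proof (rule ncp.subspaceI)
    show "0 \<in> ?I" using closed(2)[of "Suc k"] by (simp only: mem_Collect_eq collapse_linear zero)
    show "x + y \<in> ?I" if "x \<in> ?I" "y \<in> ?I" for x y
      using closed(3)[of "collapse n x" "Suc k" "collapse n y"] that
      by (simp only: mem_Collect_eq collapse_linear add)
    show "scl c x \<in> ?I" if "x \<in> ?I" for c x
      using closed(4)[OF B.scalar[of c], of "collapse n x" "Suc k"] that
      by (simp only: mem_Collect_eq collapse_linear mult scalar_mult[OF collapse_closed])
  qed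
  have rad: "collapse n (pair_insertion a b (hsym n)) \<in> jacobson_rad ?B" for a b
  proof -
    have "cfilt 1 (expand {1..n} (pair_insertion a b (hsym n :: 'f ncsym)))"
      by (intro cfilt_expand cfilt_insert_bracket cfilt_cmt) simp
    then show ?thesis
      unfolding B.jacobson_rad_eq[unfolded B] mem_Collect_eq words_of_collapse
      by (rule conjI[OF collapse_invariant])
  qed
  have "collapse n z \<in> rad_pow ?B (Suc k)" if "cfilt j z" "Suc k \<le> j" "n < j + t" for j t and z :: "'f ncsym"
    using that
  proof (induction t arbitrary: j z)
    case 0
    have "lookup z (Word (shape P)) = 0" if "P \<in> set_comps n" for P
    proof -
      have "length P \<le> n"
        using length_ordered_partition[of "{1..n}" P] that by (simp add: set_comps_ordered_partitions)
      then have "Word (shape P) \<notin> keys z"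
        using cfilt_long_words[OF 0(1), of "Word (shape P)"] 0(2,3) by (force simp: shape_def)
      then show ?thesis by (simp add: in_keys_iff)
    qed
    then have "collapse n z = collapse n 0" by (intro ext) (simp add: collapse_def)
    then show ?case using ncp.subspace_0[OF I] by (simp only: mem_Collect_eq)
  next
    case (Suc t)
    have "z \<in> ?I"
    proof (rule cfilt_in_subspace[OF psym_generate bracket_insertion_psym I _ _ _ Suc.prems(1)])
      show "x \<in> ?I" if "cfilt (Suc j) x" for x :: "'f ncsym"
        unfolding mem_Collect_eq by (rule Suc.IH[OF that]) (use Suc.prems in simp_all)
      show "pair_insertion a b x \<in> ?I" if "0 < a" "0 < b" "cfilt (j - 1) x" for a b and x :: "'f ncsym"
      proof -
        have "cfilt k x" using that(3) by (rule cfilt_mono) (use Suc.prems(2) in simp)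
        then have "collapse n x \<in> rad_pow ?B k" by (rule IH)
        then have "collapse n x \<otimes>\<^bsub>?B\<^esub> collapse n (pair_insertion a b (hsym n)) \<in> rad_pow ?B (Suc k)"
          using rad by (rule B.rad_pow_mult_rad[unfolded B])
        then show ?thesis
          unfolding mem_Collect_eq mult by (subst collapse_pair_insertion[OF that(1,2)])
      qed
      show "0 < j" using Suc.prems(2) by simp
    qed
    then show ?case unfolding mem_Collect_eq .
  qed
  note step = this
  show ?case by (rule step[OF Suc.prems le_refl, of n]) simp
qed

theorem theorem9p10:
  fixes n k :: nat
  shows "rad_pow (invariant_algebra n :: (nat set list \<Rightarrow> 'f::field_char_0) ring) k =
         carrier (invariant_algebra n) \<inter> rad_pow (solomon_tits n) k"
proof
  let ?A = "solomon_tits n :: (nat set list \<Rightarrow> 'f) ring" and ?B = "invariant_algebra n :: (nat set list \<Rightarrow> 'f) ring"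
  interpret A: comp_subalgebra n "carrier ?A" by (rule solomon_tits_subalgebra)
  interpret B: comp_subalgebra n "carrier ?B" by (rule invariant_subalgebra)
  have A: "A.R = ?A" by simp
  have B: "B.R = ?B" by (rule invariant_algebra_eq[symmetric])
  show "carrier ?B \<inter> rad_pow ?A k \<subseteq> rad_pow ?B k"
  proof
    fix f assume f: "f \<in> carrier ?B \<inter> rad_pow ?A k"
    then have "cfilt k (words_of n f)" using A.rad_pow_cfilt[unfolded A] by simp
    then obtain z where "cfilt k z" "f = collapse n z" using invariant_cfilt f by blast
    then show "f \<in> rad_pow ?B k" using cfilt_collapse_rad_pow by simp
  qed
  have rad: "jacobson_rad ?B \<subseteq> jacobson_rad ?A"
    using A.jacobson_rad_eq[unfolded A] B.jacobson_rad_eq[unfolded B] B.K_subset by auto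
  have "rad_pow ?B k \<subseteq> rad_pow ?A k"
  proof (induction k)
    case 0
    then show ?case using B.K_subset by simp
  next
    case (Suc k)
    show ?case
    proof
      fix f assume "f \<in> rad_pow ?B (Suc k)"
      then have "f \<in> ideal_prod ?B (jacobson_rad ?B) (rad_pow ?B k)" by simp
      then have "f \<in> ideal_prod ?A (jacobson_rad ?A) (rad_pow ?A k)"
      proof induction
        case (prod i j)
        then have "i \<otimes>\<^bsub>?A\<^esub> j \<in> ideal_prod ?A (jacobson_rad ?A) (rad_pow ?A k)"
          using rad Suc.IH by (intro ideal_prod.prod) auto
        then show ?case by (simp add: invariant_algebra_def)
      next
        case (sum x y)
        then have "x \<oplus>\<^bsub>?A\<^esub> y \<in> ideal_prod ?A (jacobson_rad ?A) (rad_pow ?A k)"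
          by (intro ideal_prod.sum)
        then show ?case by (simp add: invariant_algebra_def)
      qed
      then show "f \<in> rad_pow ?A (Suc k)" by simp
    qed
  qed
  then show "rad_pow ?B k \<subseteq> carrier ?B \<inter> rad_pow ?A k"
    using B.rad_pow_closed(1)[unfolded B] by blast
qed

end
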